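(* Let $X=\{1,2\}$, $\Omega=\{1,\dots,d\}^{\mathbb{N}}$ with $d\ge2$, let $\mu$ be a probability measure on $X$, and let $c:X\times\Omega\to\mathbb{R}$ be a cost such that $c(x,y)$ depends only on $x$ and on the two first coordinates $y_1,y_2$ of $y$. Let $\tilde\varphi:X\to\mathbb{R}$ be the unique minimizer of the left-hand side of the duality equation $$\inf_{\varphi:X\to\mathbb{R},\ P(c-\varphi)=0}\int_X\varphi\,d\mu=\sup_{\pi\in\Pi(\mu,\sigma)}\left(\int_{X\times\Omega}c\,d\pi+H(\pi)\right),$$ let $A=c-\tilde\varphi$, i.e. $A(x,y)=c(x,y)-\tilde\varphi(x)$, and let $\bar A$ be the normalized cost associated to $A$. Fix any $(x^0,y^0)\in X\times\Omega$ and define a random sequence in $X\times\Omega$ by recurrence: given $(x^k,y^k)$, $$(x^{k+1},y^{k+1})=(\alpha,iy^k)\quad\text{with probability}\quad e^{\bar A(\alpha,iy^k)},\qquad \alpha\in X,\ 1\le i\le d.$$ Then, for any continuous function $f:X\times\Omega\to\mathbb{R}$, almost surely, $$\frac1N\sum_{k=0}^{N-1}f(x^k,y^k)\longrightarrow\int_{X\times\Omega} f\,d\pi_A\quad(N\to\infty),$$ where $\pi_A=\pi_{c,\mu}$ is the plan in $\Pi(\mu,\sigma)$ attaining the supremum $\sup_{\pi\in\Pi(\mu,\sigma)}\left(\int c\,d\pi+H(\pi)\right)$.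
   Context: $\Omega$ is the Bernoulli space with a usual metric $d_\theta(y,w)=\theta^{\min\{k:\,y_k\ne w_k\}}$, $0<\theta<1$; $\sigma:\Omega\to\Omega$ is the shift; $iy=(i,y_1,y_2,\dots)$. A plan is a Borel probability measure on $X\times\Omega$. $\Pi(\cdot,\sigma)$ is the set of plans whose marginal on $\Omega$ is $\sigma$-invariant; $\Pi(\mu,\sigma)$ is the set of plans in $\Pi(\cdot,\sigma)$ whose marginal on $X$ is $\mu$. Entropy of a plan: let $\pi\in\Pi(\cdot,\sigma)$ have $\Omega$-marginal $\nu$. Put $J^n_\pi(x,y)=\dfrac{\pi([x,y_1\dots y_n])}{\nu([y_2\dots y_n])}$ when $(y_2,y_3,\dots)\in\operatorname{supp}\nu$, where $[x,y_1\dots y_n]=\{(\alpha,w)\in X\times\Omega:\alpha=x,\ w_1=y_1,\dots,w_n=y_n\}$ and $[y_2\dots y_n]=\{w\in\Omega:w_1=y_2,\dots,w_{n-1}=y_n\}$. The functions $J^n_\pi$ converge $\pi$-a.e. and in $L^1(\pi)$ to a function $J_\pi$, and $H(\pi)=-\int\log J_\pi\,d\pi$. Pressure: for a Lipschitz cost $c$, $P(c)=\sup_{\pi\in\Pi(\cdot,\sigma)}\left(\int c\,d\pi+H(\pi)\right)$. For $\varphi:X\to\mathbb{R}$, $(c-\varphi)(x,y)=c(x,y)-\varphi(x)$. Normalized cost: for a Lipschitz cost $A:X\times\Omega\to\mathbb{R}$ let $L_A(v)(y)=\sum_{x\in X}\sum_{\sigma(w)=y}e^{A(x,w)}v(w)$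 for $v\in C(\Omega)$. $L_A$ has a maximal eigenvalue $\lambda_A>0$, which is simple, with a positive eigenfunction $h_A:\Omega\to(0,\infty)$. The normalized cost associated to $A$ is $\bar A(x,y)=A(x,y)+\log h_A(y)-\log h_A(\sigma(y))-\log\lambda_A$; it satisfies $\sum_{x\in X}\sum_{\sigma(w)=y}e^{\bar A(x,w)}=1$ for all $y\in\Omega$. The random sequence is the Markov process on $X\times\Omega$ started at the deterministic point $(x^0,y^0)$ with the stated transition probabilities; "almost surely" refers to its law. *)

theory Defs
  imports "HOL-Probability.Probability"
begin

definition Xset :: "nat set" where
  "Xset = {1, 2}"

text \<open>
  Sequences are indexed from 0, so \<open>y 0, y 1, \<dots>\<close> are the coordinates \<open>y\<^sub>1, y\<^sub>2, \<dots>\<close>.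
  As a subset of \<open>nat \<Rightarrow> nat\<close> the Bernoulli space carries the product topology of the
  discrete topologies, which is the topology of every metric
  \<open>d(y, w) = \<theta> ^ min {k. y k \<noteq> w k}\<close> with \<open>0 < \<theta> < 1\<close>.
\<close>

definition Omega :: "nat \<Rightarrow> (nat \<Rightarrow> nat) set" where
  "Omega d = UNIV \<rightarrow> {1..d}"

definition shift :: "(nat \<Rightarrow> nat) \<Rightarrow> nat \<Rightarrow> nat" where
  "shift y = (\<lambda>n. y (Suc n))"

definition scons :: "nat \<Rightarrow> (nat \<Rightarrow> nat) \<Rightarrow> nat \<Rightarrow> nat" where
  "scons i y = case_nat i y"

definition cylinder :: "nat \<Rightarrow> nat \<Rightarrow> (nat \<Rightarrow> nat) \<Rightarrow> (nat \<Rightarrow> nat) set" where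
  "cylinder d n y = {w \<in> Omega d. \<forall>k<n. w k = y k}"

definition plans :: "nat \<Rightarrow> (nat \<times> (nat \<Rightarrow> nat)) measure set" where
  "plans d = {\<pi>. prob_space \<pi> \<and> sets \<pi> = sets (restrict_space borel (Xset \<times> Omega d))}"

definition X_marginal :: "(nat \<times> (nat \<Rightarrow> nat)) measure \<Rightarrow> nat measure" where
  "X_marginal \<pi> = distr \<pi> (count_space Xset) fst"

definition Omega_marginal :: "nat \<Rightarrow> (nat \<times> (nat \<Rightarrow> nat)) measure \<Rightarrow> (nat \<Rightarrow> nat) measure" where
  "Omega_marginal d \<pi> = distr \<pi> (restrict_space borel (Omega d)) snd"

definition inv_plans :: "nat \<Rightarrow> (nat \<times> (nat \<Rightarrow> nat)) measure set" where
  "inv_plans d = {\<pi> \<in> plans d. distr (Omega_marginal d \<pi>) (restrict_space borel (Omega d)) shift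
     = Omega_marginal d \<pi>}"

definition inv_plans_with :: "nat \<Rightarrow> nat measure \<Rightarrow> (nat \<times> (nat \<Rightarrow> nat)) measure set" where
  "inv_plans_with d \<mu> = {\<pi> \<in> inv_plans d. X_marginal \<pi> = \<mu>}"

definition supp :: "'a::topological_space measure \<Rightarrow> 'a set" where
  "supp \<nu> = {y \<in> space \<nu>. \<forall>U. open U \<and> y \<in> U \<longrightarrow> emeasure \<nu> (U \<inter> space \<nu>) > 0}"

text \<open>
  The value 0 off the support is a convention, relevant only on a \<open>\<pi>\<close>-null set when the
  \<open>\<Omega>\<close>-marginal is shift-invariant. Likewise \<open>J_plan\<close> is the \<open>\<pi>\<close>-almost sure limit, with
  an unspecified value where the limit does not exist.
\<close>

definition Jn_plan ::
    "nat \<Rightarrow> (nat \<times> (nat \<Rightarrow> nat)) measure \<Rightarrow> nat \<Rightarrow> nat \<times> (nat \<Rightarrow> nat) \<Rightarrow> real" where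
  "Jn_plan d \<pi> n = (\<lambda>(x, y).
     if shift y \<in> supp (Omega_marginal d \<pi>)
     then measure \<pi> ({x} \<times> cylinder d n y)
       / measure (Omega_marginal d \<pi>) (cylinder d (n - 1) (shift y))
     else 0)"

definition J_plan ::
    "nat \<Rightarrow> (nat \<times> (nat \<Rightarrow> nat)) measure \<Rightarrow> nat \<times> (nat \<Rightarrow> nat) \<Rightarrow> real" where
  "J_plan d \<pi> z = lim (\<lambda>n. Jn_plan d \<pi> n z)"

definition plan_entropy :: "nat \<Rightarrow> (nat \<times> (nat \<Rightarrow> nat)) measure \<Rightarrow> real" where
  "plan_entropy d \<pi> = - (\<integral>z. ln (J_plan d \<pi> z) \<partial>\<pi>)"

definition pressure :: "nat \<Rightarrow> (nat \<times> (nat \<Rightarrow> nat) \<Rightarrow> real) \<Rightarrow> real" where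
  "pressure d c = (SUP \<pi>\<in>inv_plans d. (\<integral>z. c z \<partial>\<pi>) + plan_entropy d \<pi>)"

definition cost_minus ::
    "(nat \<times> (nat \<Rightarrow> nat) \<Rightarrow> real) \<Rightarrow> (nat \<Rightarrow> real) \<Rightarrow> nat \<times> (nat \<Rightarrow> nat) \<Rightarrow> real" where
  "cost_minus c \<phi> = (\<lambda>(x, y). c (x, y) - \<phi> x)"

definition transfer_op ::
    "nat \<Rightarrow> (nat \<times> (nat \<Rightarrow> nat) \<Rightarrow> real) \<Rightarrow> ((nat \<Rightarrow> nat) \<Rightarrow> real) \<Rightarrow> (nat \<Rightarrow> nat) \<Rightarrow> real" where
  "transfer_op d A v y = (\<Sum>x\<in>Xset. \<Sum>w\<in>{w \<in> Omega d. shift w = y}. exp (A (x, w)) * v w)"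

definition is_eigenvalue :: "nat \<Rightarrow> (nat \<times> (nat \<Rightarrow> nat) \<Rightarrow> real) \<Rightarrow> real \<Rightarrow> bool" where
  "is_eigenvalue d A l \<longleftrightarrow> (\<exists>v. continuous_on (Omega d) v \<and> (\<exists>y\<in>Omega d. v y \<noteq> 0) \<and>
     (\<forall>y\<in>Omega d. transfer_op d A v y = l * v y))"

definition max_eigenvalue :: "nat \<Rightarrow> (nat \<times> (nat \<Rightarrow> nat) \<Rightarrow> real) \<Rightarrow> real" where
  "max_eigenvalue d A = (GREATEST l. is_eigenvalue d A l)"

text \<open>
  The positive eigenfunction is determined on \<open>Omega d\<close> up to a positive factor (the maximal
  eigenvalue is simple); the normalized cost does not depend on that factor.
\<close>

definition pos_eigenfun :: "nat \<Rightarrow> (nat \<times> (nat \<Rightarrow> nat) \<Rightarrow> real) \<Rightarrow> (nat \<Rightarrow> nat) \<Rightarrow> real" where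
  "pos_eigenfun d A = (SOME h. continuous_on (Omega d) h \<and> (\<forall>y\<in>Omega d. h y > 0) \<and>
     (\<forall>y\<in>Omega d. transfer_op d A h y = max_eigenvalue d A * h y))"

definition normalized_cost ::
    "nat \<Rightarrow> (nat \<times> (nat \<Rightarrow> nat) \<Rightarrow> real) \<Rightarrow> nat \<times> (nat \<Rightarrow> nat) \<Rightarrow> real" where
  "normalized_cost d A = (\<lambda>(x, y). A (x, y) + ln (pos_eigenfun d A y)
     - ln (pos_eigenfun d A (shift y)) - ln (max_eigenvalue d A))"

text \<open>
  Each \<open>Z k\<close> almost surely takes finitely many values, so conditioning on the histories
  \<open>h 0, \<dots>, h k\<close> of positive probability determines the law of the process.
\<close>

definition random_sequence ::
    "nat \<Rightarrow> (nat \<times> (nat \<Rightarrow> nat) \<Rightarrow> real) \<Rightarrow> nat \<times> (nat \<Rightarrow> nat) \<Rightarrow> 'w measure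
     \<Rightarrow> (nat \<Rightarrow> 'w \<Rightarrow> nat \<times> (nat \<Rightarrow> nat)) \<Rightarrow> bool" where
  "random_sequence d Abar z0 M Z \<longleftrightarrow>
     prob_space M \<and>
     (\<forall>k. Z k \<in> measurable M (restrict_space borel (Xset \<times> Omega d))) \<and>
     (AE \<omega> in M. Z 0 \<omega> = z0) \<and>
     (\<forall>k h. \<P>(\<omega> in M. \<forall>j\<le>k. Z j \<omega> = h j) > 0 \<longrightarrow>
       (\<forall>\<alpha>\<in>Xset. \<forall>i\<in>{1..d}.
         \<P>(\<omega> in M. Z (Suc k) \<omega> = (\<alpha>, scons i (snd (h k))) \<bar> \<forall>j\<le>k. Z j \<omega> = h j)
           = exp (Abar (\<alpha>, scons i (snd (h k))))))"

end

theory Submission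
  imports Defs
begin

text \<open>
  Write \<open>A = c - \<phi>m\<close>. As \<open>A (x, y)\<close> depends on \<open>x, y 0, y 1\<close> only, the transfer operator acts
  on functions of the first letter as a positive \<open>d \<times> d\<close> matrix. Perron and Frobenius give an
  eigenvalue \<open>lam\<close> and a positive eigenvector \<open>h\<close> (\<open>perron_frobenius\<close>), and the normalized cost is the
  logarithm of the stochastic kernel \<open>g x i j = exp (A x i j) * h i / (lam * h j)\<close>
  (\<open>exp_normalized_cost\<close>). The random sequence is therefore a Markov chain with transition operator
  \<open>markov_op f (x, y) = (\<Sum>\<alpha> i. g \<alpha> i (y 0) * f (\<alpha>, iy))\<close>.

  This operator contracts oscillations: its \<open>n\<close>-th power forgets all but the first letter of a function of
  \<open>n\<close> letters, and on functions of one letter Doeblin's argument applies. Hence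
  \<open>markov_op ^^ n\<close> applied to a continuous \<open>f\<close> tends uniformly to a constant \<open>lim_mean f\<close>
  (\<open>markov_op_pow_tendsto_uniform\<close>). Writing \<open>f - markov_op ^^ n f = u - markov_op u\<close>, the time averages
  of \<open>f\<close> along the chain are, up to a small error, those of a martingale with bounded increments, whose
  variance grows linearly; along squares the Borel--Cantelli lemma applies, and almost surely the
  averages tend to \<open>lim_mean f\<close> (\<open>AE_ergodic\<close>).

  It remains to show that \<open>\<integral> f d\<pi> = lim_mean f\<close>. For any invariant plan, Gibbs' inequality bounds
  \<open>\<integral> A d\<pi> + H(\<pi>)\<close> by \<open>ln lam\<close>, and equality forces the cylinder weights to satisfy
  \<open>\<pi>[x, i l] = g x i (hd l) * \<nu>[l]\<close> (\<open>entropy_subkernel\<close>), which says that \<open>\<pi>\<close> is invariant under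
  \<open>markov_op\<close> and so integrates \<open>f\<close> to \<open>lim_mean f\<close>. The entropy is defined through an almost everywhere
  limit of the functions \<open>Jn_plan\<close>; that limit exists by a differentiation theorem for measures on
  sequences (\<open>AE_convergent_ratio\<close>), and by Fatou's lemma the entropy is at most each of its finite
  approximations. Conversely a plan with these weights exists by Kolmogorov extension and attains
  \<open>ln lam\<close>, so the pressure of \<open>A\<close> is \<open>ln lam\<close>.

  Finally, since \<open>\<phi>m\<close> is a minimizer, \<open>pressure (A - t \<psi>) \<ge> - t * \<integral> \<psi> d\<mu>\<close> for all \<open>t\<close>, while a test function
  built from an approximate solution of the Poisson equation gives the first order upper bound
  \<open>- t * lim_mean \<psi>\<close> (\<open>pressure_first_order\<close>). So the plan of the kernel has \<open>X\<close>-marginal \<open>\<mu>\<close>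
  and competes in the constrained problem. The maximizer \<open>\<pi>\<close> does at least as well, hence
  attains the unconstrained bound \<open>ln lam\<close>, and the equality case above applies to it.
\<close>

section \<open>Words and cylinders\<close>

text \<open>
  Words of length \<open>n\<close> over the alphabet \<open>{1..d}\<close>.
\<close>

definition words :: "nat \<Rightarrow> nat \<Rightarrow> nat list set" where
  "words d n = {l. set l \<subseteq> {1..d} \<and> length l = n}"

text \<open>
  The prefix of length \<open>n\<close> of a sequence.
\<close>

definition pre :: "nat \<Rightarrow> (nat \<Rightarrow> nat) \<Rightarrow> nat list" where
  "pre n y = map y [0..<n]"

text \<open>
  The cylinder of a word, taken in the space of all sequences. The word determines the length,
  and letters outside \<open>{1..d}\<close> are allowed.
\<close>

definition cyl :: "nat list \<Rightarrow> (nat \<Rightarrow> nat) set" where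
  "cyl l = {y. pre (length l) y = l}"

lemma finite_words [simp]: "finite (words d n)"
  unfolding words_def by (rule finite_lists_length_eq) simp

lemma words_0 [simp]: "words d 0 = {[]}"
  by (auto simp: words_def)

lemma length_words: "l \<in> words d n \<Longrightarrow> length l = n"
  by (simp add: words_def)

lemma Cons_in_words [simp]: "i # l \<in> words d (Suc n) \<longleftrightarrow> i \<in> {1..d} \<and> l \<in> words d n"
  by (auto simp: words_def)

lemma snoc_in_words [simp]: "l @ [i] \<in> words d (Suc n) \<longleftrightarrow> i \<in> {1..d} \<and> l \<in> words d n"
  by (auto simp: words_def)

lemma sum_words_Cons: "(\<Sum>l\<in>words d (Suc n). F l) = (\<Sum>i\<in>{1..d}. \<Sum>l\<in>words d n. F (i # l))"
proof -
  have eq: "words d (Suc n) = (\<lambda>(i, l). i # l) ` ({1..d} \<times> words d n)"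
    unfolding words_def by (auto simp: length_Suc_conv image_iff)
  show ?thesis
    unfolding eq by (subst sum.reindex) (auto simp: inj_on_def sum.cartesian_product split_beta)
qed

lemma sum_words_snoc: "(\<Sum>l\<in>words d (Suc n). F l) = (\<Sum>l\<in>words d n. \<Sum>i\<in>{1..d}. F (l @ [i]))"
proof -
  have eq: "words d (Suc n) = (\<lambda>(l, i). l @ [i]) ` (words d n \<times> {1..d})"
  proof (intro set_eqI iffI)
    fix l assume l: "l \<in> words d (Suc n)"
    then have ne: "l \<noteq> []" by (auto simp: words_def)
    then have "l = butlast l @ [last l]" by simp
    moreover have "last l \<in> {1..d}" using l last_in_set[OF ne] by (auto simp: words_def)
    moreover have "butlast l \<in> words d n" using l by (auto simp: words_def dest: in_set_butlastD)
    ultimately show "l \<in> (\<lambda>(l, i). l @ [i]) ` (words d n \<times> {1..d})"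
      by (intro image_eqI[where x = "(butlast l, last l)"]) auto
  qed auto
  show ?thesis
    unfolding eq by (subst sum.reindex) (auto simp: inj_on_def sum.cartesian_product split_beta)
qed

lemma length_pre [simp]: "length (pre n y) = n"
  by (simp add: pre_def)

lemma pre_0 [simp]: "pre 0 y = []"
  by (simp add: pre_def)

lemma pre_Suc_snoc: "pre (Suc n) y = pre n y @ [y n]"
  by (simp add: pre_def)

lemma pre_Suc_Cons: "pre (Suc n) y = y 0 # pre n (shift y)"
  by (simp add: pre_def shift_def map_upt_Suc del: upt_Suc)

lemma nth_pre [simp]: "k < n \<Longrightarrow> pre n y ! k = y k"
  by (simp add: pre_def)

lemma pre_eq_iff: "pre n y = pre n w \<longleftrightarrow> (\<forall>k<n. y k = w k)"
  by (auto simp: list_eq_iff_nth_eq)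

lemma take_pre: "m \<le> n \<Longrightarrow> take m (pre n y) = pre m y"
  by (simp add: list_eq_iff_nth_eq)

lemma pre_in_words: "y \<in> Omega d \<Longrightarrow> pre n y \<in> words d n"
  by (auto simp: words_def pre_def Omega_def)

lemma in_cyl_iff: "y \<in> cyl l \<longleftrightarrow> pre (length l) y = l"
  by (simp add: cyl_def)

lemma cyl_Nil [simp]: "cyl [] = UNIV"
  by (simp add: cyl_def)

lemma cyl_pre: "w \<in> cyl (pre n y) \<longleftrightarrow> pre n w = pre n y"
  by (simp add: cyl_def)

lemma cyl_antimono: "m \<le> n \<Longrightarrow> cyl (pre n y) \<subseteq> cyl (pre m y)"
  by (auto simp: cyl_pre pre_eq_iff)

lemma cylinder_eq: "cylinder d n y = cyl (pre n y) \<inter> Omega d"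
  by (auto simp: cylinder_def cyl_pre pre_eq_iff)

lemma scons_simps [simp]: "scons i y 0 = i" "scons i y (Suc n) = y n" "shift (scons i y) = y"
  by (auto simp: scons_def shift_def)

lemma scons_shift: "scons (y 0) (shift y) = y"
  by (auto simp: scons_def shift_def fun_eq_iff split: nat.split)

lemma scons_in_Omega [simp]: "scons i y \<in> Omega d \<longleftrightarrow> i \<in> {1..d} \<and> y \<in> Omega d"
proof
  assume *: "scons i y \<in> Omega d"
  have "y n \<in> {1..d}" for n using * by (auto simp: Omega_def Pi_iff dest: spec[of _ "Suc n"])
  moreover have "i \<in> {1..d}" using * by (auto simp: Omega_def Pi_iff dest: spec[of _ 0])
  ultimately show "i \<in> {1..d} \<and> y \<in> Omega d" by (auto simp: Omega_def)
qed (auto simp: Omega_def scons_def Pi_iff split: nat.split)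

lemma shift_in_Omega: "y \<in> Omega d \<Longrightarrow> shift y \<in> Omega d"
  by (auto simp: Omega_def shift_def)

lemma Omega_nth: "y \<in> Omega d \<Longrightarrow> y n \<in> {1..d}"
  by (auto simp: Omega_def)

lemma Omega_nth_bounds: "y \<in> Omega d \<Longrightarrow> Suc 0 \<le> y n" "y \<in> Omega d \<Longrightarrow> y n \<le> d"
  using Omega_nth[of y d n] by auto

lemma pre_scons: "pre (Suc n) (scons i y) = i # pre n y"
  by (simp add: pre_Suc_Cons)

lemma shift_vimage: "{w \<in> Omega d. shift w = y} = (\<lambda>i. scons i y) ` {1..d}" if "y \<in> Omega d"
proof (intro set_eqI iffI)
  fix w assume "w \<in> {w \<in> Omega d. shift w = y}"
  then have "w = scons (w 0) y" "w 0 \<in> {1..d}" using scons_shift[of w] Omega_nth[of w] by auto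
  then show "w \<in> (\<lambda>i. scons i y) ` {1..d}" by blast
qed (use that in auto)

lemma inj_scons: "inj_on (\<lambda>i. scons i y) S"
  by (rule inj_on_inverseI[where g = "\<lambda>w. w 0"]) simp

lemma continuous_coord: "continuous_on S (\<lambda>y::nat \<Rightarrow> nat. y k)"
  by (rule continuous_on_subset[OF continuous_on_product_coordinates]) simp

lemma measurable_coord [measurable]: "(\<lambda>y::nat \<Rightarrow> nat. y k) \<in> borel \<rightarrow>\<^sub>M count_space UNIV"
proof -
  have "(borel :: (nat \<Rightarrow> nat) measure) \<rightarrow>\<^sub>M (borel :: nat measure) = borel \<rightarrow>\<^sub>M count_space UNIV"
    by (rule measurable_cong_sets) (rule refl, rule sets_borel_eq_count_space)
  with borel_measurable_continuous_onI[OF continuous_coord[of UNIV k]]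
  show ?thesis by (rule back_subst)
qed

lemma continuous_shift: "continuous_on S shift"
proof -
  have "continuous_on S (\<lambda>(y::nat \<Rightarrow> nat) n. y (Suc n))"
    by (rule continuous_on_coordinatewise_then_product) (rule continuous_coord)
  then show ?thesis unfolding shift_def[abs_def] .
qed

lemma borel_measurable_shift [measurable]: "shift \<in> borel \<rightarrow>\<^sub>M borel"
  by (rule borel_measurable_continuous_onI[OF continuous_shift])

lemma open_cyl: "open (cyl l)"
proof -
  have "cyl l = (\<Inter>k<length l. (\<lambda>y. y k) -` {l ! k})"
    by (auto simp: cyl_def list_eq_iff_nth_eq)
  moreover have "open ((\<lambda>y. y k) -` {l ! k} :: (nat \<Rightarrow> nat) set)" for k
    using open_vimage[of "{l ! k}" "\<lambda>y::nat \<Rightarrow> nat. y k"] continuous_coord[of UNIV k] by (simp add: discrete_topology_class.open_discrete)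
  ultimately show ?thesis by auto
qed

lemma sets_cyl [measurable, simp]: "cyl l \<in> sets borel"
  using open_cyl by (rule borel_open)

lemma measurable_pre [measurable]: "pre n \<in> borel \<rightarrow>\<^sub>M count_space UNIV"
proof (subst measurable_count_space_eq_countable)
  have "pre n -` {l} = (if length l = n then cyl l else {})" for l
    by (auto simp: cyl_def)
  then show "pre n \<in> space borel \<rightarrow> UNIV \<and> (\<forall>l\<in>UNIV. pre n -` {l} \<inter> space borel \<in> sets borel)"
    by auto
qed auto

lemma open_contains_cyl:
  assumes "open U" "y \<in> U"
  obtains n where "cyl (pre n y) \<subseteq> U"
proof -
  have "openin (product_topology (\<lambda>i::nat. euclidean) UNIV) U"
    using assms by (simp add: euclidean_product_topology)
  then have "\<exists>X. y \<in> Pi\<^sub>E UNIV X \<and> (\<forall>i. openin euclidean (X i)) \<and>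
      finite {i. X i \<noteq> topspace euclidean} \<and> Pi\<^sub>E UNIV X \<subseteq> U"
    by (rule product_topology_open_contains_basis[OF _ \<open>y \<in> U\<close>])
  then obtain X where X: "y \<in> Pi\<^sub>E UNIV X" "finite {i. X i \<noteq> UNIV}" "Pi\<^sub>E UNIV X \<subseteq> U"
    unfolding topspace_euclidean by blast
  obtain n where n: "\<forall>i\<in>{i. X i \<noteq> UNIV}. i < n"
    using X(2) unfolding finite_nat_set_iff_bounded by blast
  have "cyl (pre n y) \<subseteq> Pi\<^sub>E UNIV X"
  proof
    fix w assume "w \<in> cyl (pre n y)"
    then have w: "w k = y k" if "k < n" for k using that by (simp add: cyl_pre pre_eq_iff)
    have "w i \<in> X i" for i
      using X(1) n w[of i] by (cases "X i = UNIV") (auto simp: PiE_iff)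
    then show "w \<in> Pi\<^sub>E UNIV X" by auto
  qed
  from subset_trans[OF this X(3)] show thesis by (rule that)
qed

lemma open_eq_UN_cyl:
  assumes "open U" shows "U = (\<Union>l\<in>{l. cyl l \<subseteq> U}. cyl l)"
proof (intro set_eqI iffI)
  fix y assume "y \<in> U"
  then obtain n where "cyl (pre n y) \<subseteq> U" using open_contains_cyl[OF assms] by blast
  moreover have "y \<in> cyl (pre n y)" by (simp add: cyl_pre)
  ultimately show "y \<in> (\<Union>l\<in>{l. cyl l \<subseteq> U}. cyl l)" by blast
qed blast

lemma borel_eq_sigma_cyl: "(borel :: (nat \<Rightarrow> nat) measure) = sigma UNIV (range cyl)"
  unfolding borel_def
proof (rule sigma_eqI)
  show "sigma_sets UNIV {S. open S} = sigma_sets UNIV (range cyl)"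
  proof (rule sigma_sets_eqI)
    fix U :: "(nat \<Rightarrow> nat) set" assume "U \<in> {S. open S}"
    then have "U = (\<Union>l\<in>{l. cyl l \<subseteq> U}. cyl l)" by (intro open_eq_UN_cyl) simp
    also have "\<dots> \<in> sigma_sets UNIV (range cyl)"
      by (rule sigma_sets_UNION) (auto intro!: sigma_sets.Basic)
    finally show "U \<in> sigma_sets UNIV (range cyl)" .
  qed (auto intro!: sigma_sets.Basic open_cyl)
qed auto

lemma cyl_Int: "cyl l \<inter> cyl l' \<in> insert {} (range cyl)"
proof (cases "cyl l \<inter> cyl l' = {}")
  case False
  then obtain y where y: "y \<in> cyl l" "y \<in> cyl l'" by auto
  have *: "cyl (pre m y) \<inter> cyl (pre n y) = cyl (pre (max m n) y)" for m n
    by (auto simp: cyl_pre pre_eq_iff less_max_iff_disj)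
  show ?thesis using y *[of "length l" "length l'"] by (auto simp: in_cyl_iff)
qed auto

text \<open>
  Cylinders are stable under intersection (up to the empty set) and generate the Borel sets.
\<close>

lemma finite_measure_eqI_cyl:
  assumes M: "finite_measure M" "sets M = sets borel" and N: "finite_measure N" "sets N = sets borel"
    and eq: "\<And>l. measure M (cyl l) = measure N (cyl l)"
  shows "M = N"
proof (rule measure_eqI_generator_eq[where E = "insert {} (range cyl)" and \<Omega> = UNIV and A = "\<lambda>_. UNIV"])
  show "Int_stable (insert {} (range cyl))"
    using cyl_Int by (auto simp: Int_stable_def)
  have "sigma_sets UNIV (insert {} (range cyl)) = sigma_sets UNIV (range cyl)"
    by (rule sigma_sets_eqI) (auto intro: sigma_sets.intros)
  then have "sets (borel::(nat \<Rightarrow> nat) measure) = sigma_sets UNIV (insert {} (range cyl))"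
    by (subst borel_eq_sigma_cyl) simp
  then show "sets M = sigma_sets UNIV (insert {} (range cyl))" "sets N = sigma_sets UNIV (insert {} (range cyl))"
    using M(2) N(2) by auto
  show "emeasure M X = emeasure N X" if "X \<in> insert {} (range cyl)" for X
    using that eq by (auto simp: finite_measure.emeasure_eq_measure[OF M(1)]
      finite_measure.emeasure_eq_measure[OF N(1)])
  show "range (\<lambda>_. UNIV) \<subseteq> insert {} (range cyl)"
    using cyl_Nil by (metis image_subsetI insertCI rangeI)
  show "emeasure M UNIV \<noteq> \<infinity>" using finite_measure.emeasure_finite[OF M(1)] by simp
qed auto

section \<open>Differentiation along cylinders\<close>

text \<open>
  A bound between two measures on each cylinder of a family passes to the union of the family,
  because the union is the disjoint union of the maximal cylinders.
\<close>

lemma measure_UN_cyl_le: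
  assumes \<alpha>: "finite_measure \<alpha>" "sets \<alpha> = sets borel" and \<beta>: "finite_measure \<beta>" "sets \<beta> = sets borel"
    and k: "k \<ge> 0"
    and le: "\<And>l. R l \<Longrightarrow> measure \<alpha> (cyl l) \<le> k * measure \<beta> (cyl l)"
  shows "measure \<alpha> (\<Union>l\<in>Collect R. cyl l) \<le> k * measure \<beta> (\<Union>l\<in>Collect R. cyl l)"
proof -
  interpret \<alpha>: finite_measure \<alpha> by fact
  interpret \<beta>: finite_measure \<beta> by fact
  \<comment> \<open>The shortest words of the family: those without a proper prefix in it.\<close>
  define L where "L = {l. R l \<and> (\<forall>m<length l. \<not> R (take m l))}"
  have cover: "(\<Union>l\<in>Collect R. cyl l) = (\<Union>l\<in>L. cyl l)"
  proof (intro set_eqI iffI)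
    fix y assume "y \<in> (\<Union>l\<in>Collect R. cyl l)"
    then obtain l where l: "R l" "y \<in> cyl l" by auto
    then have ex: "R (pre (length l) y)" by (simp add: in_cyl_iff)
    define n where "n = (LEAST n. R (pre n y))"
    have n: "R (pre n y)" unfolding n_def using ex by (rule LeastI)
    have "\<not> R (pre m y)" if "m < n" for m
      using that unfolding n_def by (rule not_less_Least)
    then have "pre n y \<in> L" using n by (auto simp: L_def take_pre)
    moreover have "y \<in> cyl (pre n y)" by (simp add: cyl_pre)
    ultimately show "y \<in> (\<Union>l\<in>L. cyl l)" by (rule UN_I)
  qed (auto simp: L_def)
  have disj: "disjoint_family_on cyl L"
    unfolding disjoint_family_on_def
  proof (intro ballI impI)
    fix l l' assume *: "l \<in> L" "l' \<in> L" "l \<noteq> l'"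
    show "cyl l \<inter> cyl l' = {}"
    proof (rule ccontr)
      assume "cyl l \<inter> cyl l' \<noteq> {}"
      then obtain y where y: "pre (length l) y = l" "pre (length l') y = l'" by (auto simp: cyl_def)
      have "length l \<noteq> length l'" using y * by metis
      then consider "length l < length l'" | "length l' < length l" by linarith
      then show False
      proof cases
        case 1
        have "take (length l) l' = l" using 1 y take_pre[of "length l" "length l'" y] by simp
        then show False using 1 * by (auto simp: L_def)
      next
        case 2
        have "take (length l') l = l'" using 2 y take_pre[of "length l'" "length l" y] by simp
        then show False using 2 * by (auto simp: L_def)
      qed
    qed
  qed
  have "emeasure \<alpha> (\<Union>l\<in>L. cyl l) = (\<integral>\<^sup>+ l. emeasure \<alpha> (cyl l) \<partial>count_space L)"
    using disj \<alpha>(2) by (intro emeasure_UN_countable) auto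
  also have "\<dots> \<le> (\<integral>\<^sup>+ l. ennreal k * emeasure \<beta> (cyl l) \<partial>count_space L)"
  proof (intro nn_integral_mono)
    fix l assume "l \<in> space (count_space L)"
    then have "measure \<alpha> (cyl l) \<le> k * measure \<beta> (cyl l)" by (intro le) (simp add: L_def)
    then show "emeasure \<alpha> (cyl l) \<le> ennreal k * emeasure \<beta> (cyl l)"
      using k by (simp add: \<alpha>.emeasure_eq_measure \<beta>.emeasure_eq_measure ennreal_mult[symmetric] ennreal_leI)
  qed
  also have "\<dots> = ennreal k * (\<integral>\<^sup>+ l. emeasure \<beta> (cyl l) \<partial>count_space L)"
    by (rule nn_integral_cmult) simp
  also have "(\<integral>\<^sup>+ l. emeasure \<beta> (cyl l) \<partial>count_space L) = emeasure \<beta> (\<Union>l\<in>L. cyl l)"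
    using disj \<beta>(2) by (intro emeasure_UN_countable[symmetric]) auto
  finally show ?thesis
    unfolding cover using k
    by (simp add: \<alpha>.emeasure_eq_measure \<beta>.emeasure_eq_measure ennreal_mult[symmetric] ennreal_le_iff)
qed

lemma not_convergent_crossing:
  fixes X :: "nat \<Rightarrow> real"
  assumes bnd: "\<And>n. 0 \<le> X n" "\<And>n. X n \<le> 1" and nc: "\<not> convergent X"
  shows "\<exists>a b::rat. 0 \<le> a \<and> a < b \<and> (\<exists>\<^sub>F n in sequentially. X n < of_rat a) \<and> (\<exists>\<^sub>F n in sequentially. X n > of_rat b)"
proof -
  let ?l = "liminf (\<lambda>n. ereal (X n))" and ?L = "limsup (\<lambda>n. ereal (X n))"
  have le: "?l \<le> ?L" by (rule Liminf_le_Limsup) simp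
  have l0: "0 \<le> ?l" by (rule Liminf_bounded) (simp add: bnd)
  have L1: "?L \<le> 1" by (rule Limsup_bounded) (simp add: bnd)
  have "?l \<noteq> ?L"
  proof
    assume eq: "?l = ?L"
    have "\<bar>?L\<bar> \<noteq> \<infinity>" using eq l0 L1 by auto
    then obtain r where r: "?L = ereal r" by auto
    then have "(\<lambda>n. ereal (X n)) \<longlonglongrightarrow> ereal r"
      using eq by (subst tendsto_iff_Liminf_eq_Limsup) auto
    then have "X \<longlonglongrightarrow> r" by simp
    then show False using nc by (auto simp: convergent_def)
  qed
  with le have "?l < ?L" by simp
  then obtain r where r: "?l < ereal (real_of_rat r)" "ereal (real_of_rat r) < ?L"
    using ereal_dense3 by blast
  then obtain s where s: "ereal (real_of_rat r) < ereal (real_of_rat s)" "ereal (real_of_rat s) < ?L"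
    using ereal_dense3[of "ereal (real_of_rat r)" ?L] by blast
  have "0 \<le> r" using le_less_trans[OF l0 r(1)] by (simp add: order_less_imp_le)
  moreover have "r < s" using s by (simp add: of_rat_less)
  moreover have "\<exists>\<^sub>F n in sequentially. X n < of_rat r"
  proof (rule ccontr)
    assume "\<not> ?thesis"
    then have "\<forall>\<^sub>F n in sequentially. ereal (of_rat r) \<le> ereal (X n)"
      by (simp add: not_frequently not_less)
    from Liminf_bounded[OF this] r(1) show False by simp
  qed
  moreover have "\<exists>\<^sub>F n in sequentially. X n > of_rat s"
  proof (rule ccontr)
    assume "\<not> ?thesis"
    then have "\<forall>\<^sub>F n in sequentially. ereal (X n) \<le> ereal (of_rat s)"
      by (simp add: not_frequently not_less)
    from Limsup_bounded[OF this] s(2) show False by simp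
  qed
  ultimately show ?thesis by blast
qed

text \<open>
  Martingale convergence in the form of a differentiation theorem. If the ratio oscillates at \<open>y\<close>
  across an interval \<open>a < b\<close>, then \<open>y\<close> lies in cylinders where the ratio is alternately below \<open>a\<close> and
  above \<open>b\<close>. Each pair of alternations shrinks the \<open>\<beta>\<close>-measure of the set of such points by the
  factor \<open>a / b\<close>, so the set is null.
\<close>

theorem AE_convergent_ratio:
  assumes \<alpha>: "finite_measure \<alpha>" "sets \<alpha> = sets borel" and \<beta>: "finite_measure \<beta>" "sets \<beta> = sets borel"
    and le: "\<And>l. measure \<alpha> (cyl l) \<le> measure \<beta> (cyl l)"
  shows "AE y in \<beta>. convergent (\<lambda>n. measure \<alpha> (cyl (pre n y)) / measure \<beta> (cyl (pre n y)))"
proof -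
  interpret \<alpha>: finite_measure \<alpha> by fact
  interpret \<beta>: finite_measure \<beta> by fact
  define X where "X y n = measure \<alpha> (cyl (pre n y)) / measure \<beta> (cyl (pre n y))" for y n
  define Low where "Low a U = (\<Union>l\<in>{l. cyl l \<subseteq> U \<and> measure \<alpha> (cyl l) \<le> a * measure \<beta> (cyl l)}. cyl l)" for a :: real and U
  define High where "High b U = (\<Union>l\<in>{l. cyl l \<subseteq> U \<and> measure \<beta> (cyl l) \<le> (1 / b) * measure \<alpha> (cyl l)}. cyl l)" for b :: real and U
  have open_Low: "open (Low a U)" and open_High: "open (High b U)" for a b U
    unfolding Low_def High_def by (intro open_UN ballI open_cyl)+
  have sub_Low: "Low a U \<subseteq> U" and sub_High: "High b U \<subseteq> U" for a b U
    unfolding Low_def High_def by auto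
  have m_Low: "measure \<alpha> (Low a U) \<le> a * measure \<beta> (Low a U)" if "a \<ge> 0" for a U
    unfolding Low_def by (rule measure_UN_cyl_le[OF \<alpha> \<beta> that]) simp
  have m_High: "measure \<beta> (High b U) \<le> (1 / b) * measure \<alpha> (High b U)" if "b > 0" for b U
    unfolding High_def by (rule measure_UN_cyl_le[OF \<beta> \<alpha>]) (use that in auto)
  have null: "\<exists>N\<in>null_sets \<beta>. {y. (\<exists>\<^sub>F n in sequentially. X y n < a) \<and> (\<exists>\<^sub>F n in sequentially. X y n > b)} \<subseteq> N"
    if ab: "0 \<le> a" "a < b" for a b
  proof -
    define W where "W k = ((\<lambda>U. High b (Low a U)) ^^ k) UNIV" for k
    have W_Suc: "W (Suc k) = High b (Low a (W k))" for k by (simp add: W_def)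
    have open_W: "open (W k)" for k
      by (cases k) (simp_all add: W_Suc open_High, simp add: W_def)
    have sets_W: "W k \<in> sets \<beta>" for k using open_W by (simp add: \<beta>(2))
    have W_le: "measure \<beta> (W k) \<le> (a / b) ^ k * measure \<beta> UNIV" for k
    proof (induction k)
      case (Suc k)
      have "measure \<beta> (W (Suc k)) \<le> (1 / b) * measure \<alpha> (High b (Low a (W k)))"
        unfolding W_Suc using ab by (intro m_High) simp
      also have "\<dots> \<le> (1 / b) * measure \<alpha> (Low a (W k))"
        using ab by (intro mult_left_mono \<alpha>.finite_measure_mono sub_High) (auto simp: \<alpha>(2) open_Low)
      also have "\<dots> \<le> (1 / b) * (a * measure \<beta> (Low a (W k)))"
        using ab by (intro mult_left_mono m_Low) auto
      also have "\<dots> \<le> (1 / b) * (a * measure \<beta> (W k))"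
        using ab by (intro mult_left_mono \<beta>.finite_measure_mono sub_Low) (auto simp: sets_W)
      also have "\<dots> \<le> (1 / b) * (a * ((a / b) ^ k * measure \<beta> UNIV))"
        using ab by (intro mult_left_mono Suc) auto
      finally show ?case by (simp add: mult_ac)
    qed (simp add: W_def)
    have cov: "y \<in> W k" if y: "\<exists>\<^sub>F n in sequentially. X y n < a" "\<exists>\<^sub>F n in sequentially. X y n > b" for y k
    proof (induction k)
      case (Suc k)
      have step: "\<exists>n. P n \<and> cyl (pre n y) \<subseteq> U" if U: "open U" "y \<in> U" and fr: "\<exists>\<^sub>F n in sequentially. P n" for U P
      proof -
        obtain m where m: "cyl (pre m y) \<subseteq> U" using open_contains_cyl[OF U] by blast
        obtain n where n: "n \<ge> m" "P n" using fr unfolding frequently_sequentially by auto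
        show ?thesis using n m cyl_antimono[OF n(1), of y] by (intro exI[of _ n]) auto
      qed
      obtain n where n: "X y n < a" "cyl (pre n y) \<subseteq> W k"
        using step[OF open_W Suc y(1)] by auto
      \<comment> \<open>A ratio with vanishing denominator is 0; there the inequality holds because the numerator vanishes too.\<close>
      have "measure \<alpha> (cyl (pre n y)) \<le> a * measure \<beta> (cyl (pre n y))"
      proof (cases "measure \<beta> (cyl (pre n y)) = 0")
        case True then show ?thesis using le[of "pre n y"] by simp
      next
        case False
        then have "measure \<beta> (cyl (pre n y)) > 0" using measure_nonneg[of \<beta>] by (simp add: less_le)
        then show ?thesis using n(1) by (simp add: X_def field_simps)
      qed
      with n(2) have yL: "y \<in> Low a (W k)"
        unfolding Low_def by (intro UN_I[of "pre n y"]) (auto simp: cyl_pre)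
      obtain m where m: "X y m > b" "cyl (pre m y) \<subseteq> Low a (W k)"
        using step[OF open_Low yL y(2)] by auto
      have "measure \<beta> (cyl (pre m y)) \<noteq> 0"
        using m(1) ab by (auto simp: X_def)
      then have "measure \<beta> (cyl (pre m y)) > 0" using measure_nonneg[of \<beta>] by (simp add: less_le)
      then have "measure \<beta> (cyl (pre m y)) \<le> (1 / b) * measure \<alpha> (cyl (pre m y))"
        using m(1) ab by (simp add: X_def field_simps)
      with m(2) show ?case
        unfolding W_Suc High_def by (intro UN_I[of "pre m y"]) (auto simp: cyl_pre)
    qed (simp add: W_def)
    have lim: "(\<lambda>k. (a / b) ^ k * measure \<beta> UNIV) \<longlonglongrightarrow> 0"
      using ab by (intro tendsto_mult_left_zero LIMSEQ_power_zero) simp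
    have "measure \<beta> (\<Inter>k. W k) \<le> (a / b) ^ k * measure \<beta> UNIV" for k
      using W_le[of k] \<beta>.finite_measure_mono[of "\<Inter>k. W k" "W k"] sets_W[of k] by force
    then have "measure \<beta> (\<Inter>k. W k) \<le> 0"
      using lim by (intro LIMSEQ_le_const[OF lim]) auto
    then have "(\<Inter>k. W k) \<in> null_sets \<beta>"
      using sets_W by (intro null_setsI) (auto simp: \<beta>.emeasure_eq_measure measure_le_0_iff)
    moreover have "{y. (\<exists>\<^sub>F n in sequentially. X y n < a) \<and> (\<exists>\<^sub>F n in sequentially. X y n > b)} \<subseteq> (\<Inter>k. W k)"
      using cov by blast
    ultimately show ?thesis by blast
  qed
  have AE_ab: "AE y in \<beta>. \<not> (0 \<le> a \<and> a < b \<and> (\<exists>\<^sub>F n in sequentially. X y n < of_rat a) \<and> (\<exists>\<^sub>F n in sequentially. X y n > of_rat b))" for a b :: rat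
  proof (cases "0 \<le> a \<and> a < b")
    case True
    then have "0 \<le> real_of_rat a" "real_of_rat a < of_rat b" by (simp_all add: of_rat_less)
    from null[OF this] obtain N where N: "N \<in> null_sets \<beta>" 
      "{y. (\<exists>\<^sub>F n in sequentially. X y n < of_rat a) \<and> (\<exists>\<^sub>F n in sequentially. X y n > of_rat b)} \<subseteq> N" by blast
    show ?thesis by (rule AE_I'[OF N(1)]) (use N(2) in auto)
  qed auto
  then have "AE y in \<beta>. \<forall>a b::rat. \<not> (0 \<le> a \<and> a < b \<and> (\<exists>\<^sub>F n in sequentially. X y n < of_rat a) \<and> (\<exists>\<^sub>F n in sequentially. X y n > of_rat b))"
    by (simp only: AE_all_countable) blast
  then have "AE y in \<beta>. convergent (X y)"
  proof (eventually_elim)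
    case (elim y)
    show ?case
    proof (rule ccontr)
      assume nc: "\<not> convergent (X y)"
      have "\<exists>a b::rat. 0 \<le> a \<and> a < b \<and> (\<exists>\<^sub>F n in sequentially. X y n < of_rat a) \<and> (\<exists>\<^sub>F n in sequentially. X y n > of_rat b)"
      proof (rule not_convergent_crossing[OF _ _ nc])
        show "0 \<le> X y n" for n by (simp add: X_def)
        show "X y n \<le> 1" for n using le[of "pre n y"]
          by (cases "measure \<beta> (cyl (pre n y)) = 0") (simp_all add: X_def divide_le_eq_1 less_le)
      qed
      then show False using elim by blast
    qed
  qed
  then show ?thesis unfolding X_def .
qed

section \<open>Cylinder weights and entropy of an invariant plan\<close>

lemma finite_Xset [simp]: "finite Xset"
  by (simp add: Xset_def)

lemma sum_of_bool_single:
  "finite A \<Longrightarrow> a \<in> A \<Longrightarrow> (\<Sum>x\<in>A. of_bool (x = a) * F x) = (F a :: real)"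
proof -
  assume "finite A" "a \<in> A"
  have "(\<Sum>x\<in>A. of_bool (x = a) * F x) = (\<Sum>x\<in>A. if x = a then F x else 0)"
    by (intro sum.cong) auto
  with \<open>finite A\<close> \<open>a \<in> A\<close> show ?thesis by simp
qed

text \<open>
  A plan, not necessarily with invariant marginal.
\<close>

locale plan_space =
  fixes d :: nat and \<pi> :: "(nat \<times> (nat \<Rightarrow> nat)) measure"
  assumes plan: "\<pi> \<in> plans d"
begin

sublocale prob_space \<pi>
  using plan by (simp add: plans_def)

lemma sets_plan: "sets \<pi> = sets (restrict_space borel (Xset \<times> Omega d))"
  using plan by (simp add: plans_def)

lemma space_plan: "space \<pi> = Xset \<times> Omega d"
  using sets_eq_imp_space_eq[OF sets_plan] by (simp add: space_restrict_space)

lemma measurable_planI: "g \<in> restrict_space borel (Xset \<times> Omega d) \<rightarrow>\<^sub>M N \<Longrightarrow> g \<in> \<pi> \<rightarrow>\<^sub>M N"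
  by (simp add: measurable_cong_sets[OF sets_plan refl])

lemma measurable_snd_plan [measurable]: "snd \<in> \<pi> \<rightarrow>\<^sub>M borel"
  by (rule measurable_planI, rule measurable_restrict_space1, rule borel_measurable_continuous_onI)
    (rule continuous_on_snd[OF continuous_on_id])

lemma measurable_fst_plan [measurable]: "fst \<in> \<pi> \<rightarrow>\<^sub>M count_space UNIV"
proof -
  have "(fst :: nat \<times> (nat \<Rightarrow> nat) \<Rightarrow> nat) \<in> borel \<rightarrow>\<^sub>M borel"
    by (rule borel_measurable_continuous_onI) (rule continuous_on_fst[OF continuous_on_id])
  then have "(fst :: nat \<times> (nat \<Rightarrow> nat) \<Rightarrow> nat) \<in> borel \<rightarrow>\<^sub>M count_space UNIV"
    by (subst measurable_cong_sets[OF refl sets_borel_eq_count_space[symmetric]])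
  then show ?thesis by (intro measurable_planI measurable_restrict_space1)
qed

lemma measurable_snd_Omega: "snd \<in> \<pi> \<rightarrow>\<^sub>M restrict_space borel (Omega d)"
  by (rule measurable_restrict_space2) (auto simp: space_plan)

text \<open>
  The weight of the cylinder \<open>[x, l]\<close> and the weight of \<open>[l]\<close> under the \<open>\<Omega>\<close>-marginal.
\<close>

definition weight :: "nat \<Rightarrow> nat list \<Rightarrow> real" where
  "weight x l = measure \<pi> ({x} \<times> (cyl l \<inter> Omega d))"

definition marg :: "nat list \<Rightarrow> real" where
  "marg l = measure \<pi> {z \<in> space \<pi>. snd z \<in> cyl l}"

lemma weight_nonneg [simp]: "weight x l \<ge> 0" and marg_nonneg [simp]: "marg l \<ge> 0"
  by (simp_all add: weight_def marg_def)

lemma weight_set: "x \<in> Xset \<Longrightarrow> {x} \<times> (cyl l \<inter> Omega d) = {z \<in> space \<pi>. fst z = x \<and> snd z \<in> cyl l}"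
  by (auto simp: space_plan)

lemma sets_weight [measurable]: "x \<in> Xset \<Longrightarrow> {x} \<times> (cyl l \<inter> Omega d) \<in> sets \<pi>"
  by (simp add: weight_set)

lemma marg_Nil: "marg [] = 1"
  by (simp add: marg_def prob_space)

lemma integral_pre:
  fixes F :: "nat \<Rightarrow> nat list \<Rightarrow> real"
  shows "integrable \<pi> (\<lambda>z. F (fst z) (pre n (snd z)))"
    and "(\<integral>z. F (fst z) (pre n (snd z)) \<partial>\<pi>) = (\<Sum>x\<in>Xset. \<Sum>l\<in>words d n. F x l * weight x l)"
proof -
  let ?S = "\<lambda>z. \<Sum>x\<in>Xset. \<Sum>l\<in>words d n. F x l * indicator ({x} \<times> (cyl l \<inter> Omega d)) z"
  have eq: "F (fst z) (pre n (snd z)) = ?S z" if "z \<in> space \<pi>" for z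
  proof -
    obtain x0 y where z0: "z = (x0, y)" by (cases z)
    then have z: "z = (x0, y)" "x0 \<in> Xset" "y \<in> Omega d"
      using that by (auto simp: space_plan)
    have "?S z = (\<Sum>x\<in>Xset. if x = x0 then (\<Sum>l\<in>words d n. F x l * indicator ({x} \<times> (cyl l \<inter> Omega d)) z) else 0)"
      by (intro sum.cong) (auto simp: z indicator_def)
    also have "\<dots> = (\<Sum>l\<in>words d n. F x0 l * indicator ({x0} \<times> (cyl l \<inter> Omega d)) z)"
      using z(2) by simp
    also have "\<dots> = (\<Sum>l\<in>words d n. if l = pre n y then F x0 l else 0)"
      by (intro sum.cong) (auto simp: z indicator_def in_cyl_iff length_words)
    also have "\<dots> = F x0 (pre n y)" using pre_in_words[OF z(3)] by simp
    finally show ?thesis by (simp add: z)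
  qed
  have int: "integrable \<pi> (\<lambda>z. F x l * indicator ({x} \<times> (cyl l \<inter> Omega d)) z)" if "x \<in> Xset" for x l
    using that sets_weight[of x l] by (auto intro!: integrable_real_mult_indicator integrable_const simp: less_top[symmetric])
  show "integrable \<pi> (\<lambda>z. F (fst z) (pre n (snd z)))"
    by (subst Bochner_Integration.integrable_cong[OF refl eq], assumption) (intro Bochner_Integration.integrable_sum int)
  have "(\<integral>z. F (fst z) (pre n (snd z)) \<partial>\<pi>) = (\<integral>z. ?S z \<partial>\<pi>)"
    by (rule Bochner_Integration.integral_cong[OF refl eq])
  also have "\<dots> = (\<Sum>x\<in>Xset. \<integral>z. (\<Sum>l\<in>words d n. F x l * indicator ({x} \<times> (cyl l \<inter> Omega d)) z) \<partial>\<pi>)"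
    by (rule Bochner_Integration.integral_sum) (intro Bochner_Integration.integrable_sum int)
  also have "\<dots> = (\<Sum>x\<in>Xset. \<Sum>l\<in>words d n. \<integral>z. F x l * indicator ({x} \<times> (cyl l \<inter> Omega d)) z \<partial>\<pi>)"
    by (intro sum.cong refl Bochner_Integration.integral_sum int)
  also have "\<dots> = (\<Sum>x\<in>Xset. \<Sum>l\<in>words d n. F x l * weight x l)"
    by (intro sum.cong refl) (simp add: weight_def Int_absorb1 sets.sets_into_space[OF sets_weight] del: space_plan)
  finally show "(\<integral>z. F (fst z) (pre n (snd z)) \<partial>\<pi>) = (\<Sum>x\<in>Xset. \<Sum>l\<in>words d n. F x l * weight x l)" .
qed

lemma prob_pre:
  "measure \<pi> {z \<in> space \<pi>. P (fst z) (pre n (snd z))} = (\<Sum>x\<in>Xset. \<Sum>l\<in>words d n. of_bool (P x l) * weight x l)"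
proof -
  have "measure \<pi> {z \<in> space \<pi>. P (fst z) (pre n (snd z))} = (\<integral>z. indicator {z \<in> space \<pi>. P (fst z) (pre n (snd z))} z \<partial>\<pi>)"
    by (simp add: Int_absorb1)
  also have "\<dots> = (\<integral>z. of_bool (P (fst z) (pre n (snd z))) \<partial>\<pi>)"
    by (intro Bochner_Integration.integral_cong) (auto simp: indicator_def)
  also have "\<dots> = (\<Sum>x\<in>Xset. \<Sum>l\<in>words d n. of_bool (P x l) * weight x l)"
    by (rule integral_pre)
  finally show ?thesis .
qed

lemma marg_sum:
  assumes "l \<in> words d n"
  shows "marg l = (\<Sum>x\<in>Xset. weight x l)"
proof -
  have "marg l = measure \<pi> {z \<in> space \<pi>. pre n (snd z) = l}"
    using length_words[OF assms] by (simp add: marg_def in_cyl_iff)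
  also have "\<dots> = (\<Sum>x\<in>Xset. weight x l)"
    using prob_pre[of "\<lambda>x l'. l' = l" n] assms by (simp add: sum_of_bool_single)
  finally show ?thesis .
qed

lemma weight_eq: "x \<in> Xset \<Longrightarrow> weight x l = measure \<pi> {z \<in> space \<pi>. fst z = x \<and> pre (length l) (snd z) = l}"
  by (simp add: weight_def weight_set in_cyl_iff)

lemma weight_snoc:
  assumes "x \<in> Xset" "l \<in> words d n"
  shows "weight x l = (\<Sum>i\<in>{1..d}. weight x (l @ [i]))"
proof -
  have l: "length l = n" using assms by (simp add: length_words)
  have "weight x l = measure \<pi> {z \<in> space \<pi>. fst z = x \<and> butlast (pre (Suc n) (snd z)) = l}"
    using assms(1) by (simp add: weight_eq l pre_Suc_snoc)
  also have "\<dots> = (\<Sum>x'\<in>Xset. \<Sum>l'\<in>words d (Suc n). of_bool (x' = x \<and> butlast l' = l) * weight x' l')"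
    by (rule prob_pre)
  also have "\<dots> = (\<Sum>x'\<in>Xset. of_bool (x' = x) * (\<Sum>l'\<in>words d n. of_bool (l' = l) * (\<Sum>i\<in>{1..d}. weight x' (l' @ [i]))))"
    by (intro sum.cong refl) (auto simp: sum_words_snoc sum_distrib_left intro!: sum.cong)
  also have "\<dots> = (\<Sum>i\<in>{1..d}. weight x (l @ [i]))"
    using assms by (simp add: sum_of_bool_single)
  finally show ?thesis .
qed

lemma measure_marginal: "measure (Omega_marginal d \<pi>) (cyl l \<inter> Omega d) = marg l"
  unfolding Omega_marginal_def marg_def
  by (subst measure_distr[OF measurable_snd_Omega])
    (auto simp: space_plan sets_restrict_space intro!: arg_cong[where f = "measure \<pi>"])

lemma measurable_shift_marginal:
  "shift \<in> Omega_marginal d \<pi> \<rightarrow>\<^sub>M restrict_space borel (Omega d)"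
proof -
  have "shift \<in> restrict_space borel (Omega d) \<rightarrow>\<^sub>M restrict_space borel (Omega d)"
    by (rule measurable_restrict_space2)
      (auto simp: space_restrict_space shift_in_Omega intro: measurable_restrict_space1 borel_measurable_shift)
  then show ?thesis by (simp add: Omega_marginal_def)
qed

lemma measure_distr_shift_marginal:
  "measure (distr (Omega_marginal d \<pi>) (restrict_space borel (Omega d)) shift) (cyl l \<inter> Omega d)
     = measure \<pi> {z \<in> space \<pi>. shift (snd z) \<in> cyl l}"
proof -
  let ?N = "restrict_space borel (Omega d)" and ?C = "cyl l \<inter> Omega d"
  have C: "?C \<in> sets ?N" by (auto simp: sets_restrict_space)
  have sp: "space (Omega_marginal d \<pi>) = Omega d"
    by (simp add: Omega_marginal_def space_restrict_space)
  have "shift -` ?C \<inter> space (Omega_marginal d \<pi>) \<in> sets (Omega_marginal d \<pi>)"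
    using measurable_shift_marginal C by (rule measurable_sets)
  then have sh: "shift -` ?C \<inter> Omega d \<in> sets ?N"
    by (simp add: Omega_marginal_def space_restrict_space)
  have "measure (distr (Omega_marginal d \<pi>) ?N shift) ?C = measure (Omega_marginal d \<pi>) (shift -` ?C \<inter> Omega d)"
    by (subst measure_distr[OF measurable_shift_marginal C]) (simp add: sp)
  also have "\<dots> = measure \<pi> {z \<in> space \<pi>. shift (snd z) \<in> cyl l}"
    unfolding Omega_marginal_def
    by (subst measure_distr[OF measurable_snd_Omega sh])
      (auto simp: space_plan shift_in_Omega intro!: arg_cong[where f = "measure \<pi>"])
  finally show ?thesis .
qed

lemma prob_shift_sum:
  assumes "l \<in> words d n"
  shows "measure \<pi> {z \<in> space \<pi>. shift (snd z) \<in> cyl l} = (\<Sum>x\<in>Xset. \<Sum>i\<in>{1..d}. weight x (i # l))"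
proof -
  have "measure \<pi> {z \<in> space \<pi>. shift (snd z) \<in> cyl l} = measure \<pi> {z \<in> space \<pi>. tl (pre (Suc n) (snd z)) = l}"
    using length_words[OF assms] by (simp add: in_cyl_iff pre_Suc_Cons)
  also have "\<dots> = (\<Sum>x\<in>Xset. \<Sum>l'\<in>words d (Suc n). of_bool (tl l' = l) * weight x l')"
    by (rule prob_pre)
  also have "\<dots> = (\<Sum>x\<in>Xset. \<Sum>i\<in>{1..d}. weight x (i # l))"
    using assms by (simp add: sum_words_Cons sum_of_bool_single)
  finally show ?thesis .
qed

end

locale inv_plan = plan_space +
  assumes shift_invariant: "distr (Omega_marginal d \<pi>) (restrict_space borel (Omega d)) shift = Omega_marginal d \<pi>"
begin

text \<open>
  Invariance of the marginal, on cylinders.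
\<close>

lemma prob_shift: "measure \<pi> {z \<in> space \<pi>. shift (snd z) \<in> cyl l} = marg l"
  by (simp add: measure_distr_shift_marginal[symmetric] shift_invariant measure_marginal)

lemma marg_Cons: "l \<in> words d n \<Longrightarrow> marg l = (\<Sum>x\<in>Xset. \<Sum>i\<in>{1..d}. weight x (i # l))"
  using prob_shift_sum[of l n] prob_shift[of l] by simp

lemma marg_snoc:
  assumes "l \<in> words d n"
  shows "marg l = (\<Sum>i\<in>{1..d}. marg (l @ [i]))"
proof -
  have "marg l = (\<Sum>x\<in>Xset. \<Sum>i\<in>{1..d}. weight x (l @ [i]))"
    by (simp add: marg_sum[OF assms] weight_snoc[OF _ assms])
  also have "\<dots> = (\<Sum>i\<in>{1..d}. \<Sum>x\<in>Xset. weight x (l @ [i]))" by (rule sum.swap)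
  also have "\<dots> = (\<Sum>i\<in>{1..d}. marg (l @ [i]))"
    using assms by (intro sum.cong refl marg_sum[where n = "Suc n", symmetric]) simp
  finally show ?thesis .
qed

lemma weight_Cons_le_marg:
  assumes "l \<in> words d n" "x \<in> Xset" "i \<in> {1..d}"
  shows "weight x (i # l) \<le> marg l"
proof -
  have "weight x (i # l) \<le> (\<Sum>i\<in>{1..d}. weight x (i # l))" using assms by (intro member_le_sum) auto
  also have "\<dots> \<le> (\<Sum>x\<in>Xset. \<Sum>i\<in>{1..d}. weight x (i # l))" using assms by (intro member_le_sum) (auto intro!: sum_nonneg)
  also have "\<dots> = marg l" using marg_Cons[OF assms(1)] by simp
  finally show ?thesis .
qed

lemma sum_marg_words: "(\<Sum>l\<in>words d n. marg l) = 1"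
proof (induction n)
  case (Suc n)
  have "(\<Sum>l\<in>words d (Suc n). marg l) = (\<Sum>l\<in>words d n. marg l)"
    unfolding sum_words_snoc by (intro sum.cong refl marg_snoc[symmetric])
  then show ?case using Suc by simp
qed (simp add: marg_Nil)

end

lemma inv_plans_iff: "\<pi> \<in> inv_plans d \<longleftrightarrow> inv_plan d \<pi>"
  by (simp add: inv_plans_def inv_plan_def plan_space_def inv_plan_axioms_def)

text \<open>
  The summands of Gibbs' inequality, with the equality case. For \<open>t = 0\<close> the left side is 0.
\<close>

lemma mult_ln_ratio_le:
  fixes s t :: real
  assumes "s \<ge> 0" "t \<ge> 0" "t > 0 \<Longrightarrow> s > 0"
  shows "t * ln (s / t) \<le> s - t" and "t * ln (s / t) = s - t \<Longrightarrow> s = t"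
proof -
  show "t * ln (s / t) \<le> s - t"
  proof (cases "t = 0")
    case False
    then have t: "t > 0" "s > 0" using assms by auto
    then have "ln (s / t) \<le> s / t - 1" by (intro ln_le_minus_one) simp
    then have "t * ln (s / t) \<le> t * (s / t - 1)" using t by (intro mult_left_mono) auto
    also have "t * (s / t - 1) = s - t" using t by (simp add: field_simps)
    finally show ?thesis .
  qed (use assms in simp)
  show "s = t" if eq: "t * ln (s / t) = s - t"
  proof (cases "t = 0")
    case False
    then have t: "t > 0" "s > 0" using assms by auto
    then have "ln (s / t) = s / t - 1" using eq by (simp add: field_simps)
    then have "s / t = 1" using t ln_eq_minus_one[of "s / t"] by simp
    then show ?thesis using t by simp
  qed (use eq in simp)
qed

context inv_plan
begin

text \<open>
  The conditional entropy of \<open>(x, i)\<close> given the \<open>n\<close> following letters. It is the \<open>n\<close>-th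
  approximation to the entropy of the plan. Terms of weight 0 vanish because of the factor in front.
\<close>

definition cond_entropy :: "nat \<Rightarrow> real" where
  "cond_entropy n = - (\<Sum>x\<in>Xset. \<Sum>i\<in>{1..d}. \<Sum>l\<in>words d n. weight x (i # l) * ln (weight x (i # l) / marg l))"

text \<open>
  Gibbs' inequality against an arbitrary sub-probability \<open>Q\<close> of \<open>(x, i)\<close> given \<open>l\<close>, and its
  equality case.
\<close>

lemma gibbs:
  assumes Q0: "\<And>x i l. x \<in> Xset \<Longrightarrow> i \<in> {1..d} \<Longrightarrow> l \<in> words d n \<Longrightarrow> Q x i l \<ge> 0"
    and Qpos: "\<And>x i l. x \<in> Xset \<Longrightarrow> i \<in> {1..d} \<Longrightarrow> l \<in> words d n \<Longrightarrow> weight x (i # l) > 0 \<Longrightarrow> Q x i l > 0"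
    and Q1: "\<And>l. l \<in> words d n \<Longrightarrow> (\<Sum>x\<in>Xset. \<Sum>i\<in>{1..d}. Q x i l) \<le> 1"
  shows "(\<Sum>x\<in>Xset. \<Sum>i\<in>{1..d}. \<Sum>l\<in>words d n. weight x (i # l) * ln (Q x i l)) + cond_entropy n \<le> 0"
    and "(\<Sum>x\<in>Xset. \<Sum>i\<in>{1..d}. \<Sum>l\<in>words d n. weight x (i # l) * ln (Q x i l)) + cond_entropy n = 0 \<Longrightarrow>
      x \<in> Xset \<Longrightarrow> i \<in> {1..d} \<Longrightarrow> l \<in> words d n \<Longrightarrow> weight x (i # l) = Q x i l * marg l"
proof -
  define D where "D = (\<lambda>(x, i, l). Q x i l * marg l - weight x (i # l) - weight x (i # l) * ln (Q x i l * marg l / weight x (i # l)))"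
  define I where "I = Xset \<times> {1..d} \<times> words d n"
  have fin: "finite I" by (simp add: I_def)
  have pre: "Q x i l * marg l \<ge> 0" "weight x (i # l) > 0 \<Longrightarrow> Q x i l * marg l > 0" if "(x, i, l) \<in> I" for x i l
    using that Q0[of x i l] Qpos[of x i l] weight_Cons_le_marg[of l n x i] by (auto simp: I_def intro!: mult_pos_pos)
  have D0: "D t \<ge> 0" if "t \<in> I" for t
  proof -
    obtain x i l where t: "t = (x, i, l)" by (cases t)
    show ?thesis using mult_ln_ratio_le(1)[OF pre(1) weight_nonneg pre(2)] that t by (auto simp: D_def)
  qed
  have Deq: "weight x (i # l) = Q x i l * marg l" if "(x, i, l) \<in> I" "D (x, i, l) = 0" for x i l
    using mult_ln_ratio_le(2)[of "Q x i l * marg l" "weight x (i # l)"] pre[OF that(1)] that(2) by (simp add: D_def)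
  have split: "weight x (i # l) * ln (Q x i l * marg l / weight x (i # l)) = weight x (i # l) * ln (Q x i l) - weight x (i # l) * ln (weight x (i # l) / marg l)"
    if "(x, i, l) \<in> I" for x i l
  proof (cases "weight x (i # l) = 0")
    case False
    then have w: "weight x (i # l) > 0" using weight_nonneg[of x "i # l"] by linarith
    then have "Q x i l > 0" "marg l > 0" using that Qpos[of x i l] weight_Cons_le_marg[of l n x i] by (auto simp: I_def)
    then show ?thesis using w by (simp add: ln_div ln_mult algebra_simps)
  qed simp
  have "(\<Sum>t\<in>I. D t) = (\<Sum>(x, i, l)\<in>I. Q x i l * marg l) - (\<Sum>(x, i, l)\<in>I. weight x (i # l))
     - (\<Sum>(x, i, l)\<in>I. weight x (i # l) * ln (Q x i l * marg l / weight x (i # l)))"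
    by (simp add: D_def split_beta sum_subtractf)
  also have "(\<Sum>(x, i, l)\<in>I. weight x (i # l) * ln (Q x i l * marg l / weight x (i # l)))
     = (\<Sum>(x, i, l)\<in>I. weight x (i # l) * ln (Q x i l) - weight x (i # l) * ln (weight x (i # l) / marg l))"
    by (intro sum.cong refl) (use split in auto)
  also have "\<dots> = (\<Sum>x\<in>Xset. \<Sum>i\<in>{1..d}. \<Sum>l\<in>words d n. weight x (i # l) * ln (Q x i l)) + cond_entropy n"
    unfolding I_def cond_entropy_def sum.cartesian_product[symmetric] by (simp add: sum_subtractf)
  also have "(\<Sum>(x, i, l)\<in>I. weight x (i # l)) = (\<Sum>l\<in>words d n. \<Sum>x\<in>Xset. \<Sum>i\<in>{1..d}. weight x (i # l))"
    unfolding I_def sum.cartesian_product[symmetric] by (simp add: sum.swap[of _ "words d n"])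
  also have "\<dots> = (\<Sum>l\<in>words d n. marg l)"
    by (intro sum.cong refl marg_Cons[symmetric])
  also have "\<dots> = 1" by (rule sum_marg_words)
  also have "(\<Sum>(x, i, l)\<in>I. Q x i l * marg l) = (\<Sum>l\<in>words d n. (\<Sum>x\<in>Xset. \<Sum>i\<in>{1..d}. Q x i l) * marg l)"
    unfolding I_def sum.cartesian_product[symmetric] by (simp add: sum.swap[of _ "words d n"] sum_distrib_right)
  finally have sumD: "(\<Sum>x\<in>Xset. \<Sum>i\<in>{1..d}. \<Sum>l\<in>words d n. weight x (i # l) * ln (Q x i l)) + cond_entropy n
     = (\<Sum>l\<in>words d n. (\<Sum>x\<in>Xset. \<Sum>i\<in>{1..d}. Q x i l) * marg l) - 1 - (\<Sum>t\<in>I. D t)" by simp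
  have "(\<Sum>l\<in>words d n. (\<Sum>x\<in>Xset. \<Sum>i\<in>{1..d}. Q x i l) * marg l) \<le> (\<Sum>l\<in>words d n. 1 * marg l)"
    by (intro sum_mono mult_right_mono Q1) auto
  then have le1: "(\<Sum>l\<in>words d n. (\<Sum>x\<in>Xset. \<Sum>i\<in>{1..d}. Q x i l) * marg l) \<le> 1" by (simp add: sum_marg_words)
  have sD: "(\<Sum>t\<in>I. D t) \<ge> 0" by (rule sum_nonneg[OF D0])
  show "(\<Sum>x\<in>Xset. \<Sum>i\<in>{1..d}. \<Sum>l\<in>words d n. weight x (i # l) * ln (Q x i l)) + cond_entropy n \<le> 0"
    using sumD le1 sD by linarith
  assume "(\<Sum>x\<in>Xset. \<Sum>i\<in>{1..d}. \<Sum>l\<in>words d n. weight x (i # l) * ln (Q x i l)) + cond_entropy n = 0"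
  then have "(\<Sum>t\<in>I. D t) = 0" using sumD le1 sD by linarith
  then have "\<forall>t\<in>I. D t = 0" using sum_nonneg_eq_0_iff[OF fin D0] by simp
  then show "weight x (i # l) = Q x i l * marg l" if "x \<in> Xset" "i \<in> {1..d}" "l \<in> words d n"
    using that Deq[of x i l] by (auto simp: I_def)
qed

text \<open>
  Conditioning on one more letter decreases the entropy: Gibbs' inequality against the conditional probabilities given \<open>n\<close> letters.
\<close>

lemma cond_entropy_Suc_le: "cond_entropy (Suc n) \<le> cond_entropy n"
proof -
  let ?Q = "\<lambda>x i l. weight x (i # butlast l) / marg (butlast l)"
  have bl: "butlast l \<in> words d n" if "l \<in> words d (Suc n)" for l
    using that by (auto simp: words_def dest: in_set_butlastD)
  have snoc: "butlast l @ [last l] = l" "last l \<in> {1..d}" if "l \<in> words d (Suc n)" for l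
  proof -
    have ne: "l \<noteq> []" using that by (auto simp: words_def)
    then show "butlast l @ [last l] = l" by simp
    show "last l \<in> {1..d}" using that last_in_set[OF ne] by (auto simp: words_def)
  qed
  have le: "weight x (i # l) \<le> ?Q x i l * marg (butlast l)" if "x \<in> Xset" "i \<in> {1..d}" "l \<in> words d (Suc n)" for x i l
  proof -
    have "weight x (i # l) = weight x ((i # butlast l) @ [last l])" using snoc[OF that(3)] by simp
    also have "\<dots> \<le> (\<Sum>j\<in>{1..d}. weight x ((i # butlast l) @ [j]))"
      using snoc[OF that(3)] by (intro member_le_sum) auto
    also have "\<dots> = weight x (i # butlast l)" using that bl[OF that(3)] by (subst weight_snoc[of x _ "Suc n"]) auto
    also have "\<dots> \<le> ?Q x i l * marg (butlast l)" using weight_Cons_le_marg[OF bl[OF that(3)] that(1,2)] weight_nonneg[of x "i # butlast l"] 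
      by (cases "marg (butlast l) = 0") auto
    finally show ?thesis .
  qed
  have "(\<Sum>x\<in>Xset. \<Sum>i\<in>{1..d}. \<Sum>l\<in>words d (Suc n). weight x (i # l) * ln (?Q x i l)) + cond_entropy (Suc n) \<le> 0"
  proof (rule gibbs(1))
    fix x i l assume *: "x \<in> Xset" "i \<in> {1..d}" "l \<in> words d (Suc n)" "weight x (i # l) > 0"
    then have "?Q x i l * marg (butlast l) > 0" using le[of x i l] by simp
    then show "?Q x i l > 0" using marg_nonneg by (metis not_less zero_less_mult_pos2 less_le mult_zero_right)
  next
    fix l assume "l \<in> words d (Suc n)"
    from marg_Cons[OF bl[OF this]] show "(\<Sum>x\<in>Xset. \<Sum>i\<in>{1..d}. ?Q x i l) \<le> 1"
      by (simp add: sum_divide_distrib[symmetric])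
  qed auto
  moreover have "(\<Sum>x\<in>Xset. \<Sum>i\<in>{1..d}. \<Sum>l\<in>words d (Suc n). weight x (i # l) * ln (?Q x i l)) = - cond_entropy n"
  proof -
    have "(\<Sum>l\<in>words d (Suc n). weight x (i # l) * ln (?Q x i l)) = (\<Sum>l\<in>words d n. weight x (i # l) * ln (weight x (i # l) / marg l))"
      if "x \<in> Xset" "i \<in> {1..d}" for x i
    proof -
      have "(\<Sum>l\<in>words d (Suc n). weight x (i # l) * ln (?Q x i l))
        = (\<Sum>l\<in>words d n. (\<Sum>j\<in>{1..d}. weight x ((i # l) @ [j])) * ln (weight x (i # l) / marg l))"
        by (simp add: sum_words_snoc sum_distrib_right)
      also have "\<dots> = (\<Sum>l\<in>words d n. weight x (i # l) * ln (weight x (i # l) / marg l))"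
        using that by (intro sum.cong refl) (subst weight_snoc[symmetric, of x _ "Suc n"], auto)
      finally show ?thesis .
    qed
    then show ?thesis unfolding cond_entropy_def by simp
  qed
  ultimately show ?thesis by simp
qed

lemma cond_entropy_antimono: "m \<le> n \<Longrightarrow> cond_entropy n \<le> cond_entropy m"
  by (rule lift_Suc_antimono_le[of cond_entropy]) (rule cond_entropy_Suc_le)

text \<open>
  The quotient which defines \<open>Jn_plan\<close> at index \<open>n + 1\<close>, without the convention off the support.
\<close>

definition cond_weight :: "nat \<Rightarrow> nat \<times> (nat \<Rightarrow> nat) \<Rightarrow> real" where
  "cond_weight n z = weight (fst z) (pre (Suc n) (snd z)) / marg (tl (pre (Suc n) (snd z)))"

lemma cond_weight_le_1: "z \<in> space \<pi> \<Longrightarrow> cond_weight n z \<le> 1"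
proof -
  assume z: "z \<in> space \<pi>"
  then have "weight (fst z) (pre (Suc n) (snd z)) \<le> marg (pre n (shift (snd z)))"
    unfolding pre_Suc_Cons
    by (intro weight_Cons_le_marg[of _ n]) (auto simp: space_plan pre_in_words shift_in_Omega Omega_nth_bounds)
  then show ?thesis
    using marg_nonneg[of "pre n (shift (snd z))"]
    by (cases "marg (pre n (shift (snd z))) = 0") (auto simp: cond_weight_def pre_Suc_Cons divide_le_eq_1 less_le)
qed

lemma cond_weight_nonneg: "cond_weight n z \<ge> 0"
  by (simp add: cond_weight_def)

lemma cond_entropy_eq_integral: "integrable \<pi> (\<lambda>z. - ln (cond_weight n z))" "cond_entropy n = (\<integral>z. - ln (cond_weight n z) \<partial>\<pi>)"
proof -
  have "(\<integral>z. - ln (cond_weight n z) \<partial>\<pi>) = (\<Sum>x\<in>Xset. \<Sum>l\<in>words d (Suc n). - ln (weight x l / marg (tl l)) * weight x l)"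
    unfolding cond_weight_def by (rule integral_pre)
  also have "\<dots> = cond_entropy n" unfolding cond_entropy_def by (simp add: sum_words_Cons sum_negf mult_ac)
  finally show "cond_entropy n = (\<integral>z. - ln (cond_weight n z) \<partial>\<pi>)" by simp
  show "integrable \<pi> (\<lambda>z. - ln (cond_weight n z))" unfolding cond_weight_def by (rule integral_pre)
qed

lemma minus_ln_cond_weight_nonneg: "z \<in> space \<pi> \<Longrightarrow> - ln (cond_weight n z) \<ge> 0"
  using cond_weight_le_1[of z n] cond_weight_nonneg[of n z] by (cases "cond_weight n z = 0") (simp_all add: less_le)

lemma cond_entropy_nonneg: "cond_entropy n \<ge> 0"
  unfolding cond_entropy_eq_integral(2) by (intro integral_nonneg_AE AE_I2 minus_ln_cond_weight_nonneg)

lemma AE_weight_pos: "AE z in \<pi>. \<forall>n. weight (fst z) (pre n (snd z)) > 0"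
  unfolding AE_all_countable
proof
  fix n
  have "measure \<pi> {z \<in> space \<pi>. weight (fst z) (pre n (snd z)) = 0} = 0"
    using prob_pre[of "\<lambda>x l. weight x l = 0" n] by (auto intro!: sum.neutral)
  moreover have "{z \<in> space \<pi>. weight (fst z) (pre n (snd z)) = 0} \<in> sets \<pi>"
  proof -
    have "(\<lambda>z. weight (fst z) (pre n (snd z))) \<in> borel_measurable \<pi>"
      by (rule borel_measurable_integrable[OF integral_pre(1)])
    then show ?thesis by measurable
  qed
  ultimately have "AE z in \<pi>. weight (fst z) (pre n (snd z)) \<noteq> 0"
    by (subst AE_iff_measurable[OF _ refl]) (auto simp: emeasure_eq_measure)
  then show "AE z in \<pi>. 0 < weight (fst z) (pre n (snd z))"
    by eventually_elim (simp add: less_le)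
qed

lemma supp_marginal_iff:
  assumes y: "y \<in> Omega d"
  shows "y \<in> supp (Omega_marginal d \<pi>) \<longleftrightarrow> (\<forall>n. marg (pre n y) > 0)"
proof -
  let ?\<nu> = "Omega_marginal d \<pi>"
  have sp: "space ?\<nu> = Omega d" by (simp add: Omega_marginal_def space_restrict_space)
  have sets: "sets ?\<nu> = sets (restrict_space borel (Omega d))" by (simp add: Omega_marginal_def)
  interpret marg: prob_space ?\<nu>
    unfolding Omega_marginal_def by (rule prob_space_distr[OF measurable_snd_Omega])
  show ?thesis
  proof (intro iffI allI)
    fix n assume "y \<in> supp ?\<nu>"
    then have "emeasure ?\<nu> (cyl (pre n y) \<inter> Omega d) > 0"
      using open_cyl[of "pre n y"] by (simp add: supp_def sp cyl_pre)
    then show "marg (pre n y) > 0"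
      using measure_marginal[of "pre n y"] by (simp add: marg.emeasure_eq_measure)
  next
    assume pos: "\<forall>n. marg (pre n y) > 0"
    show "y \<in> supp ?\<nu>"
      unfolding supp_def sp
    proof (intro CollectI conjI allI impI y)
      fix U :: "(nat \<Rightarrow> nat) set" assume U: "open U \<and> y \<in> U"
      then obtain n where n: "cyl (pre n y) \<subseteq> U" using open_contains_cyl[of U y] by blast
      have "0 < measure ?\<nu> (cyl (pre n y) \<inter> Omega d)" using pos by (simp add: measure_marginal)
      also have "\<dots> \<le> measure ?\<nu> (U \<inter> Omega d)"
        using n U by (intro marg.finite_measure_mono) (auto simp: sets sets_restrict_space)
      finally show "0 < emeasure ?\<nu> (U \<inter> Omega d)" by (simp add: marg.emeasure_eq_measure)
    qed
  qed
qed

lemma Jn_plan_eq: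
  assumes z: "z \<in> space \<pi>"
  shows "Jn_plan d \<pi> n z = (if \<forall>k. marg (tl (pre (Suc k) (snd z))) > 0
    then weight (fst z) (pre n (snd z)) / marg (tl (pre n (snd z))) else 0)"
proof -
  have y: "shift (snd z) \<in> Omega d" using z by (auto simp: space_plan shift_in_Omega)
  have tl: "pre (n - 1) (shift (snd z)) = tl (pre n (snd z))" by (cases n) (simp_all add: pre_Suc_Cons)
  show ?thesis
    by (cases z) (use y tl in \<open>simp add: Jn_plan_def supp_marginal_iff cylinder_eq measure_marginal weight_def pre_Suc_Cons\<close>)
qed

lemma borel_measurable_pre: "(\<lambda>z. F (fst z) (pre n (snd z)) :: real) \<in> borel_measurable \<pi>"
  by (rule borel_measurable_integrable[OF integral_pre(1)])

lemma borel_measurable_J_plan: "J_plan d \<pi> \<in> borel_measurable \<pi>"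
proof -
  have "(\<lambda>z. if \<forall>k. marg (tl (pre (Suc k) (snd z))) > 0
    then weight (fst z) (pre n (snd z)) / marg (tl (pre n (snd z))) else 0) \<in> borel_measurable \<pi>" for n
  proof (rule measurable_If)
    show "(\<lambda>z. weight (fst z) (pre n (snd z)) / marg (tl (pre n (snd z)))) \<in> borel_measurable \<pi>"
      by (rule borel_measurable_pre[where F = "\<lambda>x l. weight x l / marg (tl l)"])
    have [measurable]: "(\<lambda>z. marg (tl (pre (Suc k) (snd z)))) \<in> borel_measurable \<pi>" for k
      by (rule borel_measurable_pre[where F = "\<lambda>x l. marg (tl l)"])
    show "{z \<in> space \<pi>. \<forall>k. marg (tl (pre (Suc k) (snd z))) > 0} \<in> sets \<pi>" by measurable
  qed auto
  then have "Jn_plan d \<pi> n \<in> borel_measurable \<pi>" for n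
    by (subst measurable_cong[OF Jn_plan_eq])
  then show ?thesis
    unfolding J_plan_def[abs_def] by (rule borel_measurable_lim_metric)
qed

lemma Jn_eq_cond_weight:
  assumes z: "z \<in> space \<pi>" and pos: "\<And>n. weight (fst z) (pre n (snd z)) > 0"
  shows "Jn_plan d \<pi> (Suc n) z = cond_weight n z"
proof -
  have "marg (tl (pre (Suc k) (snd z))) > 0" for k
  proof -
    have "0 < weight (fst z) (pre (Suc k) (snd z))" by (rule pos)
    also have "\<dots> \<le> marg (tl (pre (Suc k) (snd z)))"
      unfolding pre_Suc_Cons list.sel using z
      by (intro weight_Cons_le_marg[of _ k]) (auto simp: space_plan pre_in_words shift_in_Omega Omega_nth_bounds)
    finally show ?thesis .
  qed
  then show ?thesis by (simp add: Jn_plan_eq[OF z] cond_weight_def)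
qed

text \<open>
  For fixed \<open>x\<close> and first letter \<open>i\<close>, the ratio is that of the measure \<open>B \<mapsto> \<pi>({x} \<times> iB)\<close> to the
  marginal, evaluated at the shifted sequence. The exceptional set is null for the marginal, hence, by
  invariance, its preimage under the shift is null.
\<close>

lemma AE_convergent_cond_weight: "AE z in \<pi>. convergent (\<lambda>n. cond_weight n z)"
proof -
  let ?b = "distr \<pi> borel (\<lambda>z. shift (snd z))"
  have m: "(\<lambda>z. shift (snd z)) \<in> \<pi> \<rightarrow>\<^sub>M borel" by measurable
  have b: "finite_measure ?b" using prob_space_distr[OF m] by (simp add: prob_space_def)
  have b_cyl: "measure ?b (cyl l) = marg l" for l
    using prob_shift[of l] by (subst measure_distr[OF m]) (auto simp: vimage_def Int_def conj_commute)
  have AE: "AE z in \<pi>. fst z = x \<and> snd z 0 = i \<longrightarrow> convergent (\<lambda>n. cond_weight n z)" if xi: "x \<in> Xset" for x i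
  proof -
    define S where "S = {z \<in> space \<pi>. fst z = x \<and> snd z 0 = i}"
    have S: "S \<in> sets \<pi>" unfolding S_def by measurable
    define a where "a = distr (restrict_space \<pi> S) borel (\<lambda>z. shift (snd z))"
    have ma: "(\<lambda>z. shift (snd z)) \<in> restrict_space \<pi> S \<rightarrow>\<^sub>M borel"
      by (rule measurable_restrict_space1[OF m])
    have a: "finite_measure a"
      unfolding a_def by (intro finite_measure.finite_measure_distr[OF finite_measure_restrict_space[OF finite_measure_axioms S]] ma)
    have a_cyl: "measure a (cyl l) = weight x (i # l)" for l
    proof -
      have "measure a (cyl l) = measure (restrict_space \<pi> S) ((\<lambda>z. shift (snd z)) -` cyl l \<inter> S)"
        using sets.sets_into_space[OF S] unfolding a_def
        by (subst measure_distr[OF ma]) (auto simp: space_restrict_space Int_absorb2)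
      also have "\<dots> = measure \<pi> ((\<lambda>z. shift (snd z)) -` cyl l \<inter> S)"
        using S by (subst measure_restrict_space) (auto simp: Int_absorb1 sets.sets_into_space)
      also have "(\<lambda>z. shift (snd z)) -` cyl l \<inter> S = {z \<in> space \<pi>. fst z = x \<and> pre (length (i # l)) (snd z) = i # l}"
        by (auto simp: S_def in_cyl_iff pre_Suc_Cons)
      finally show ?thesis using weight_eq[OF xi, of "i # l"] by simp
    qed
    have "AE y in ?b. convergent (\<lambda>n. measure a (cyl (pre n y)) / measure ?b (cyl (pre n y)))"
    proof (rule AE_convergent_ratio[OF a _ b])
      fix l
      have "weight x (i # l) \<le> measure \<pi> {z \<in> space \<pi>. shift (snd z) \<in> cyl l}"
        unfolding weight_eq[OF xi] by (intro finite_measure_mono) (auto simp: in_cyl_iff pre_Suc_Cons)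
      then show "measure a (cyl l) \<le> measure ?b (cyl l)" by (simp add: a_cyl b_cyl prob_shift)
    qed (auto simp: a_def)
    then have "AE z in \<pi>. convergent (\<lambda>n. weight x (i # pre n (shift (snd z))) / marg (pre n (shift (snd z))))"
      unfolding a_cyl b_cyl by (rule AE_distrD[OF m])
    then show ?thesis
      by eventually_elim (auto simp: cond_weight_def pre_Suc_Cons)
  qed
  have "AE z in \<pi>. \<forall>i. \<forall>x\<in>Xset. fst z = x \<and> snd z 0 = i \<longrightarrow> convergent (\<lambda>n. cond_weight n z)"
    unfolding AE_all_countable by (intro allI AE_finite_allI[OF finite_Xset] AE)
  then show ?thesis by (rule AE_mp) (auto simp: space_plan intro!: AE_I2)
qed

text \<open>
  Fatou's lemma. If the logarithm of \<open>J\<close> is not integrable, then its integral is 0 by convention and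
  the bound holds because the right side is nonnegative. Likewise \<open>ln 0 = 0\<close> is harmless.
\<close>

lemma plan_entropy_le_cond_entropy: "plan_entropy d \<pi> \<le> cond_entropy m"
proof -
  let ?J = "J_plan d \<pi>"
  have AE: "AE z in \<pi>. ennreal (- ln (?J z)) \<le> liminf (\<lambda>n. ennreal (- ln (cond_weight n z))) \<and> - ln (?J z) \<ge> 0"
    using AE_weight_pos AE_convergent_cond_weight AE_space
  proof eventually_elim
    case (elim z)
    then obtain r where r: "(\<lambda>n. cond_weight n z) \<longlonglongrightarrow> r" by (auto simp: convergent_def)
    have "(\<lambda>n. Jn_plan d \<pi> (Suc n) z) \<longlonglongrightarrow> r" using r Jn_eq_cond_weight[OF elim(3)] elim(1) by simp
    then have "(\<lambda>n. Jn_plan d \<pi> n z) \<longlonglongrightarrow> r" by (rule LIMSEQ_imp_Suc)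
    then have J: "?J z = r" unfolding J_plan_def by (rule limI)
    have r0: "0 \<le> r" using r by (rule LIMSEQ_le_const) (auto simp: cond_weight_nonneg)
    have r1: "r \<le> 1" using r by (rule LIMSEQ_le_const2) (auto simp: cond_weight_le_1 elim)
    show ?case
    proof (cases "r = 0")
      case False
      then have "(\<lambda>n. ennreal (- ln (cond_weight n z))) \<longlonglongrightarrow> ennreal (- ln r)"
        using r by (intro tendsto_ennrealI tendsto_minus tendsto_ln)
      then have "liminf (\<lambda>n. ennreal (- ln (cond_weight n z))) = ennreal (- ln r)"
        by (intro lim_imp_Liminf) auto
      then show ?thesis using r0 r1 False by (simp add: J)
    qed (simp add: J)
  qed
  have "(\<integral>\<^sup>+z. ennreal (- ln (?J z)) \<partial>\<pi>) \<le> (\<integral>\<^sup>+z. liminf (\<lambda>n. ennreal (- ln (cond_weight n z))) \<partial>\<pi>)"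
    using AE by (intro nn_integral_mono_AE) auto
  also have "\<dots> \<le> liminf (\<lambda>n. \<integral>\<^sup>+z. ennreal (- ln (cond_weight n z)) \<partial>\<pi>)"
    by (intro nn_integral_liminf measurable_compose[OF borel_measurable_integrable[OF cond_entropy_eq_integral(1)]]) auto
  also have "\<dots> = liminf (\<lambda>n. ennreal (cond_entropy n))"
    unfolding cond_entropy_eq_integral(2)
    by (intro arg_cong[where f = liminf] ext nn_integral_eq_integral cond_entropy_eq_integral(1) AE_I2 minus_ln_cond_weight_nonneg)
  also have "\<dots> \<le> ennreal (cond_entropy m)"
  proof (rule order_trans[OF Liminf_le_Limsup])
    show "limsup (\<lambda>n. ennreal (cond_entropy n)) \<le> ennreal (cond_entropy m)"
      by (rule Limsup_bounded) (auto intro!: eventually_sequentiallyI[of m] ennreal_leI cond_entropy_antimono)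
  qed simp
  finally have le: "(\<integral>\<^sup>+z. ennreal (- ln (?J z)) \<partial>\<pi>) \<le> ennreal (cond_entropy m)" .
  show ?thesis
  proof (cases "integrable \<pi> (\<lambda>z. ln (?J z))")
    case True
    then have "ennreal (\<integral>z. - ln (?J z) \<partial>\<pi>) = (\<integral>\<^sup>+z. ennreal (- ln (?J z)) \<partial>\<pi>)"
      using AE by (intro nn_integral_eq_integral[symmetric]) auto
    then have "ennreal (plan_entropy d \<pi>) \<le> ennreal (cond_entropy m)" using le by (simp add: plan_entropy_def)
    then show ?thesis using cond_entropy_nonneg by (simp add: ennreal_le_iff)
  next
    case False
    then show ?thesis using cond_entropy_nonneg by (simp add: plan_entropy_def not_integrable_integral_eq)
  qed
qed

end

section \<open>Stochastic kernels and their transition operators\<close>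

text \<open>
  The space of the plans, which is also the state space of the random sequence.
\<close>

definition State :: "nat \<Rightarrow> (nat \<times> (nat \<Rightarrow> nat)) set" where
  "State d = Xset \<times> Omega d"

text \<open>
  \<open>f\<close> varies by at most \<open>e\<close> when the sequence is changed after its first \<open>n\<close> letters.
\<close>

definition near :: "nat \<Rightarrow> nat \<Rightarrow> real \<Rightarrow> (nat \<times> (nat \<Rightarrow> nat) \<Rightarrow> real) \<Rightarrow> bool" where
  "near d n e f \<longleftrightarrow> (\<forall>x\<in>Xset. \<forall>y\<in>Omega d. \<forall>w\<in>Omega d. pre n y = pre n w \<longrightarrow> \<bar>f (x, y) - f (x, w)\<bar> \<le> e)"

text \<open>
  Uniform continuity on \<open>State d\<close>, with respect to cylinders.
\<close>

definition ucont :: "nat \<Rightarrow> (nat \<times> (nat \<Rightarrow> nat) \<Rightarrow> real) \<Rightarrow> bool" where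
  "ucont d f \<longleftrightarrow> (\<forall>e>0. \<exists>n. near d n e f)"

lemma near_mono: "near d n e f \<Longrightarrow> n \<le> m \<Longrightarrow> e \<le> e' \<Longrightarrow> near d m e' f"
  unfolding near_def by (meson order_trans pre_eq_iff less_le_trans)

lemma compact_Omega: "compact (Omega d)"
proof -
  have "compactin (product_topology (\<lambda>_::nat. euclidean :: nat topology) UNIV) (Pi\<^sub>E UNIV (\<lambda>_. {1..d}))"
    by (auto simp: compactin_PiE intro!: finite_imp_compact)
  then show ?thesis
    by (simp add: euclidean_product_topology Omega_def PiE_UNIV_domain)
qed

lemma uniform_on_Omega:
  assumes v: "continuous_on (Omega d) v" and e: "(e::real) > 0"
  shows "\<exists>n. \<forall>y\<in>Omega d. \<forall>w\<in>Omega d. pre n y = pre n w \<longrightarrow> \<bar>v y - v w\<bar> \<le> e"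
proof -
  have "\<exists>n. \<forall>w\<in>Omega d. pre n w = pre n y \<longrightarrow> \<bar>v w - v y\<bar> < e / 2" if y: "y \<in> Omega d" for y
  proof -
    have "v y \<in> ball (v y) (e / 2)" "open (ball (v y) (e / 2))" using e by auto
    then obtain A where A: "open A" "y \<in> A" "\<forall>w\<in>Omega d. w \<in> A \<longrightarrow> v w \<in> ball (v y) (e / 2)"
      using v y unfolding continuous_on_topological by metis
    obtain n where "cyl (pre n y) \<subseteq> A" using open_contains_cyl[OF A(1,2)] by blast
    then show ?thesis using A(3) by (intro exI[of _ n]) (auto simp: cyl_pre dist_real_def abs_minus_commute subset_iff)
  qed
  then obtain N where N: "\<And>y w. y \<in> Omega d \<Longrightarrow> w \<in> Omega d \<Longrightarrow> pre (N y) w = pre (N y) y \<Longrightarrow> \<bar>v w - v y\<bar> < e / 2"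
    by metis
  obtain C where C: "C \<subseteq> Omega d" "finite C" "Omega d \<subseteq> (\<Union>c\<in>C. cyl (pre (N c) c))"
  proof (rule compactE_image[OF compact_Omega])
    show "open (cyl (pre (N c) c))" for c by (rule open_cyl)
    show "Omega d \<subseteq> (\<Union>c\<in>Omega d. cyl (pre (N c) c))" by (auto simp: cyl_pre)
  qed auto
  show ?thesis
  proof (intro exI ballI impI)
    fix y w assume y: "y \<in> Omega d" and w: "w \<in> Omega d"
      and eq: "pre (\<Sum>c\<in>C. N c) y = pre (\<Sum>c\<in>C. N c) w"
    obtain c where c: "c \<in> C" "y \<in> cyl (pre (N c) c)" using C y by blast
    have "N c \<le> (\<Sum>c\<in>C. N c)" using c C by (intro member_le_sum) auto
    then have "pre (N c) w = pre (N c) y" using eq by (auto simp: pre_eq_iff)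
    then have "pre (N c) w = pre (N c) c" "pre (N c) y = pre (N c) c" using c by (auto simp: cyl_pre)
    moreover have "c \<in> Omega d" using c C by auto
    ultimately have "\<bar>v y - v c\<bar> < e / 2" "\<bar>v w - v c\<bar> < e / 2"
      using y w by (simp_all only: N)
    then show "\<bar>v y - v w\<bar> \<le> e" by linarith
  qed
qed

lemma ucont_continuous:
  assumes "continuous_on (Xset \<times> Omega d) f" shows "ucont d f"
  unfolding ucont_def
proof (intro allI impI)
  fix e :: real assume e: "e > 0"
  have "\<exists>n. \<forall>y\<in>Omega d. \<forall>w\<in>Omega d. pre n y = pre n w \<longrightarrow> \<bar>f (x, y) - f (x, w)\<bar> \<le> e" if x: "x \<in> Xset" for x
    using x by (intro uniform_on_Omega[OF _ e] continuous_on_compose2[OF assms]) (auto intro!: continuous_intros)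
  then obtain N where N: "\<And>x y w. x \<in> Xset \<Longrightarrow> y \<in> Omega d \<Longrightarrow> w \<in> Omega d \<Longrightarrow> pre (N x) y = pre (N x) w \<Longrightarrow> \<bar>f (x, y) - f (x, w)\<bar> \<le> e"
    by metis
  show "\<exists>n. near d n e f"
    unfolding near_def
  proof (intro exI ballI impI)
    fix x y w assume *: "x \<in> Xset" "y \<in> Omega d" "w \<in> Omega d" "pre (\<Sum>x\<in>Xset. N x) y = pre (\<Sum>x\<in>Xset. N x) w"
    have "N x \<le> (\<Sum>x\<in>Xset. N x)" using * by (intro member_le_sum) auto
    then show "\<bar>f (x, y) - f (x, w)\<bar> \<le> e" using * by (intro N) (auto simp: pre_eq_iff)
  qed
qed

text \<open>
  A word continued by the constant sequence 1.
\<close>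

definition ext :: "nat list \<Rightarrow> nat \<Rightarrow> nat" where
  "ext l k = (if k < length l then l ! k else 1)"

lemma pre_ext: "pre (length l) (ext l) = l"
  by (simp add: list_eq_iff_nth_eq ext_def)

lemma ext_in_Omega: "l \<in> words d n \<Longrightarrow> d \<ge> 1 \<Longrightarrow> ext l \<in> Omega d"
  using nth_mem by (fastforce simp: ext_def Omega_def words_def)

text \<open>
  Functions on \<open>State d\<close> of \<open>x\<close> and finitely many letters.
\<close>

definition cylfun :: "nat \<Rightarrow> (nat \<times> (nat \<Rightarrow> nat) \<Rightarrow> real) \<Rightarrow> bool" where
  "cylfun d f \<longleftrightarrow> (\<exists>n F. \<forall>z\<in>State d. f z = F (fst z) (pre n (snd z)))"

lemma cylfunI: "(\<And>z. z \<in> State d \<Longrightarrow> f z = F (fst z) (pre n (snd z))) \<Longrightarrow> cylfun d f"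
  unfolding cylfun_def by blast

lemma cylfun_const: "cylfun d (\<lambda>_. a)"
  by (rule cylfunI[where F = "\<lambda>_ _. a"]) simp

lemma cylfunE:
  assumes "cylfun d f"
  obtains n F where "n \<ge> m" "\<And>z. z \<in> State d \<Longrightarrow> f z = F (fst z) (pre n (snd z))"
proof -
  obtain n F where F: "\<And>z. z \<in> State d \<Longrightarrow> f z = F (fst z) (pre n (snd z))"
    using assms unfolding cylfun_def by auto
  show thesis
  proof (rule that)
    show "m \<le> max m n" by simp
    show "f z = (\<lambda>x l. F x (take n l)) (fst z) (pre (max m n) (snd z))" if "z \<in> State d" for z
      using F[OF that] by (simp add: take_pre)
  qed
qed

lemma cylfun_ucont: "cylfun d f \<Longrightarrow> ucont d f"
proof -
  assume "cylfun d f"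
  then obtain n F where F: "\<And>z. z \<in> State d \<Longrightarrow> f z = F (fst z) (pre n (snd z))"
    unfolding cylfun_def by auto
  have "near d n e f" if "e > 0" for e
    using that unfolding near_def by (auto simp: F State_def)
  then show ?thesis unfolding ucont_def by blast
qed

lemma cylfun_approx:
  assumes f: "ucont d f" and d: "d \<ge> 1" and e: "e > 0"
  obtains h where "cylfun d h" "\<And>z. z \<in> State d \<Longrightarrow> \<bar>f z - h z\<bar> \<le> e"
proof -
  obtain n where n: "near d n e f" using f e unfolding ucont_def by auto
  define h where "h = (\<lambda>z. f (fst z, ext (pre n (snd z))))"
  have "cylfun d h" by (rule cylfunI[where F = "\<lambda>x l. f (x, ext l)" and n = n]) (simp add: h_def)
  moreover have "\<bar>f z - h z\<bar> \<le> e" if "z \<in> State d" for z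
  proof -
    obtain x y where z: "z = (x, y)" by (cases z)
    with that have xy: "z = (x, y)" "x \<in> Xset" "y \<in> Omega d" by (auto simp: State_def)
    have "pre n (ext (pre n y)) = pre n y" using pre_ext[of "pre n y"] by simp
    then show ?thesis using n xy ext_in_Omega[OF pre_in_words[OF xy(3), of n] d] by (auto simp: near_def h_def)
  qed
  ultimately show thesis by (rule that)
qed

lemma cylfun_bounded:
  assumes "cylfun d f"
  obtains B where "\<And>z. z \<in> State d \<Longrightarrow> \<bar>f z\<bar> \<le> B"
proof -
  obtain n F where F: "\<And>z. z \<in> State d \<Longrightarrow> f z = F (fst z) (pre n (snd z))"
    using assms unfolding cylfun_def by auto
  have "\<bar>f z\<bar> \<le> (\<Sum>x\<in>Xset. \<Sum>l\<in>words d n. \<bar>F x l\<bar>)" if z: "z \<in> State d" for z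
  proof -
    have zz: "fst z \<in> Xset" "pre n (snd z) \<in> words d n" using z by (auto simp: State_def pre_in_words)
    have "\<bar>F (fst z) (pre n (snd z))\<bar> \<le> (\<Sum>l\<in>words d n. \<bar>F (fst z) l\<bar>)" using zz by (intro member_le_sum) auto
    also have "\<dots> \<le> (\<Sum>x\<in>Xset. \<Sum>l\<in>words d n. \<bar>F x l\<bar>)"
      using zz by (intro member_le_sum[where f = "\<lambda>x. \<Sum>l\<in>words d n. \<bar>F x l\<bar>"]) (auto intro!: sum_nonneg)
    finally show ?thesis by (simp add: F[OF z])
  qed
  then show thesis by (rule that)
qed

lemma ucont_bounded:
  assumes "ucont d f" "d \<ge> 1"
  obtains B where "\<And>z. z \<in> State d \<Longrightarrow> \<bar>f z\<bar> \<le> B"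
proof -
  obtain h where h: "cylfun d h" "\<And>z. z \<in> State d \<Longrightarrow> \<bar>f z - h z\<bar> \<le> 1"
    using cylfun_approx[OF assms, of 1] by auto
  obtain B where B: "\<And>z. z \<in> State d \<Longrightarrow> \<bar>h z\<bar> \<le> B" using cylfun_bounded[OF h(1)] by auto
  have "\<bar>f z\<bar> \<le> B + 1" if "z \<in> State d" for z using B[OF that] h(2)[OF that] by linarith
  then show thesis by (rule that)
qed

text \<open>
  A positive stochastic kernel: \<open>g x i j\<close> is the probability to choose \<open>x\<close> and to put the letter \<open>i\<close> in
  front of a sequence which begins with \<open>j\<close>.
\<close>

locale kernel =
  fixes d :: nat and g :: "nat \<Rightarrow> nat \<Rightarrow> nat \<Rightarrow> real"
  assumes d2: "d \<ge> 2"
    and g_pos: "\<And>x i j. x \<in> Xset \<Longrightarrow> i \<in> {1..d} \<Longrightarrow> j \<in> {1..d} \<Longrightarrow> g x i j > 0"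
    and g_sum: "\<And>j. j \<in> {1..d} \<Longrightarrow> (\<Sum>x\<in>Xset. \<Sum>i\<in>{1..d}. g x i j) = 1"
begin

text \<open>
  The transition operator of the Markov chain with kernel \<open>g\<close>.
\<close>

definition markov_op :: "(nat \<times> (nat \<Rightarrow> nat) \<Rightarrow> real) \<Rightarrow> nat \<times> (nat \<Rightarrow> nat) \<Rightarrow> real" where
  "markov_op f z = (\<Sum>x\<in>Xset. \<Sum>i\<in>{1..d}. g x i (snd z 0) * f (x, scons i (snd z)))"

lemma scons_State: "z \<in> State d \<Longrightarrow> x \<in> Xset \<Longrightarrow> i \<in> {1..d} \<Longrightarrow> (x, scons i (snd z)) \<in> State d"
  by (cases z) (simp add: State_def)

lemma g_pos_State: "z \<in> State d \<Longrightarrow> x \<in> Xset \<Longrightarrow> i \<in> {1..d} \<Longrightarrow> g x i (snd z 0) > 0"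
  using Omega_nth[of "snd z" d 0] by (intro g_pos) (auto simp: State_def)

lemma g_sum_State: "z \<in> State d \<Longrightarrow> (\<Sum>x\<in>Xset. \<Sum>i\<in>{1..d}. g x i (snd z 0)) = 1"
  using Omega_nth[of "snd z" d 0] by (intro g_sum) (auto simp: State_def)

lemma markov_op_cong: "(\<And>z. z \<in> State d \<Longrightarrow> f z = h z) \<Longrightarrow> z \<in> State d \<Longrightarrow> markov_op f z = markov_op h z"
  unfolding markov_op_def by (intro sum.cong refl) (simp add: scons_State)

lemma markov_op_mono: "(\<And>z. z \<in> State d \<Longrightarrow> f z \<le> h z) \<Longrightarrow> z \<in> State d \<Longrightarrow> markov_op f z \<le> markov_op h z"
  unfolding markov_op_def by (intro sum_mono mult_left_mono) (auto simp: scons_State g_pos_State less_imp_le)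

lemma markov_op_const: "z \<in> State d \<Longrightarrow> markov_op (\<lambda>_. a) z = a"
  unfolding markov_op_def sum_distrib_right[symmetric] by (simp add: g_sum_State del: One_nat_def)

lemma markov_op_add: "markov_op (\<lambda>z. f z + h z) = (\<lambda>z. markov_op f z + markov_op h z)"
  by (simp add: markov_op_def fun_eq_iff algebra_simps sum.distrib)

lemma markov_op_cmult: "markov_op (\<lambda>z. a * f z) = (\<lambda>z. a * markov_op f z)"
  by (simp add: markov_op_def fun_eq_iff algebra_simps sum_distrib_left)

lemma markov_op_snd: "markov_op f (x, y) = markov_op f (x', y)"
  by (simp add: markov_op_def)

lemma markov_op_pow_cong: "(\<And>z. z \<in> State d \<Longrightarrow> f z = h z) \<Longrightarrow> z \<in> State d \<Longrightarrow> (markov_op ^^ n) f z = (markov_op ^^ n) h z"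
  by (induction n arbitrary: z) (auto intro: markov_op_cong)

lemma markov_op_pow_mono: "(\<And>z. z \<in> State d \<Longrightarrow> f z \<le> h z) \<Longrightarrow> z \<in> State d \<Longrightarrow> (markov_op ^^ n) f z \<le> (markov_op ^^ n) h z"
  by (induction n arbitrary: z) (auto intro: markov_op_mono)

lemma markov_op_pow_const: "z \<in> State d \<Longrightarrow> (markov_op ^^ n) (\<lambda>_. a) z = a"
proof (induction n arbitrary: z)
  case (Suc n)
  have "markov_op ((markov_op ^^ n) (\<lambda>_. a)) z = markov_op (\<lambda>_. a) z" using Suc by (intro markov_op_cong) auto
  then show ?case using Suc.prems by (simp add: markov_op_const)
qed simp

lemma markov_op_pow_add: "(markov_op ^^ n) (\<lambda>z. f z + h z) = (\<lambda>z. (markov_op ^^ n) f z + (markov_op ^^ n) h z)"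
  by (induction n) (simp_all add: markov_op_add)

lemma markov_op_pow_cmult: "(markov_op ^^ n) (\<lambda>z. a * f z) = (\<lambda>z. a * (markov_op ^^ n) f z)"
  by (induction n) (simp_all add: markov_op_cmult)

lemma markov_op_pow_bounds:
  assumes "\<And>z. z \<in> State d \<Longrightarrow> a \<le> f z \<and> f z \<le> b" "z \<in> State d"
  shows "a \<le> (markov_op ^^ n) f z \<and> (markov_op ^^ n) f z \<le> b"
  using markov_op_pow_mono[of "\<lambda>_. a" f z n] markov_op_pow_mono[of f "\<lambda>_. b" z n] markov_op_pow_const[OF assms(2)] assms by simp

lemma near_markov_op:
  assumes "near d (Suc n) e f" "n \<ge> 1"
  shows "near d n e (markov_op f)"
  unfolding near_def
proof (intro ballI impI)
  fix x y w assume *: "x \<in> Xset" "y \<in> Omega d" "w \<in> Omega d" "pre n y = pre n w"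
  then have 0: "y 0 = w 0" using assms(2) by (simp add: pre_eq_iff)
  have z: "(x, y) \<in> State d" using * by (simp add: State_def)
  have "\<bar>markov_op f (x, y) - markov_op f (x, w)\<bar> = \<bar>\<Sum>x\<in>Xset. \<Sum>i\<in>{1..d}. g x i (y 0) * (f (x, scons i y) - f (x, scons i w))\<bar>"
    by (simp add: markov_op_def 0 sum_subtractf algebra_simps)
  also have "\<dots> \<le> (\<Sum>x\<in>Xset. \<Sum>i\<in>{1..d}. \<bar>g x i (y 0) * (f (x, scons i y) - f (x, scons i w))\<bar>)"
    by (rule order_trans[OF sum_abs]) (intro sum_mono sum_abs)
  also have "\<dots> \<le> (\<Sum>x\<in>Xset. \<Sum>i\<in>{1..d}. g x i (y 0) * e)"
  proof (intro sum_mono)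
    fix x i assume xi: "x \<in> Xset" "i \<in> {1..d}"
    have "\<bar>f (x, scons i y) - f (x, scons i w)\<bar> \<le> e"
      using assms(1) xi * unfolding near_def by (simp add: pre_scons)
    then show "\<bar>g x i (y 0) * (f (x, scons i y) - f (x, scons i w))\<bar> \<le> g x i (y 0) * e"
      using g_pos_State[OF z xi] by (simp add: abs_mult)
  qed
  also have "\<dots> = e" using g_sum_State[OF z] by (simp add: sum_distrib_right[symmetric])
  finally show "\<bar>markov_op f (x, y) - markov_op f (x, w)\<bar> \<le> e" .
qed

lemma near_markov_op_pow: "near d (Suc n) e f \<Longrightarrow> m \<ge> n \<Longrightarrow> near d 1 e ((markov_op ^^ m) f)"
proof -
  have A: "near d (Suc n) e f \<Longrightarrow> near d 1 e ((markov_op ^^ n) f)" for f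
  proof (induction n arbitrary: f)
    case (Suc n)
    from Suc.IH[OF near_markov_op[OF Suc.prems]] show ?case by (simp add: funpow_Suc_right del: funpow.simps)
  qed simp
  assume f: "near d (Suc n) e f" and "m \<ge> n"
  from this(2) show ?thesis
  proof (induction rule: dec_induct)
    case (step k)
    then show ?case using near_markov_op[of 1 e "(markov_op ^^ k) f"] near_mono[of d 1 e _ "Suc 1" e] by simp
  qed (rule A[OF f])
qed

lemma g_lower: obtains \<delta> where "\<delta> > 0" "\<delta> \<le> 1" "\<And>j. j \<in> {1..d} \<Longrightarrow> g 1 1 j \<ge> \<delta>"
proof
  let ?\<delta> = "Min ((\<lambda>j. g 1 1 j) ` {1..d})"
  have ne: "(\<lambda>j. g 1 1 j) ` {1..d} \<noteq> {}" "finite ((\<lambda>j. g 1 1 j) ` {1..d})" using d2 by auto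
  have x: "1 \<in> Xset" "1 \<in> {1..d}" using d2 by (auto simp: Xset_def)
  show "?\<delta> > 0" using ne x g_pos by (subst Min_gr_iff) auto
  show *: "g 1 1 j \<ge> ?\<delta>" if "j \<in> {1..d}" for j using that ne by (intro Min_le) auto
  have nn: "0 \<le> g x i 1" if "x \<in> Xset" "i \<in> {1..d}" for x i using g_pos[OF that x(2)] by simp
  have "g 1 1 1 \<le> (\<Sum>i\<in>{1..d}. g 1 i 1)" using x nn by (intro member_le_sum) auto
  also have "\<dots> \<le> (\<Sum>x\<in>Xset. \<Sum>i\<in>{1..d}. g x i 1)"
    using x nn by (intro member_le_sum[where f = "\<lambda>x. \<Sum>i\<in>{1..d}. g x i 1"]) (auto intro!: sum_nonneg)
  finally show "?\<delta> \<le> 1" using *[OF x(2)] g_sum[OF x(2)] by linarith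
qed

text \<open>
  Doeblin's estimate: from every state the chain moves with probability at least \<open>\<delta>\<close> by the choice
  \<open>x = 1, i = 1\<close>, and a function which is nearly determined by \<open>x\<close> and the first letter takes nearly the same
  value at all the resulting states.
\<close>

lemma markov_op_contract:
  assumes \<delta>: "\<delta> > 0" "\<delta> \<le> 1" "\<And>j. j \<in> {1..d} \<Longrightarrow> g 1 1 j \<ge> \<delta>"
    and h: "near d 1 e h" "\<And>z. z \<in> State d \<Longrightarrow> a \<le> h z \<and> h z \<le> b"
    and z: "z \<in> State d" "z' \<in> State d"
  shows "markov_op h z - markov_op h z' \<le> (1 - \<delta>) * (b - a) + \<delta> * e"
proof -
  have x1: "1 \<in> Xset" "1 \<in> {1..d}" using d2 by (auto simp: Xset_def)
  \<comment> \<open>The common part of all transition probabilities.\<close>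
  define t where "t x i = (if x = 1 \<and> i = 1 then \<delta> else 0)" for x i :: nat
  have sum_t: "(\<Sum>x\<in>Xset. \<Sum>i\<in>{1..d}. t x i * k x i) = \<delta> * k 1 1" for k
  proof -
    have "(\<Sum>i\<in>{1..d}. t x i * k x i) = (if x = 1 then \<delta> * k 1 1 else 0)" for x
    proof -
      have "(\<Sum>i\<in>{1..d}. t x i * k x i) = (\<Sum>i\<in>{1..d}. if i = 1 then (if x = 1 then \<delta> * k 1 1 else 0) else 0)"
        by (intro sum.cong) (auto simp: t_def)
      then show ?thesis using x1 by simp
    qed
    then show ?thesis using x1 by simp
  qed
  have t_le: "t x i \<le> g x i (snd z 0)" if "x \<in> Xset" "i \<in> {1..d}" "z \<in> State d" for x i z
    using g_pos_State[OF that(3,1,2)] \<delta>(3)[of "snd z 0"] that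
    by (cases "x = 1 \<and> i = 1") (auto simp: t_def State_def Omega_nth_bounds)
  have sum_gt: "(\<Sum>x\<in>Xset. \<Sum>i\<in>{1..d}. (g x i (snd z 0) - t x i) * c) = (1 - \<delta>) * c" if "z \<in> State d" for z c
    using g_sum_State[OF that] sum_t[of "\<lambda>_ _. 1"] by (simp add: sum_distrib_right[symmetric] sum_subtractf)
  have split: "markov_op h z = (\<Sum>x\<in>Xset. \<Sum>i\<in>{1..d}. (g x i (snd z 0) - t x i) * h (x, scons i (snd z))) + \<delta> * h (1, scons 1 (snd z))" for z
    using sum_t[of "\<lambda>x i. h (x, scons i (snd z))"] by (simp add: markov_op_def left_diff_distrib sum_subtractf)
  have up: "markov_op h z \<le> (1 - \<delta>) * b + \<delta> * h (1, scons 1 (snd z))"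
  proof -
    have "(\<Sum>x\<in>Xset. \<Sum>i\<in>{1..d}. (g x i (snd z 0) - t x i) * h (x, scons i (snd z)))
        \<le> (\<Sum>x\<in>Xset. \<Sum>i\<in>{1..d}. (g x i (snd z 0) - t x i) * b)"
      using z t_le[OF _ _ z(1)] h(2)[OF scons_State[OF z(1)]] by (intro sum_mono mult_left_mono) auto
    then show ?thesis using sum_gt[OF z(1), of b] split[of z] by linarith
  qed
  have dn: "markov_op h z' \<ge> (1 - \<delta>) * a + \<delta> * h (1, scons 1 (snd z'))"
  proof -
    have "(\<Sum>x\<in>Xset. \<Sum>i\<in>{1..d}. (g x i (snd z' 0) - t x i) * h (x, scons i (snd z')))
        \<ge> (\<Sum>x\<in>Xset. \<Sum>i\<in>{1..d}. (g x i (snd z' 0) - t x i) * a)"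
      using z t_le[OF _ _ z(2)] h(2)[OF scons_State[OF z(2)]] by (intro sum_mono mult_left_mono) auto
    then show ?thesis using sum_gt[OF z(2), of a] split[of z'] by linarith
  qed
  have "\<bar>h (1, scons 1 (snd z)) - h (1, scons 1 (snd z'))\<bar> \<le> e"
    using h(1) x1 z unfolding near_def by (auto simp: State_def pre_eq_iff)
  then have "\<delta> * (h (1, scons 1 (snd z)) - h (1, scons 1 (snd z'))) \<le> \<delta> * e"
    using \<delta>(1) by (intro mult_left_mono) auto
  then show ?thesis using up dn by (simp add: algebra_simps)
qed

lemma State_witness: "(1, \<lambda>_. 1) \<in> State d"
  using d2 by (auto simp: State_def Omega_def Xset_def)

lemma markov_op_pow_oscillation:
  assumes f: "ucont d f" and e: "e > 0"
  shows "\<exists>n a. \<forall>z\<in>State d. a \<le> (markov_op ^^ n) f z \<and> (markov_op ^^ n) f z \<le> a + e"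
proof -
  obtain \<delta> where \<delta>: "\<delta> > 0" "\<delta> \<le> 1" "\<And>j. j \<in> {1..d} \<Longrightarrow> g 1 1 j \<ge> \<delta>" using g_lower by blast
  obtain B where B: "\<And>z. z \<in> State d \<Longrightarrow> \<bar>f z\<bar> \<le> B" using ucont_bounded[OF f] d2 by auto
  have B0: "B \<ge> 0" using B[OF State_witness] by linarith
  obtain N where "near d N (e / 2) f" using f e unfolding ucont_def by (meson half_gt_zero)
  then have N: "near d (Suc N) (e / 2) f" by (rule near_mono) auto
  have "\<exists>a. \<forall>z\<in>State d. a \<le> (markov_op ^^ (N + k)) f z \<and> (markov_op ^^ (N + k)) f z \<le> a + ((1 - \<delta>) ^ k * (2 * B) + e / 2)" for k
  proof (induction k)
    case 0
    have "-B \<le> (markov_op ^^ N) f z \<and> (markov_op ^^ N) f z \<le> B" if "z \<in> State d" for z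
      using B that by (intro markov_op_pow_bounds) (auto simp: abs_le_iff minus_le_iff)
    then show ?case using e by (intro exI[of _ "-B"]) fastforce
  next
    case (Suc k)
    let ?h = "(markov_op ^^ (N + k)) f" and ?D = "(1 - \<delta>) ^ k * (2 * B) + e / 2"
    let ?D' = "(1 - \<delta>) ^ Suc k * (2 * B) + e / 2"
    obtain a where a: "\<And>z. z \<in> State d \<Longrightarrow> a \<le> ?h z \<and> ?h z \<le> a + ?D" using Suc by blast
    have nr: "near d 1 (e / 2) ?h" by (rule near_markov_op_pow[OF N]) simp
    have diff: "markov_op ?h z - markov_op ?h z' \<le> ?D'" if "z \<in> State d" "z' \<in> State d" for z z'
      using markov_op_contract[OF \<delta> nr a that] by (simp add: field_simps)
    define a' where "a' = (INF z\<in>State d. markov_op ?h z)"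
    have "a \<le> markov_op ?h z" if "z \<in> State d" for z
      using markov_op_pow_bounds[of a ?h "a + ?D" z 1] a that by simp
    then have bdd: "bdd_below (markov_op ?h ` State d)" by (rule bdd_belowI2)
    have "a' \<le> markov_op ?h z \<and> markov_op ?h z \<le> a' + ?D'" if z: "z \<in> State d" for z
    proof
      show "a' \<le> markov_op ?h z" unfolding a'_def by (rule cINF_lower[OF bdd z])
      have "markov_op ?h z - ?D' \<le> a'" unfolding a'_def
        using diff[OF z] State_witness by (intro cINF_greatest) (auto simp: diff_le_eq add.commute)
      then show "markov_op ?h z \<le> a' + ?D'" by simp
    qed
    then show ?case unfolding add_Suc_right funpow.simps o_apply by blast
  qed
  note bound = this
  have "(\<lambda>k. (1 - \<delta>) ^ k * (2 * B)) \<longlonglongrightarrow> 0"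
    using \<delta> by (intro tendsto_mult_left_zero LIMSEQ_power_zero) auto
  then have "\<forall>\<^sub>F k in sequentially. (1 - \<delta>) ^ k * (2 * B) < e / 2"
    using e by (intro order_tendstoD(2)) auto
  then obtain k where k: "(1 - \<delta>) ^ k * (2 * B) < e / 2" by (metis eventually_sequentially order_refl)
  obtain a where "\<forall>z\<in>State d. a \<le> (markov_op ^^ (N + k)) f z \<and> (markov_op ^^ (N + k)) f z \<le> a + ((1 - \<delta>) ^ k * (2 * B) + e / 2)"
    using bound by blast
  then show ?thesis using k by (intro exI[of _ "N + k"] exI[of _ a]) force
qed

text \<open>
  The constant to which the iterates of the transition operator converge, read off at an
  arbitrary state.
\<close>

definition lim_mean :: "(nat \<times> (nat \<Rightarrow> nat) \<Rightarrow> real) \<Rightarrow> real" where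
  "lim_mean f = lim (\<lambda>n. (markov_op ^^ n) f (1, \<lambda>_. 1))"

lemma markov_op_pow_tendsto_uniform:
  assumes f: "ucont d f" and e: "e > 0"
  shows "\<exists>N. \<forall>n\<ge>N. \<forall>z\<in>State d. \<bar>(markov_op ^^ n) f z - lim_mean f\<bar> \<le> e"
proof -
  let ?X = "\<lambda>n. (markov_op ^^ n) f (1, \<lambda>_. 1)"
  have stay: "\<exists>N a. \<forall>n\<ge>N. \<forall>z\<in>State d. a \<le> (markov_op ^^ n) f z \<and> (markov_op ^^ n) f z \<le> a + e" if e: "e > 0" for e
  proof -
    obtain N a where Na: "\<forall>z\<in>State d. a \<le> (markov_op ^^ N) f z \<and> (markov_op ^^ N) f z \<le> a + e"
      using markov_op_pow_oscillation[OF f e] by blast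
    have "a \<le> (markov_op ^^ n) f z \<and> (markov_op ^^ n) f z \<le> a + e" if "n \<ge> N" "z \<in> State d" for n z
    proof -
      have "(markov_op ^^ n) f = (markov_op ^^ (n - N)) ((markov_op ^^ N) f)"
        using that by (metis comp_apply funpow_add le_add_diff_inverse2)
      then show ?thesis using markov_op_pow_bounds[of a "(markov_op ^^ N) f" "a + e" z "n - N"] Na that by simp
    qed
    then show ?thesis by blast
  qed
  have "Cauchy ?X"
  proof (rule metric_CauchyI)
    fix r :: real assume r: "0 < r"
    obtain N a where Na: "\<forall>n\<ge>N. \<forall>z\<in>State d. a \<le> (markov_op ^^ n) f z \<and> (markov_op ^^ n) f z \<le> a + r / 2"
      using stay[of "r / 2"] r by auto
    have "dist (?X m) (?X n) < r" if "m \<ge> N" "n \<ge> N" for m n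
    proof -
      have "a \<le> ?X m \<and> ?X m \<le> a + r / 2" "a \<le> ?X n \<and> ?X n \<le> a + r / 2" using Na that State_witness by blast+
      then show ?thesis using r unfolding dist_real_def by (smt (verit) field_sum_of_halves)
    qed
    then show "\<exists>N. \<forall>m\<ge>N. \<forall>n\<ge>N. dist (?X m) (?X n) < r" by blast
  qed
  then have lim: "?X \<longlonglongrightarrow> lim_mean f"
    unfolding lim_mean_def by (simp add: Cauchy_convergent_iff convergent_LIMSEQ_iff)
  obtain N a where Na: "\<forall>n\<ge>N. \<forall>z\<in>State d. a \<le> (markov_op ^^ n) f z \<and> (markov_op ^^ n) f z \<le> a + e"
    using stay[OF e] by blast
  have "a \<le> lim_mean f" "lim_mean f \<le> a + e"
    using Na State_witness by (auto intro!: LIMSEQ_le_const[OF lim] LIMSEQ_le_const2[OF lim] exI[of _ N])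
  then have "\<bar>(markov_op ^^ n) f z - lim_mean f\<bar> \<le> e" if "n \<ge> N" "z \<in> State d" for n z
    using Na that by (smt (verit))
  then show ?thesis by blast
qed

lemma markov_op_pow_tendsto_lim_mean:
  assumes f: "ucont d f" and z: "z \<in> State d"
  shows "(\<lambda>n. (markov_op ^^ n) f z) \<longlonglongrightarrow> lim_mean f"
proof (rule metric_LIMSEQ_I)
  fix r :: real assume "0 < r"
  then obtain N where "\<forall>n\<ge>N. \<forall>z\<in>State d. \<bar>(markov_op ^^ n) f z - lim_mean f\<bar> \<le> r / 2"
    using markov_op_pow_tendsto_uniform[OF f, of "r / 2"] by auto
  then show "\<exists>N. \<forall>n\<ge>N. dist ((markov_op ^^ n) f z) (lim_mean f) < r"
    using z \<open>0 < r\<close> by (intro exI[of _ N]) (force simp: dist_real_def)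
qed

lemma lim_mean_cong: "(\<And>z. z \<in> State d \<Longrightarrow> f z = h z) \<Longrightarrow> lim_mean f = lim_mean h"
  unfolding lim_mean_def using markov_op_pow_cong[of f h "(1, \<lambda>_. 1)"] State_witness by presburger

lemma lim_mean_const: "lim_mean (\<lambda>_. a) = a"
  unfolding lim_mean_def using markov_op_pow_const[OF State_witness, of _ a] by simp

lemma lim_mean_add: "ucont d f \<Longrightarrow> ucont d h \<Longrightarrow> lim_mean (\<lambda>z. f z + h z) = lim_mean f + lim_mean h"
  unfolding lim_mean_def[of "\<lambda>z. f z + h z"] markov_op_pow_add
  by (intro limI tendsto_add markov_op_pow_tendsto_lim_mean State_witness)

lemma lim_mean_cmult: "ucont d f \<Longrightarrow> lim_mean (\<lambda>z. a * f z) = a * lim_mean f"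
  unfolding lim_mean_def[of "\<lambda>z. a * f z"] markov_op_pow_cmult
  by (intro limI tendsto_mult_left markov_op_pow_tendsto_lim_mean State_witness)

lemma lim_mean_mono: "ucont d f \<Longrightarrow> ucont d h \<Longrightarrow> (\<And>z. z \<in> State d \<Longrightarrow> f z \<le> h z) \<Longrightarrow> lim_mean f \<le> lim_mean h"
  by (rule LIMSEQ_le[OF markov_op_pow_tendsto_lim_mean[OF _ State_witness] markov_op_pow_tendsto_lim_mean[OF _ State_witness]])
    (assumption | intro exI allI impI markov_op_pow_mono State_witness)+

lemma lim_mean_markov_op: "ucont d f \<Longrightarrow> lim_mean (markov_op f) = lim_mean f"
  unfolding lim_mean_def[of "markov_op f"]
  using LIMSEQ_Suc[OF markov_op_pow_tendsto_lim_mean[OF _ State_witness]]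
  by (intro limI) (simp add: funpow_Suc_right del: funpow.simps)

end

section \<open>Measures with prescribed cylinder weights\<close>

lemma measurable_map_upt:
  "(\<lambda>h. map h [0..<n]) \<in> PiM {0..<n} (\<lambda>_. count_space (UNIV :: nat set)) \<rightarrow>\<^sub>M count_space UNIV"
proof (subst measurable_count_space_eq_countable)
  let ?M = "PiM {0..<n} (\<lambda>_. count_space (UNIV :: nat set))"
  have "(\<lambda>h. map h [0..<n]) -` {l} \<inter> space ?M \<in> sets ?M" for l
  proof (cases "length l = n")
    case True
    then have "map h [0..<n] = l \<longleftrightarrow> (\<forall>k<n. h k = l ! k)" for h
      by (simp add: list_eq_iff_nth_eq)
    then have "(\<lambda>h. map h [0..<n]) -` {l} \<inter> space ?M = Pi\<^sub>E {0..<n} (\<lambda>k. {l ! k})"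
      by (auto simp: space_PiM PiE_iff)
    moreover have "Pi\<^sub>E {0..<n} (\<lambda>k. {l ! k}) \<in> sets ?M"
      by (rule sets_PiM_I_finite) auto
    ultimately show ?thesis by simp
  next
    case False
    then have "(\<lambda>h. map h [0..<n]) -` {l} \<inter> space ?M = {}" by auto
    then show ?thesis by simp
  qed
  then show "(\<lambda>h. map h [0..<n]) \<in> space ?M \<rightarrow> UNIV \<and> (\<forall>l\<in>UNIV. (\<lambda>h. map h [0..<n]) -` {l} \<inter> space ?M \<in> sets ?M)"
    by (intro conjI ballI) (simp, assumption)
qed simp

text \<open>
  Kolmogorov extension for consistent weights of words. The theorem of Ionescu Tulcea is applied to
  the conditional distributions of the next letter; where the weight of the word is 0, the
  distribution is arbitrary.
\<close>

theorem exists_measure_of_cyl: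
  fixes w :: "nat list \<Rightarrow> real"
  assumes nn: "\<And>l. w l \<ge> 0" and w0: "w [] = 1"
    and out: "\<And>l i. i \<notin> {1..d} \<Longrightarrow> w (l @ [i]) = 0"
    and sum: "\<And>l. w l = (\<Sum>i\<in>{1..d}. w (l @ [i]))"
  obtains N :: "(nat \<Rightarrow> nat) measure"
  where "prob_space N" "sets N = sets borel" "\<And>l. measure N (cyl l) = w l"
proof -
  define K where "K l = (if w l = 0 then return_pmf 0 else embed_pmf (\<lambda>i. w (l @ [i]) / w l))" for l
  have pmf_K: "w l * pmf (K l) i = w (l @ [i])" for l i
  proof (cases "w l = 0")
    case True
    then have "(\<Sum>i\<in>{1..d}. w (l @ [i])) = 0" using sum[of l] by simp
    then have "\<forall>i\<in>{1..d}. w (l @ [i]) = 0" using nn by (subst (asm) sum_nonneg_eq_0_iff) auto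
    then show ?thesis using out[of i l] True by (cases "i \<in> {1..d}") auto
  next
    case False
    have "(\<integral>\<^sup>+i. ennreal (w (l @ [i]) / w l) \<partial>count_space UNIV) = (\<Sum>i\<in>{1..d}. ennreal (w (l @ [i]) / w l))"
      using out[of _ l] by (intro nn_integral_count_space') auto
    also have "\<dots> = ennreal ((\<Sum>i\<in>{1..d}. w (l @ [i])) / w l)"
      using nn by (simp add: sum_ennreal sum_divide_distrib)
    also have "\<dots> = 1" using False sum[of l] by simp
    finally have "pmf (embed_pmf (\<lambda>i. w (l @ [i]) / w l)) i = w (l @ [i]) / w l"
      using nn by (intro pmf_embed_pmf) auto
    then show ?thesis using False by (simp add: K_def)
  qed
  let ?P = "\<lambda>n h. measure_pmf (K (map h [0..<n]))" and ?M = "\<lambda>_::nat. count_space (UNIV :: nat set)"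
  interpret IT: Ionescu_Tulcea ?P ?M
  proof (rule Ionescu_Tulcea.intro)
    show "?P n \<in> PiM {0..<n} ?M \<rightarrow>\<^sub>M subprob_algebra (?M n)" for n
      by (rule measurable_compose[OF measurable_map_upt]) (auto simp: measure_pmf_in_subprob_algebra)
    show "prob_space (?P n x)" for n x by (rule prob_space_measure_pmf)
  qed
  define A where "A n l = {h \<in> space (PiM {0..<n} ?M). map h [0..<n] = l}" for n l
  have A_sets: "A n l \<in> sets (PiM {0..<n} ?M)" for n l
    using measurable_sets[OF measurable_map_upt, of "{l}" n] by (simp add: A_def vimage_def Int_def conj_commute)
  have C: "emeasure (IT.C 0 n (\<lambda>_. undefined)) (A n l) = ennreal (w l)" if "length l = n" for n l
    using that
  proof (induction n arbitrary: l)
    case 0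
    then show ?case
      using emeasure_return[OF A_sets[of 0 "[]"], of "\<lambda>_. undefined"] by (simp add: A_def w0 space_PiM)
  next
    case (Suc n)
    then have "l \<noteq> []" by auto
    then obtain l' i where l: "l = l' @ [i]" by (metis append_butlast_last_id)
    have len: "length l' = n" using Suc l by simp
    let ?C = "IT.C 0 n (\<lambda>_. undefined)"
    have u: "(\<lambda>_. undefined) \<in> space (PiM {0..<0} ?M)" by (simp add: space_PiM)
    have spC: "space ?C = space (PiM {0..<n} ?M)" using IT.space_C[OF u, of n] by simp
    have setsC: "sets ?C = sets (PiM {0..<n} ?M)" using IT.sets_C[OF u, of n] by simp
    have "emeasure (IT.C 0 (Suc n) (\<lambda>_. undefined)) (A (Suc n) l) = (\<integral>\<^sup>+h. emeasure (IT.eP n h) (A (Suc n) l) \<partial>?C)"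
      using A_sets[of "Suc n" l] IT.measurable_eP[of n] prob_space.not_empty[OF IT.prob_space_C[OF u, of n]]
      by (simp add: emeasure_bind[where N = "PiM {0..<Suc n} ?M"] measurable_cong_sets[OF setsC refl])
    also have "\<dots> = (\<integral>\<^sup>+h. ennreal (pmf (K l') i) * indicator (A n l') h \<partial>?C)"
    proof (intro nn_integral_cong)
      fix h assume "h \<in> space ?C"
      then have h: "h \<in> space (PiM {0..<n} ?M)" by (simp add: spC)
      have "emeasure (IT.eP n h) (A (Suc n) l) = emeasure (?P n h) ((\<lambda>x. h(n := x)) -` A (Suc n) l)"
        using IT.emeasure_eP[OF h A_sets] by simp
      also have "(\<lambda>x. h(n := x)) -` A (Suc n) l = (if map h [0..<n] = l' then {i} else {})"
      proof -
        have "map (h(n := x)) [0..<n] = map h [0..<n]" for x by simp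
        moreover have "h(n := x) \<in> space (PiM {0..<Suc n} ?M)" for x
          using h by (auto simp: space_PiM PiE_iff extensional_def)
        ultimately have "h(n := x) \<in> A (Suc n) l \<longleftrightarrow> map h [0..<n] = l' \<and> x = i" for x
          by (simp add: A_def l)
        then show ?thesis by auto
      qed
      also have "emeasure (?P n h) \<dots> = ennreal (pmf (K l') i) * indicator (A n l') h"
        using h by (auto simp: A_def emeasure_pmf_single)
      finally show "emeasure (IT.eP n h) (A (Suc n) l) = ennreal (pmf (K l') i) * indicator (A n l') h" .
    qed
    also have "\<dots> = ennreal (pmf (K l') i) * ennreal (w l')"
      using A_sets[of n l'] Suc.IH[OF len] by (subst nn_integral_cmult_indicator) (auto simp: setsC)
    also have "\<dots> = ennreal (w l)"
      using pmf_K[of l' i] nn by (simp add: l ennreal_mult[symmetric] mult.commute)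
    finally show ?case .
  qed
  have sets_lim: "sets IT.PF.lim = sets borel"
  proof -
    have "sets IT.PF.lim = sets (PiM UNIV ?M)" by simp
    also have "\<dots> = sets (PiM UNIV (\<lambda>_::nat. borel :: nat measure))"
      by (rule sets_PiM_cong[OF refl]) (rule sets_borel_eq_count_space[symmetric])
    also have "\<dots> = sets borel" by (rule sets_PiM_equal_borel)
    finally show ?thesis .
  qed
  have lim: "emeasure IT.PF.lim (cyl l) = ennreal (w l)" for l
  proof -
    let ?n = "length l"
    have emb: "IT.PF.emb UNIV {0..<?n} (A ?n l) = cyl l"
    proof (rule set_eqI)
      fix y
      have "y \<in> IT.PF.emb UNIV {0..<?n} (A ?n l) \<longleftrightarrow> map (restrict y {0..<?n}) [0..<?n] = l"
        by (simp add: prod_emb_iff A_def space_PiM del: restrict_apply map_eq_conv)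
      also have "map (restrict y {0..<?n}) [0..<?n] = pre ?n y" by (simp add: pre_def)
      finally show "y \<in> IT.PF.emb UNIV {0..<?n} (A ?n l) \<longleftrightarrow> y \<in> cyl l" by (simp add: cyl_def)
    qed
    have "emeasure IT.PF.lim (cyl l) = emeasure (IT.CI {0..<?n}) (A ?n l)"
      unfolding emb[symmetric] by (rule IT.lim) (auto simp: A_sets)
    also have "\<dots> = emeasure (IT.C 0 ?n (\<lambda>_. undefined)) (IT.PF.emb {0..<?n} {0..<?n} (A ?n l))"
      by (rule IT.emeasure_CI) (auto simp: A_sets)
    also have "IT.PF.emb {0..<?n} {0..<?n} (A ?n l) = A ?n l"
      using sets.sets_into_space[OF A_sets[of ?n l]] by (auto simp: prod_emb_def space_PiM)
    also have "emeasure (IT.C 0 ?n (\<lambda>_. undefined)) \<dots> = ennreal (w l)" by (rule C) simp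
    finally show ?thesis .
  qed
  show thesis
  proof (rule that)
    show "prob_space IT.PF.lim"
      using lim[of "[]"] w0 sets_eq_imp_space_eq[OF sets_lim] by (intro prob_spaceI) simp
    show "measure IT.PF.lim (cyl l) = w l" for l
      using lim[of l] nn[of l] by (simp add: measure_def)
  qed (rule sets_lim)
qed


section \<open>The plan of a kernel\<close>

context kernel
begin

text \<open>
  The weight that the plan of the kernel is to give to the cylinder \<open>[x, l]\<close>.
\<close>

definition cyl_mean :: "nat \<Rightarrow> nat list \<Rightarrow> real" where
  "cyl_mean x l = lim_mean (\<lambda>z. of_bool (fst z = x \<and> snd z \<in> cyl l))"

lemma cylfun_cyl: "cylfun d (\<lambda>z. of_bool (fst z = x \<and> snd z \<in> cyl l))"
  by (rule cylfunI[where n = "length l" and F = "\<lambda>x' l'. of_bool (x' = x \<and> l' = l)"]) (simp add: in_cyl_iff)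

lemmas ucont_cyl = cylfun_ucont[OF cylfun_cyl]

lemma ucont_add: "ucont d f \<Longrightarrow> ucont d h \<Longrightarrow> ucont d (\<lambda>z. f z + h z)"
  unfolding ucont_def
proof (intro allI impI)
  fix e :: real assume f: "\<forall>e>0. \<exists>n. near d n e f" and h: "\<forall>e>0. \<exists>n. near d n e h" and e: "e > 0"
  then have "e / 2 > 0" by simp
  then obtain n m where "near d n (e / 2) f" "near d m (e / 2) h" using f h by blast
  then have n: "near d (max n m) (e / 2) f" "near d (max n m) (e / 2) h" by (auto elim: near_mono)
  have "near d (max n m) e (\<lambda>z. f z + h z)"
    unfolding near_def
  proof (intro ballI impI)
    fix x y w assume *: "x \<in> Xset" "y \<in> Omega d" "w \<in> Omega d" "pre (max n m) y = pre (max n m) w"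
    have "\<bar>f (x, y) - f (x, w)\<bar> \<le> e / 2" "\<bar>h (x, y) - h (x, w)\<bar> \<le> e / 2"
      using n * unfolding near_def by blast+
    then show "\<bar>f (x, y) + h (x, y) - (f (x, w) + h (x, w))\<bar> \<le> e" by linarith
  qed
  then show "\<exists>n. near d n e (\<lambda>z. f z + h z)" ..
qed

lemma ucont_const: "ucont d (\<lambda>_. a)"
  by (simp add: ucont_def near_def)

lemma ucont_sum: "finite I \<Longrightarrow> (\<And>i. i \<in> I \<Longrightarrow> ucont d (f i)) \<Longrightarrow> ucont d (\<lambda>z. \<Sum>i\<in>I. f i z)"
  by (induction I rule: finite_induct) (auto simp: ucont_const intro: ucont_add)

lemma lim_mean_sum: "finite I \<Longrightarrow> (\<And>i. i \<in> I \<Longrightarrow> ucont d (f i)) \<Longrightarrow> lim_mean (\<lambda>z. \<Sum>i\<in>I. f i z) = (\<Sum>i\<in>I. lim_mean (f i))"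
proof (induction I rule: finite_induct)
  case (insert i I)
  have "lim_mean (\<lambda>z. f i z + (\<Sum>i\<in>I. f i z)) = lim_mean (f i) + lim_mean (\<lambda>z. \<Sum>i\<in>I. f i z)"
    using insert by (intro lim_mean_add ucont_sum) auto
  then show ?case using insert by simp
qed (simp add: lim_mean_const)

lemma cyl_mean_nonneg: "cyl_mean x l \<ge> 0"
  unfolding cyl_mean_def using lim_mean_mono[OF ucont_const[of 0] ucont_cyl[of x l]] by (simp add: lim_mean_const)

lemma cyl_mean_snoc: "cyl_mean x l = (\<Sum>i\<in>{1..d}. cyl_mean x (l @ [i]))"
  unfolding cyl_mean_def
proof (subst lim_mean_sum[symmetric])
  show "lim_mean (\<lambda>z. of_bool (fst z = x \<and> snd z \<in> cyl l)) = lim_mean (\<lambda>z. \<Sum>i\<in>{1..d}. of_bool (fst z = x \<and> snd z \<in> cyl (l @ [i])))"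
  proof (rule lim_mean_cong)
    fix z assume z: "z \<in> State d"
    have "snd z (length l) \<in> {1..d}" using z by (auto simp: State_def Omega_nth_bounds)
    moreover have "(\<Sum>i\<in>{1..d}. of_bool (fst z = x \<and> snd z \<in> cyl (l @ [i]))) =
      (\<Sum>i\<in>{1..d}. if i = snd z (length l) then of_bool (fst z = x \<and> snd z \<in> cyl l) else (0::real))"
      by (intro sum.cong) (auto simp: in_cyl_iff pre_Suc_snoc)
    ultimately show "of_bool (fst z = x \<and> snd z \<in> cyl l) = (\<Sum>i\<in>{1..d}. of_bool (fst z = x \<and> snd z \<in> cyl (l @ [i])) :: real)"
      by simp
  qed
qed (auto intro: ucont_cyl)

lemma cyl_mean_Nil_sum: "(\<Sum>x\<in>Xset. cyl_mean x []) = 1"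
proof -
  have "(\<Sum>x\<in>Xset. cyl_mean x []) = lim_mean (\<lambda>z. \<Sum>x\<in>Xset. of_bool (fst z = x \<and> snd z \<in> cyl []))"
    unfolding cyl_mean_def by (rule lim_mean_sum[symmetric, OF finite_Xset ucont_cyl])
  also have "\<dots> = lim_mean (\<lambda>_. 1)"
    by (rule lim_mean_cong) (auto simp: State_def Xset_def)
  finally show ?thesis by (simp add: lim_mean_const)
qed

lemma cyl_mean_Cons:
  assumes xi: "x \<in> Xset" "i \<in> {1..d}" and l: "l \<noteq> []"
  shows "cyl_mean x (i # l) = g x i (hd l) * (\<Sum>x'\<in>Xset. cyl_mean x' l)"
proof -
  have eq: "markov_op (\<lambda>z. of_bool (fst z = x \<and> snd z \<in> cyl (i # l))) z
      = g x i (hd l) * (\<Sum>x'\<in>Xset. of_bool (fst z = x' \<and> snd z \<in> cyl l))" if z: "z \<in> State d" for z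
  proof -
    obtain j k where jk: "l = j # k" using l by (cases l) auto
    have "markov_op (\<lambda>z. of_bool (fst z = x \<and> snd z \<in> cyl (i # l))) z
      = (\<Sum>x'\<in>Xset. if x' = x then (\<Sum>i'\<in>{1..d}. if i' = i then g x i (snd z 0) * of_bool (snd z \<in> cyl l) else 0) else 0)"
      unfolding markov_op_def by (intro sum.cong refl) (auto simp: in_cyl_iff pre_scons intro!: sum.neutral sum.cong)
    also have "\<dots> = g x i (snd z 0) * of_bool (snd z \<in> cyl l)" using xi by simp
    also have "\<dots> = g x i (hd l) * of_bool (snd z \<in> cyl l)"
      by (auto simp: jk in_cyl_iff pre_Suc_Cons)
    also have "of_bool (snd z \<in> cyl l) = (\<Sum>x'\<in>Xset. if x' = fst z then of_bool (snd z \<in> cyl l) else (0::real))"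
      using z by (auto simp: State_def)
    also have "\<dots> = (\<Sum>x'\<in>Xset. of_bool (fst z = x' \<and> snd z \<in> cyl l))"
      by (intro sum.cong) auto
    finally show ?thesis .
  qed
  have "cyl_mean x (i # l) = lim_mean (markov_op (\<lambda>z. of_bool (fst z = x \<and> snd z \<in> cyl (i # l))))"
    unfolding cyl_mean_def by (rule lim_mean_markov_op[OF ucont_cyl, symmetric])
  also have "\<dots> = lim_mean (\<lambda>z. g x i (hd l) * (\<Sum>x'\<in>Xset. of_bool (fst z = x' \<and> snd z \<in> cyl l)))"
    by (rule lim_mean_cong[OF eq])
  also have "\<dots> = g x i (hd l) * lim_mean (\<lambda>z. \<Sum>x'\<in>Xset. of_bool (fst z = x' \<and> snd z \<in> cyl l))"
    by (rule lim_mean_cmult[OF ucont_sum[OF finite_Xset ucont_cyl]])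
  also have "lim_mean (\<lambda>z. \<Sum>x'\<in>Xset. of_bool (fst z = x' \<and> snd z \<in> cyl l))
      = (\<Sum>x'\<in>Xset. lim_mean (\<lambda>z. of_bool (fst z = x' \<and> snd z \<in> cyl l)))"
    by (rule lim_mean_sum[OF finite_Xset ucont_cyl])
  finally show ?thesis by (simp add: cyl_mean_def)
qed

lemma cyl_mean_shift:
  assumes l: "set l \<subseteq> {1..d}"
  shows "(\<Sum>x\<in>Xset. \<Sum>i\<in>{1..d}. cyl_mean x (i # l)) = (\<Sum>x\<in>Xset. cyl_mean x l)"
proof (cases "l = []")
  case True
  then show ?thesis using cyl_mean_snoc[of _ "[]"] by simp
next
  case False
  then have hd: "hd l \<in> {1..d}" using l hd_in_set by blast
  have "(\<Sum>x\<in>Xset. \<Sum>i\<in>{1..d}. cyl_mean x (i # l)) = (\<Sum>x\<in>Xset. \<Sum>i\<in>{1..d}. g x i (hd l)) * (\<Sum>x\<in>Xset. cyl_mean x l)"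
    using False by (simp add: cyl_mean_Cons sum_distrib_right)
  then show ?thesis using g_sum[OF hd] by simp
qed

end

lemma closed_Omega: "closed (Omega d)"
proof -
  have "closed ((\<lambda>y::nat \<Rightarrow> nat. y k) -` {1..d})" for k
    by (rule closed_vimage[OF closed_atLeastAtMost continuous_coord])
  then have "closed (\<Inter>k. (\<lambda>y::nat \<Rightarrow> nat. y k) -` {1..d})" by (intro closed_INT) auto
  also have "(\<Inter>k. (\<lambda>y::nat \<Rightarrow> nat. y k) -` {1..d}) = Omega d" by (auto simp: Omega_def)
  finally show ?thesis .
qed

lemma finite_measure_eqI_cyl_Omega:
  assumes M: "finite_measure M" "sets M = sets (restrict_space borel (Omega d))"
    and N: "finite_measure N" "sets N = sets (restrict_space borel (Omega d))"
    and eq: "\<And>l. measure M (cyl l \<inter> Omega d) = measure N (cyl l \<inter> Omega d)"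
  shows "M = N"
proof -
  have Om: "Omega d \<in> sets borel" using closed_Omega by (rule borel_closed)
  have sp: "space M = Omega d" "space N = Omega d"
    using sets_eq_imp_space_eq[OF M(2)] sets_eq_imp_space_eq[OF N(2)] by (simp_all add: space_restrict_space)
  have m: "(\<lambda>y. y) \<in> restrict_space borel (Omega d) \<rightarrow>\<^sub>M borel"
    by (rule measurable_restrict_space1) simp
  have mM: "(\<lambda>y. y) \<in> M \<rightarrow>\<^sub>M borel" and mN: "(\<lambda>y. y) \<in> N \<rightarrow>\<^sub>M borel"
    using m by (simp_all only: measurable_cong_sets[OF M(2) refl] measurable_cong_sets[OF N(2) refl])
  have "distr M borel (\<lambda>y. y) = distr N borel (\<lambda>y. y)"
  proof (rule finite_measure_eqI_cyl)
    show "measure (distr M borel (\<lambda>y. y)) (cyl l) = measure (distr N borel (\<lambda>y. y)) (cyl l)" for l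
      using eq[of l] by (simp add: measure_distr[OF mM] measure_distr[OF mN] sp vimage_def)
  qed (auto intro!: finite_measure.finite_measure_distr M N mM mN)
  note d_eq = this
  show ?thesis
  proof (rule measure_eqI)
    show "sets M = sets N" using M N by simp
    fix A assume A: "A \<in> sets M"
    then obtain B where B: "B \<in> sets borel" "A = Omega d \<inter> B"
      using M(2) by (auto simp: sets_restrict_space)
    have "emeasure (distr M borel (\<lambda>y. y)) A = emeasure (distr N borel (\<lambda>y. y)) A" by (simp add: d_eq)
    moreover have Ab: "A \<in> sets borel" using B Om by auto
    moreover have "A \<inter> Omega d = A" using B by auto
    ultimately show "emeasure M A = emeasure N A"
      by (simp add: emeasure_distr[OF mM] emeasure_distr[OF mN] sp)
  qed
qed

context kernel
begin

text \<open>
  The first coordinate \<open>x\<close> is treated as an additional letter in front of the sequence, which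
  is possible as \<open>Xset \<subseteq> {1..d}\<close>.
\<close>

lemma exists_plan:
  "\<exists>\<pi>. inv_plan d \<pi> \<and> (\<forall>x\<in>Xset. \<forall>l. set l \<subseteq> {1..d} \<longrightarrow> plan_space.weight d \<pi> x l = cyl_mean x l)"
proof -
  define w where "w l = (case l of [] \<Rightarrow> 1 | x # k \<Rightarrow> if x \<in> Xset \<and> set k \<subseteq> {1..d} then cyl_mean x k else 0)" for l
  have X: "Xset \<subseteq> {1..d}" using d2 by (auto simp: Xset_def)
  obtain N :: "(nat \<Rightarrow> nat) measure" where N: "prob_space N" "sets N = sets borel" "\<And>l. measure N (cyl l) = w l"
  proof (rule exists_measure_of_cyl)
    show "w l \<ge> 0" for l by (auto simp: w_def cyl_mean_nonneg split: list.split)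
    show "w [] = 1" by (simp add: w_def)
    show "w (l @ [i]) = 0" if "i \<notin> {1..d}" for l i
      using that X by (cases l) (auto simp: w_def)
    show "w l = (\<Sum>i\<in>{1..d}. w (l @ [i]))" for l
    proof (cases l)
      case Nil
      have "(\<Sum>i\<in>{1..d}. w (l @ [i])) = (\<Sum>i\<in>{1..d}. if i \<in> Xset then cyl_mean i [] else 0)"
        by (intro sum.cong) (auto simp: w_def Nil)
      also have "\<dots> = (\<Sum>i\<in>{1..d} \<inter> Xset. cyl_mean i [])" by (subst sum.inter_restrict) auto
      also have "{1..d} \<inter> Xset = Xset" using X by auto
      finally show ?thesis using cyl_mean_Nil_sum by (simp add: w_def Nil)
    next
      case (Cons x k)
      have "(\<Sum>i\<in>{1..d}. w (l @ [i])) = (\<Sum>i\<in>{1..d}. if x \<in> Xset \<and> set k \<subseteq> {1..d} then cyl_mean x (k @ [i]) else 0)"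
        by (intro sum.cong) (auto simp: w_def Cons)
      also have "\<dots> = w l"
      proof (cases "x \<in> Xset \<and> set k \<subseteq> {1..d}")
        case True
        then show ?thesis using cyl_mean_snoc[of x k] by (simp add: w_def Cons)
      next
        case False
        then show ?thesis unfolding w_def Cons by (simp only: if_False list.case) simp
      qed
      finally show ?thesis by simp
    qed
  qed auto
  interpret N: prob_space N by fact
  let ?St = "restrict_space borel (Xset \<times> Omega d)"
  define S where "S = {s :: nat \<Rightarrow> nat. s 0 \<in> Xset \<and> shift s \<in> Omega d}"
  have S_sets: "S \<in> sets borel"
  proof -
    have "S = (\<lambda>s. s 0) -` Xset \<inter> shift -` Omega d" by (auto simp: S_def)
    moreover have "(\<lambda>s::nat \<Rightarrow> nat. s 0) -` Xset \<inter> space borel \<in> sets borel"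
      by (rule measurable_sets[OF measurable_coord]) simp
    moreover have "shift -` Omega d \<inter> space borel \<in> sets borel"
      by (rule measurable_sets[OF borel_measurable_shift borel_closed[OF closed_Omega]])
    ultimately show ?thesis by simp
  qed
  have AE_S: "AE s in N. s \<in> S"
  proof (rule AE_I')
    show "(\<Union>l\<in>{l. w l = 0}. cyl l) \<in> null_sets N"
      using N by (intro null_sets_UN') (auto simp: N.emeasure_eq_measure intro!: null_setsI)
    show "{s \<in> space N. s \<notin> S} \<subseteq> (\<Union>l\<in>{l. w l = 0}. cyl l)"
    proof
      fix s assume "s \<in> {s \<in> space N. s \<notin> S}"
      then consider "s 0 \<notin> Xset" | "shift s \<notin> Omega d" by (auto simp: S_def)
      then obtain n where "w (pre n s) = 0"
      proof cases
        case 1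
        then have "w (pre (Suc 0) s) = 0" by (simp add: pre_Suc_Cons w_def)
        then show ?thesis by (rule that)
      next
        case 2
        then obtain k where k: "shift s k \<notin> {1..d}" unfolding Omega_def Pi_def by blast
        have "shift s k \<in> set (pre (Suc k) (shift s))" by (simp add: pre_Suc_snoc)
        then have "w (s 0 # pre (Suc k) (shift s)) = 0" using k unfolding w_def by auto
        then have "w (pre (Suc (Suc k)) s) = 0" by (subst pre_Suc_Cons)
        then show ?thesis by (rule that)
      qed
      then show "s \<in> (\<Union>l\<in>{l. w l = 0}. cyl l)" by (intro UN_I[of "pre n s"]) (auto simp: cyl_pre)
    qed
  qed
  \<comment> \<open>Off the set \<open>S\<close> of full measure the value is an arbitrary state.\<close>
  define G where "G s = (if s \<in> S then (s 0, shift s) else (1, \<lambda>_. 1))" for s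
  have pair: "(\<lambda>s::nat \<Rightarrow> nat. (s 0, shift s)) \<in> borel \<rightarrow>\<^sub>M borel"
    by (intro borel_measurable_continuous_onI continuous_on_Pair continuous_coord continuous_shift)
  have G: "G \<in> N \<rightarrow>\<^sub>M ?St"
  proof (rule measurable_restrict_space2)
    show "G \<in> space N \<rightarrow> Xset \<times> Omega d"
      using State_witness by (auto simp: G_def S_def State_def)
    have "G \<in> borel \<rightarrow>\<^sub>M borel"
      unfolding G_def using S_sets by (intro measurable_If_set pair) auto
    then show "G \<in> N \<rightarrow>\<^sub>M borel" by (simp only: measurable_cong_sets[OF N(2) refl])
  qed
  define \<pi> where "\<pi> = distr N ?St G"
  have ps: "plan_space d \<pi>"
    unfolding plan_space_def plans_def \<pi>_def using N.prob_space_distr[OF G] by simp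
  interpret P: plan_space d \<pi> by fact
  have weight: "P.weight x l = cyl_mean x l" if x: "x \<in> Xset" and l: "set l \<subseteq> {1..d}" for x l
  proof -
    have "P.weight x l = measure N (G -` ({x} \<times> (cyl l \<inter> Omega d)) \<inter> space N)"
      unfolding P.weight_def using P.sets_weight[OF x, of l] by (simp add: \<pi>_def measure_distr[OF G])
    also have "\<dots> = measure N (cyl (x # l))"
    proof (rule N.finite_measure_eq_AE)
      show "AE s in N. (s \<in> G -` ({x} \<times> (cyl l \<inter> Omega d)) \<inter> space N) = (s \<in> cyl (x # l))"
        using AE_S AE_space
        by eventually_elim (auto simp: G_def S_def in_cyl_iff pre_Suc_Cons)
      show "G -` ({x} \<times> (cyl l \<inter> Omega d)) \<inter> space N \<in> sets N"
        using P.sets_weight[OF x, of l] by (intro measurable_sets[OF G]) (simp add: \<pi>_def)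
    qed (simp add: N)
    also have "\<dots> = cyl_mean x l" using x l by (simp add: N w_def)
    finally show ?thesis .
  qed
  have inv: "distr (Omega_marginal d \<pi>) (restrict_space borel (Omega d)) shift = Omega_marginal d \<pi>"
  proof (rule finite_measure_eqI_cyl_Omega)
    have fin: "prob_space (Omega_marginal d \<pi>)"
      unfolding Omega_marginal_def by (rule P.prob_space_distr[OF P.measurable_snd_Omega])
    then show "finite_measure (Omega_marginal d \<pi>)" by (simp add: prob_space_def)
    show "finite_measure (distr (Omega_marginal d \<pi>) (restrict_space borel (Omega d)) shift)"
      using prob_space.prob_space_distr[OF fin P.measurable_shift_marginal] by (simp add: prob_space_def)
    show "measure (distr (Omega_marginal d \<pi>) (restrict_space borel (Omega d)) shift) (cyl l \<inter> Omega d)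
       = measure (Omega_marginal d \<pi>) (cyl l \<inter> Omega d)" for l
    proof (cases "set l \<subseteq> {1..d}")
      case True
      then have l: "l \<in> words d (length l)" by (simp add: words_def)
      show ?thesis
        using cyl_mean_shift[OF True] True
        by (simp add: P.measure_distr_shift_marginal P.prob_shift_sum[OF l] P.measure_marginal P.marg_sum[OF l] weight)
    next
      case False
      have "cyl l \<inter> Omega d = {}"
      proof -
        have "y \<notin> cyl l" if "y \<in> Omega d" for y
          using False pre_in_words[OF that, of "length l"] by (auto simp: in_cyl_iff words_def)
        then show ?thesis by blast
      qed
      then show ?thesis by simp
    qed
  qed (simp_all add: Omega_marginal_def)
  show ?thesis
    using ps inv weight by (intro exI[of _ \<pi>]) (auto simp: inv_plan_def inv_plan_axioms_def)
qed

end

section \<open>The variational inequality\<close>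

context inv_plan
begin

lemma integral_shift:
  fixes F :: "nat list \<Rightarrow> real"
  shows "(\<integral>z. F (pre n (shift (snd z))) \<partial>\<pi>) = (\<integral>z. F (pre n (snd z)) \<partial>\<pi>)"
proof -
  have "(\<integral>z. F (pre n (shift (snd z))) \<partial>\<pi>) = (\<integral>z. F (tl (pre (Suc n) (snd z))) \<partial>\<pi>)"
    by (simp add: pre_Suc_Cons)
  also have "\<dots> = (\<Sum>x\<in>Xset. \<Sum>l\<in>words d (Suc n). F (tl l) * weight x l)"
    by (rule integral_pre(2)[where F = "\<lambda>x l. F (tl l)"])
  also have "\<dots> = (\<Sum>l\<in>words d n. F l * (\<Sum>x\<in>Xset. \<Sum>i\<in>{1..d}. weight x (i # l)))"
    by (simp add: sum_words_Cons sum_distrib_left sum.swap[of _ "words d n"])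
  also have "\<dots> = (\<Sum>l\<in>words d n. F l * (\<Sum>x\<in>Xset. weight x l))"
  proof (intro sum.cong refl)
    fix l assume l: "l \<in> words d n"
    show "F l * (\<Sum>x\<in>Xset. \<Sum>i\<in>{1..d}. weight x (i # l)) = F l * (\<Sum>x\<in>Xset. weight x l)"
      using marg_Cons[OF l] marg_sum[OF l] by simp
  qed
  also have "\<dots> = (\<Sum>x\<in>Xset. \<Sum>l\<in>words d n. F l * weight x l)"
    by (simp add: sum_distrib_left sum.swap[of _ Xset])
  also have "\<dots> = (\<integral>z. F (pre n (snd z)) \<partial>\<pi>)"
    by (rule integral_pre(2)[where F = "\<lambda>x l. F l", symmetric])
  finally show ?thesis .
qed

lemma integrable_cost: "integrable \<pi> (\<lambda>z. B (fst z) (snd z 0) (snd z 1) :: real)"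
proof -
  have "integrable \<pi> (\<lambda>z. (\<lambda>x l. B x (l ! 0) (l ! 1)) (fst z) (pre 2 (snd z)))"
    by (rule integral_pre(1))
  then show ?thesis by simp
qed

lemma integrable_letter: "integrable \<pi> (\<lambda>z. h (snd z k) :: real)"
proof -
  have "integrable \<pi> (\<lambda>z. (\<lambda>x l. h (l ! k)) (fst z) (pre (Suc k) (snd z)))"
    by (rule integral_pre(1))
  then show ?thesis by simp
qed

lemma integral_letter: "(\<integral>z. h (snd z 1) \<partial>\<pi>) = (\<integral>z. h (snd z 0) \<partial>\<pi> :: real)"
  using integral_shift[of "\<lambda>l. h (l ! 0)" 1] by (simp add: shift_def)

lemma integral_cost_words:
  assumes "n \<ge> 1"
  shows "(\<integral>z. B (fst z) (snd z 0) (snd z 1) \<partial>\<pi>) = (\<Sum>x\<in>Xset. \<Sum>i\<in>{1..d}. \<Sum>l\<in>words d n. weight x (i # l) * B x i (hd l) :: real)"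
proof -
  have "(\<integral>z. B (fst z) (snd z 0) (snd z 1) \<partial>\<pi>) = (\<integral>z. (\<lambda>x l. B x (l ! 0) (l ! 1)) (fst z) (pre (Suc n) (snd z)) \<partial>\<pi>)"
    using assms by simp
  also have "\<dots> = (\<Sum>x\<in>Xset. \<Sum>l\<in>words d (Suc n). B x (l ! 0) (l ! 1) * weight x l)"
    by (rule integral_pre(2))
  also have "\<dots> = (\<Sum>x\<in>Xset. \<Sum>i\<in>{1..d}. \<Sum>l\<in>words d n. weight x (i # l) * B x i (hd l))"
  proof -
    have "hd l = l ! 0" if "l \<in> words d n" for l
      using that assms by (intro hd_conv_nth) (auto simp: words_def)
    then show ?thesis by (simp add: sum_words_Cons mult.commute)
  qed
  finally show ?thesis .
qed

lemma hd_words: "l \<in> words d n \<Longrightarrow> n \<ge> 1 \<Longrightarrow> hd l \<in> {1..d}"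
  using hd_in_set[of l] by (fastforce simp: words_def)

text \<open>
  The variational inequality for a sub-stochastic kernel \<open>q x i j\<close>. In the equality case all the finite
  approximations to the entropy coincide with it, so the equality case of Gibbs' inequality applies
  for every \<open>n\<close>.
\<close>

theorem entropy_subkernel:
  assumes q_pos: "\<And>x i j. x \<in> Xset \<Longrightarrow> i \<in> {1..d} \<Longrightarrow> j \<in> {1..d} \<Longrightarrow> q x i j > 0"
    and q_sum: "\<And>j. j \<in> {1..d} \<Longrightarrow> (\<Sum>x\<in>Xset. \<Sum>i\<in>{1..d}. q x i j) \<le> 1"
  shows "(\<integral>z. ln (q (fst z) (snd z 0) (snd z 1)) \<partial>\<pi>) + plan_entropy d \<pi> \<le> 0"
    and "(\<integral>z. ln (q (fst z) (snd z 0) (snd z 1)) \<partial>\<pi>) + plan_entropy d \<pi> = 0 \<Longrightarrow>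
      x \<in> Xset \<Longrightarrow> i \<in> {1..d} \<Longrightarrow> l \<in> words d n \<Longrightarrow> n \<ge> 1 \<Longrightarrow> weight x (i # l) = q x i (hd l) * marg l"
proof -
  let ?I = "\<integral>z. ln (q (fst z) (snd z 0) (snd z 1)) \<partial>\<pi>"
  have le: "?I + cond_entropy n \<le> 0"
    and eq: "?I + cond_entropy n = 0 \<Longrightarrow> x \<in> Xset \<Longrightarrow> i \<in> {1..d} \<Longrightarrow> l \<in> words d n \<Longrightarrow> weight x (i # l) = q x i (hd l) * marg l"
    if n: "n \<ge> 1" for n x i l
  proof -
    have I: "?I = (\<Sum>x\<in>Xset. \<Sum>i\<in>{1..d}. \<Sum>l\<in>words d n. weight x (i # l) * ln (q x i (hd l)))"
      by (rule integral_cost_words[OF n])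
    have 1: "\<And>x i l. x \<in> Xset \<Longrightarrow> i \<in> {1..d} \<Longrightarrow> l \<in> words d n \<Longrightarrow> q x i (hd l) > 0"
      using q_pos hd_words[OF _ n] by blast
    have 2: "\<And>l. l \<in> words d n \<Longrightarrow> (\<Sum>x\<in>Xset. \<Sum>i\<in>{1..d}. q x i (hd l)) \<le> 1"
      using q_sum hd_words[OF _ n] by blast
    show "?I + cond_entropy n \<le> 0"
      unfolding I using gibbs(1)[of n "\<lambda>x i l. q x i (hd l)", OF less_imp_le[OF 1] 1 2] by simp
    show "weight x (i # l) = q x i (hd l) * marg l" if "?I + cond_entropy n = 0" "x \<in> Xset" "i \<in> {1..d}" "l \<in> words d n"
      using gibbs(2)[of n "\<lambda>x i l. q x i (hd l)", OF less_imp_le[OF 1] 1 2 _ that(2-4)] that(1) unfolding I by simp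
  qed
  show "?I + plan_entropy d \<pi> \<le> 0" using le[of 1] plan_entropy_le_cond_entropy[of 1] by simp
  assume *: "?I + plan_entropy d \<pi> = 0" "x \<in> Xset" "i \<in> {1..d}" "l \<in> words d n" "n \<ge> 1"
  have "?I + cond_entropy n = 0" using le[OF *(5)] plan_entropy_le_cond_entropy[of n] *(1) by linarith
  then show "weight x (i # l) = q x i (hd l) * marg l" using eq[OF *(5)] * by blast
qed

lemma space_plan_letters: "z \<in> space \<pi> \<Longrightarrow> fst z \<in> Xset \<and> snd z k \<in> {1..d}"
  by (auto simp: space_plan Omega_nth_bounds)

text \<open>
  The coboundary \<open>ln h\<close> drops out by invariance.
\<close>

lemma integral_ln_cocycle:
  assumes h: "\<And>i. i \<in> {1..d} \<Longrightarrow> h i > (0::real)" and k: "k > 0"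
  shows "(\<integral>z. ln (exp (B (fst z) (snd z 0) (snd z 1)) * h (snd z 0) / (k * h (snd z 1))) \<partial>\<pi>)
    = (\<integral>z. B (fst z) (snd z 0) (snd z 1) \<partial>\<pi>) - ln k"
proof -
  have "(\<integral>z. ln (exp (B (fst z) (snd z 0) (snd z 1)) * h (snd z 0) / (k * h (snd z 1))) \<partial>\<pi>)
    = (\<integral>z. B (fst z) (snd z 0) (snd z 1) + ln (h (snd z 0)) - ln (h (snd z 1)) - ln k \<partial>\<pi>)"
  proof (rule Bochner_Integration.integral_cong[OF refl])
    fix z assume "z \<in> space \<pi>"
    then have "h (snd z 0) > 0" "h (snd z 1) > 0" using h space_plan_letters by blast+
    then show "ln (exp (B (fst z) (snd z 0) (snd z 1)) * h (snd z 0) / (k * h (snd z 1)))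
      = B (fst z) (snd z 0) (snd z 1) + ln (h (snd z 0)) - ln (h (snd z 1)) - ln k"
      using k by (simp add: ln_mult ln_div)
  qed
  also have "\<dots> = (\<integral>z. B (fst z) (snd z 0) (snd z 1) \<partial>\<pi>) - ln k"
    using integrable_cost[of B] integrable_letter[of "\<lambda>i. ln (h i)"] integral_letter[of "\<lambda>i. ln (h i)"]
    by (simp add: prob_space)
  finally show ?thesis .
qed

text \<open>
  Every positive test vector \<open>h\<close> bounds the value of every invariant plan, hence the pressure.
\<close>

theorem pressure_bound:
  assumes h: "\<And>i. i \<in> {1..d} \<Longrightarrow> h i > 0" and k: "k > 0"
    and le: "\<And>j. j \<in> {1..d} \<Longrightarrow> (\<Sum>x\<in>Xset. \<Sum>i\<in>{1..d}. exp (B x i j) * h i) \<le> k * h j"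
  shows "(\<integral>z. B (fst z) (snd z 0) (snd z 1) \<partial>\<pi>) + plan_entropy d \<pi> \<le> ln k"
proof -
  have "(\<integral>z. ln (exp (B (fst z) (snd z 0) (snd z 1)) * h (snd z 0) / (k * h (snd z 1))) \<partial>\<pi>) + plan_entropy d \<pi> \<le> 0"
  proof (rule entropy_subkernel(1)[where q = "\<lambda>x i j. exp (B x i j) * h i / (k * h j)"])
    show "exp (B x i j) * h i / (k * h j) > 0" if "i \<in> {1..d}" "j \<in> {1..d}" for x i j
      using h that k by simp
    show "(\<Sum>x\<in>Xset. \<Sum>i\<in>{1..d}. exp (B x i j) * h i / (k * h j)) \<le> 1" if "j \<in> {1..d}" for j
      using le[OF that] h[OF that] k by (simp add: sum_divide_distrib[symmetric] divide_le_eq_1)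
  qed
  then show ?thesis using integral_ln_cocycle[where h = h and k = k and B = B, OF h k] by simp
qed

end

section \<open>Equilibrium plans of a kernel\<close>

text \<open>
  An invariant plan under which \<open>g\<close> is the conditional distribution of \<open>x\<close> and the first letter given
  the remaining letters.
\<close>

locale kernel_plan = kernel d g + inv_plan d \<pi> for d g \<pi> +
  assumes kernel_rel: "\<And>x i l n. x \<in> Xset \<Longrightarrow> i \<in> {1..d} \<Longrightarrow> l \<in> words d n \<Longrightarrow> n \<ge> 1 \<Longrightarrow> weight x (i # l) = g x i (hd l) * marg l"
begin

text \<open>
  Almost everywhere, \<open>Jn_plan\<close> equals \<open>g\<close> at every index \<open>n \<ge> 2\<close>.
\<close>

lemma plan_entropy_kernel: "plan_entropy d \<pi> = - (\<integral>z. ln (g (fst z) (snd z 0) (snd z 1)) \<partial>\<pi>)"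
proof -
  have "AE z in \<pi>. J_plan d \<pi> z = g (fst z) (snd z 0) (snd z 1)"
    using AE_weight_pos AE_space
  proof eventually_elim
    case (elim z)
    have "Jn_plan d \<pi> (Suc n) z = g (fst z) (snd z 0) (snd z 1)" if n: "n \<ge> 1" for n
    proof -
      have l: "pre n (shift (snd z)) \<in> words d n" using elim(2) by (auto simp: space_plan pre_in_words shift_in_Omega)
      have hd: "hd (pre n (shift (snd z))) = snd z 1" using n by (cases n) (auto simp: pre_Suc_Cons shift_def)
      have weight: "weight (fst z) (snd z 0 # pre n (shift (snd z))) = g (fst z) (snd z 0) (snd z 1) * marg (pre n (shift (snd z)))"
        using kernel_rel[OF _ _ l n, of "fst z" "snd z 0"] space_plan_letters[OF elim(2)] hd by simp
      have "weight (fst z) (pre (Suc n) (snd z)) > 0" using elim(1) by blast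
      then have "marg (pre n (shift (snd z))) \<noteq> 0" using weight by (auto simp: pre_Suc_Cons)
      then show ?thesis using Jn_eq_cond_weight[OF elim(2)] elim(1) weight by (simp add: cond_weight_def pre_Suc_Cons)
    qed
    then have "\<forall>\<^sub>F n in sequentially. Jn_plan d \<pi> n z = g (fst z) (snd z 0) (snd z 1)"
      by (intro eventually_sequentiallyI[of 2]) (metis Suc_le_D Suc_le_mono numeral_2_eq_2 One_nat_def)
    then have "(\<lambda>n. Jn_plan d \<pi> n z) \<longlonglongrightarrow> g (fst z) (snd z 0) (snd z 1)" by (rule tendsto_eventually)
    then show ?case unfolding J_plan_def by (rule limI)
  qed
  note AE = this
  have "(\<integral>z. ln (J_plan d \<pi> z) \<partial>\<pi>) = (\<integral>z. ln (g (fst z) (snd z 0) (snd z 1)) \<partial>\<pi>)"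
  proof (rule integral_cong_AE)
    show "AE z in \<pi>. ln (J_plan d \<pi> z) = ln (g (fst z) (snd z 0) (snd z 1))"
      using AE by eventually_elim simp
    show "(\<lambda>z. ln (J_plan d \<pi> z)) \<in> borel_measurable \<pi>"
      using borel_measurable_J_plan by measurable
    show "(\<lambda>z. ln (g (fst z) (snd z 0) (snd z 1))) \<in> borel_measurable \<pi>"
      using integrable_cost[of "\<lambda>x i j. ln (g x i j)"] by (rule borel_measurable_integrable)
  qed
  then show ?thesis by (simp add: plan_entropy_def)
qed

lemma State_space: "z \<in> State d \<longleftrightarrow> z \<in> space \<pi>"
  by (simp add: State_def space_plan)

text \<open>
  The plan is invariant under the transition operator.
\<close>

lemma integral_markov_op_cylfun:
  assumes "cylfun d f"
  shows "cylfun d (markov_op f)" and "(\<integral>z. markov_op f z \<partial>\<pi>) = (\<integral>z. f z \<partial>\<pi>)"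
proof -
  obtain n F where n: "n \<ge> 2" and F: "\<And>z. z \<in> State d \<Longrightarrow> f z = F (fst z) (pre n (snd z))"
    by (rule cylfunE[OF assms, where m = 2]) (rule that)
  then obtain m where m: "n = Suc m" "m \<ge> 1" by (cases n) auto
  define F' where "F' l = (\<Sum>x\<in>Xset. \<Sum>i\<in>{1..d}. g x i (hd l) * F x (i # l))" for l
  have markov_op: "markov_op f z = F' (pre m (snd z))" if z: "z \<in> State d" for z
  proof -
    have hd: "hd (pre m (snd z)) = snd z 0" using m(2) by (cases m) (auto simp: pre_Suc_Cons)
    have "f (x, scons i (snd z)) = F x (i # pre m (snd z))" if "x \<in> Xset" "i \<in> {1..d}" for x i
      using F[OF scons_State[OF z that]] by (simp add: m pre_scons)
    then show ?thesis by (simp add: markov_op_def F'_def hd)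
  qed
  then show "cylfun d (markov_op f)" by (rule cylfunI[where F = "\<lambda>_. F'"])
  have "(\<integral>z. markov_op f z \<partial>\<pi>) = (\<integral>z. (\<lambda>_. F') (fst z) (pre m (snd z)) \<partial>\<pi>)"
    using markov_op by (intro Bochner_Integration.integral_cong) (auto simp: State_space)
  also have "\<dots> = (\<Sum>x\<in>Xset. \<Sum>l\<in>words d m. F' l * weight x l)" by (rule integral_pre(2))
  also have "\<dots> = (\<Sum>l\<in>words d m. F' l * marg l)"
    by (subst sum.swap) (simp add: marg_sum sum_distrib_left)
  also have "\<dots> = (\<Sum>l\<in>words d m. \<Sum>x\<in>Xset. \<Sum>i\<in>{1..d}. F x (i # l) * weight x (i # l))"
  proof (intro sum.cong refl)
    fix l assume l: "l \<in> words d m"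
    have "F' l * marg l = (\<Sum>x\<in>Xset. \<Sum>i\<in>{1..d}. F x (i # l) * (g x i (hd l) * marg l))"
      unfolding F'_def sum_distrib_right by (simp add: mult_ac)
    also have "\<dots> = (\<Sum>x\<in>Xset. \<Sum>i\<in>{1..d}. F x (i # l) * weight x (i # l))"
      using kernel_rel[OF _ _ l m(2)] by (intro sum.cong refl) simp
    finally show "F' l * marg l = (\<Sum>x\<in>Xset. \<Sum>i\<in>{1..d}. F x (i # l) * weight x (i # l))" .
  qed
  also have "\<dots> = (\<Sum>x\<in>Xset. \<Sum>l\<in>words d n. F x l * weight x l)"
    by (simp add: m sum_words_Cons sum.swap[of _ "words d m"])
  also have "\<dots> = (\<integral>z. F (fst z) (pre n (snd z)) \<partial>\<pi>)" by (rule integral_pre(2)[symmetric])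
  also have "\<dots> = (\<integral>z. f z \<partial>\<pi>)"
    using F by (intro Bochner_Integration.integral_cong) (auto simp: State_space)
  finally show "(\<integral>z. markov_op f z \<partial>\<pi>) = (\<integral>z. f z \<partial>\<pi>)" .
qed

lemma integrable_cylfun: "cylfun d f \<Longrightarrow> integrable \<pi> f"
proof -
  assume "cylfun d f"
  then obtain n F where "\<And>z. z \<in> State d \<Longrightarrow> f z = F (fst z) (pre n (snd z))" unfolding cylfun_def by auto
  then have "integrable \<pi> f \<longleftrightarrow> integrable \<pi> (\<lambda>z. F (fst z) (pre n (snd z)))"
    by (intro Bochner_Integration.integrable_cong) (auto simp: State_space)
  then show ?thesis using integral_pre(1) by simp
qed

lemma abs_integral_diff_le:
  assumes "integrable \<pi> f" "integrable \<pi> h" "\<And>z. z \<in> State d \<Longrightarrow> \<bar>f z - h z\<bar> \<le> e"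
  shows "\<bar>(\<integral>z. f z \<partial>\<pi>) - (\<integral>z. h z \<partial>\<pi>)\<bar> \<le> (e :: real)"
proof -
  have "\<bar>(\<integral>z. f z \<partial>\<pi>) - (\<integral>z. h z \<partial>\<pi>)\<bar> = \<bar>\<integral>z. f z - h z \<partial>\<pi>\<bar>" using assms by simp
  also have "\<dots> \<le> (\<integral>z. \<bar>f z - h z\<bar> \<partial>\<pi>)" by (rule integral_abs_bound)
  also have "\<dots> \<le> (\<integral>z. e \<partial>\<pi>)" using assms by (intro integral_mono) (auto simp: State_space)
  finally show ?thesis by (simp add: prob_space)
qed

lemma integral_cylfun: "cylfun d f \<Longrightarrow> (\<integral>z. f z \<partial>\<pi>) = lim_mean f"
proof -
  assume f: "cylfun d f"
  have n: "cylfun d ((markov_op ^^ n) f) \<and> (\<integral>z. (markov_op ^^ n) f z \<partial>\<pi>) = (\<integral>z. f z \<partial>\<pi>)" for n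
  proof (induction n)
    case (Suc n)
    then show ?case using integral_markov_op_cylfun[of "(markov_op ^^ n) f"] by simp
  qed (simp add: f)
  have "\<bar>(\<integral>z. f z \<partial>\<pi>) - lim_mean f\<bar> \<le> e" if e: "e > 0" for e
  proof -
    obtain N where "\<forall>n\<ge>N. \<forall>z\<in>State d. \<bar>(markov_op ^^ n) f z - lim_mean f\<bar> \<le> e"
      using markov_op_pow_tendsto_uniform[OF cylfun_ucont[OF f] e] by blast
    then have "\<bar>(\<integral>z. (markov_op ^^ N) f z \<partial>\<pi>) - (\<integral>z. lim_mean f \<partial>\<pi>)\<bar> \<le> e"
      using n[of N] by (intro abs_integral_diff_le integrable_cylfun) (auto simp: cylfun_const)
    then show ?thesis using n[of N] by (simp add: prob_space)
  qed
  then have "\<bar>(\<integral>z. f z \<partial>\<pi>) - lim_mean f\<bar> \<le> 0 + e" if "e > 0" for e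
    using that by simp
  then have "\<bar>(\<integral>z. f z \<partial>\<pi>) - lim_mean f\<bar> \<le> 0" by (rule field_le_epsilon)
  then show ?thesis by simp
qed

theorem integral_eq_lim_mean:
  assumes f: "ucont d f" and m: "f \<in> borel_measurable \<pi>"
  shows "(\<integral>z. f z \<partial>\<pi>) = lim_mean f"
proof -
  have d1: "d \<ge> 1" using d2 by simp
  obtain B where B: "\<And>z. z \<in> State d \<Longrightarrow> \<bar>f z\<bar> \<le> B" using ucont_bounded[OF f d1] by auto
  have int: "integrable \<pi> f"
    using m B by (intro integrable_const_bound[of _ B]) (auto simp: State_space)
  have "\<bar>(\<integral>z. f z \<partial>\<pi>) - lim_mean f\<bar> \<le> 2 * e" if e: "e > 0" for e
  proof -
    obtain h where h: "cylfun d h" "\<And>z. z \<in> State d \<Longrightarrow> \<bar>f z - h z\<bar> \<le> e"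
      using cylfun_approx[OF f d1 e] by auto
    have h1: "\<bar>(\<integral>z. f z \<partial>\<pi>) - (\<integral>z. h z \<partial>\<pi>)\<bar> \<le> e"
      by (rule abs_integral_diff_le[OF int integrable_cylfun[OF h(1)] h(2)])
    have uh: "ucont d h" using h(1) by (rule cylfun_ucont)
    have "lim_mean f \<le> lim_mean (\<lambda>z. h z + e)"
      using h(2) by (intro lim_mean_mono f ucont_add uh ucont_const) (auto simp: abs_le_iff, fastforce simp: abs_le_iff algebra_simps)
    moreover have "lim_mean h \<le> lim_mean (\<lambda>z. f z + e)"
      using h(2) by (intro lim_mean_mono f ucont_add uh ucont_const) (auto simp: abs_le_iff, fastforce simp: abs_le_iff algebra_simps)
    ultimately have "\<bar>lim_mean h - lim_mean f\<bar> \<le> e"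
      by (simp add: lim_mean_add f uh ucont_const lim_mean_const abs_le_iff)
    then show ?thesis using h1 integral_cylfun[OF h(1)] by linarith
  qed
  note bound = this
  have "\<bar>(\<integral>z. f z \<partial>\<pi>) - lim_mean f\<bar> \<le> 0 + e" if "e > 0" for e
    using bound[of "e / 2"] that by simp
  then have "\<bar>(\<integral>z. f z \<partial>\<pi>) - lim_mean f\<bar> \<le> 0" by (rule field_le_epsilon)
  then show ?thesis by simp
qed

end

section \<open>Perron--Frobenius\<close>

text \<open>
  The eigenvalue is the largest \<open>k\<close> with \<open>k * h j \<le> (\<Sum>i. a j i * h i)\<close> for all \<open>j\<close> and some positive \<open>h\<close>. At the
  maximum equality holds: otherwise applying the matrix once more makes all the inequalities strict.
\<close>

theorem perron_frobenius:
  fixes a :: "nat \<Rightarrow> nat \<Rightarrow> real"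
  assumes d: "d \<ge> 1" and a_pos: "\<And>i j. i \<in> {1..d} \<Longrightarrow> j \<in> {1..d} \<Longrightarrow> a j i > 0"
  obtains k h where "k > 0" "\<And>i. i \<in> {1..d} \<Longrightarrow> h i > 0"
    "\<And>j. j \<in> {1..d} \<Longrightarrow> (\<Sum>i\<in>{1..d}. a j i * h i) = k * h j"
proof -
  let ?I = "{1..d}"
  define E where "E = (\<lambda>(j, i). a j i) ` (?I \<times> ?I)"
  have E: "finite E" "E \<noteq> {}" using d by (auto simp: E_def)
  define m M where "m = Min E" and "M = Max E"
  have E_pos: "x > 0" if "x \<in> E" for x using that a_pos by (auto simp: E_def)
  have m_pos: "m > 0" unfolding m_def using E E_pos by (simp add: Min_gr_iff)
  have am: "m \<le> a j i" "a j i \<le> M" if "i \<in> ?I" "j \<in> ?I" for i j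
    unfolding m_def M_def using E that by (auto intro!: Min_le Max_ge simp: E_def)
  have mM: "m \<le> M" using am[of 1 1] d by simp
  define \<delta> where "\<delta> = m / M"
  have \<delta>: "0 < \<delta>" "\<delta> \<le> 1" using m_pos mM by (auto simp: \<delta>_def divide_le_eq_1)
  define ah where "ah h j = (\<Sum>i\<in>?I. a j i * h i)" for h j
  \<comment> \<open>The image of a positive vector, scaled to have maximal entry 1, has all entries at least \<open>\<delta>\<close>. Vectors are extended to all indices to have a compact set of functions.\<close>
  define K where "K = Pi\<^sub>E UNIV (\<lambda>_::nat. {\<delta>..1})"
  have K: "compact K"
  proof -
    have "compactin (product_topology (\<lambda>_::nat. euclidean :: real topology) UNIV) K"
      unfolding K_def by (subst compactin_PiE) auto
    then show ?thesis by (simp add: euclidean_product_topology)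
  qed
  define C where "C = d * M / \<delta>"
  define S where "S = ({0..C} \<times> K) \<inter> {p. \<forall>j\<in>?I. fst p * snd p j \<le> ah (snd p) j}"
  have cont: "continuous_on UNIV (\<lambda>p::real \<times> (nat \<Rightarrow> real). snd p j)" for j
    by (rule continuous_on_compose2[OF continuous_on_product_coordinates continuous_on_snd[OF continuous_on_id]]) simp
  have "closed {p::real \<times> (nat \<Rightarrow> real). fst p * snd p j \<le> ah (snd p) j}" for j
    unfolding ah_def
    by (intro closed_Collect_le continuous_intros cont)
  then have "closed (\<Inter>j\<in>?I. {p::real \<times> (nat \<Rightarrow> real). fst p * snd p j \<le> ah (snd p) j})"
    by (intro closed_INT) auto
  also have "(\<Inter>j\<in>?I. {p::real \<times> (nat \<Rightarrow> real). fst p * snd p j \<le> ah (snd p) j}) = {p. \<forall>j\<in>?I. fst p * snd p j \<le> ah (snd p) j}"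
    by auto
  finally have S_compact: "compact S"
    unfolding S_def by (intro compact_Int_closed compact_Times K compact_Icc)
  have C_bound: "k \<le> C" if h: "h \<in> K" and k: "\<forall>j\<in>?I. k * h j \<le> ah h j" for k h
  proof -
    have hb: "\<delta> \<le> h i" "h i \<le> 1" for i using h by (auto simp: K_def PiE_iff)
    have "ah h 1 \<le> (\<Sum>i\<in>?I. M * 1)"
      unfolding ah_def
    proof (intro sum_mono mult_mono)
      show "a 1 i \<le> M" if "i \<in> ?I" for i using am[of i 1] that d by simp
      show "h i \<le> 1" "0 \<le> h i" for i using hb[of i] \<delta> by auto
      show "0 \<le> M" using m_pos mM by simp
    qed
    then have kh: "k * h 1 \<le> d * M" using k d by force
    show ?thesis
    proof (cases "k \<le> 0")
      case True
      have "0 \<le> C" using m_pos mM \<delta> by (simp add: C_def)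
      then show ?thesis using True by simp
    next
      case False
      then have "k * \<delta> \<le> k * h 1" using hb by (intro mult_left_mono) auto
      then have "k * \<delta> \<le> d * M" using kh by simp
      then show ?thesis using \<delta> by (simp add: C_def field_simps)
    qed
  qed
  have "(0, \<lambda>_. 1) \<in> S"
  proof -
    have "0 \<le> C" using m_pos mM \<delta> by (simp add: C_def)
    moreover have "0 \<le> ah (\<lambda>_. 1) j" if "j \<in> ?I" for j
      unfolding ah_def using a_pos that by (intro sum_nonneg) (auto intro: less_imp_le)
    ultimately show ?thesis using \<delta> by (auto simp: S_def K_def)
  qed
  then obtain p where p: "p \<in> S" "\<And>q. q \<in> S \<Longrightarrow> fst q \<le> fst p"
    using continuous_attains_sup[OF S_compact _ continuous_on_fst[OF continuous_on_id]] by blast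
  obtain k h where kh: "p = (k, h)" by (cases p)
  have hK: "h \<in> K" and k0: "k \<ge> 0" and le: "\<And>j. j \<in> ?I \<Longrightarrow> k * h j \<le> ah h j"
    using p(1) by (auto simp: S_def kh)
  have h_pos: "h i > 0" for i
  proof -
    have "\<delta> \<le> h i" using hK by (auto simp: K_def PiE_iff)
    then show ?thesis using \<delta>(1) by simp
  qed
  have ah_pos: "ah f j > 0" if "\<And>i. i \<in> ?I \<Longrightarrow> f i > 0" "j \<in> ?I" for f j
    unfolding ah_def using that a_pos d by (intro sum_pos) auto
  have eq: "ah h j = k * h j" if j: "j \<in> ?I" for j
  proof (rule ccontr)
    assume "ah h j \<noteq> k * h j"
    then have lt: "k * h j < ah h j" using le[OF j] by simp
    define u where "u = ah h"
    have u_pos: "u i > 0" if "i \<in> ?I" for i unfolding u_def using that h_pos by (intro ah_pos) auto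
    have strict: "k * u i < ah u i" if i: "i \<in> ?I" for i
    proof -
      have "ah u i - k * u i = (\<Sum>l\<in>?I. a i l * (u l - k * h l))"
        by (simp add: ah_def u_def algebra_simps sum_subtractf sum_distrib_left)
      also have "\<dots> > 0"
      proof (rule sum_pos2[OF _ j])
        show "0 < a i j * (u j - k * h j)" using a_pos[OF j i] lt by (simp add: u_def)
        show "0 \<le> a i l * (u l - k * h l)" if "l \<in> ?I" for l
          using a_pos[OF that i] le[OF that] by (simp add: u_def)
      qed simp
      finally show ?thesis by simp
    qed
    define \<epsilon> where "\<epsilon> = Min ((\<lambda>i. (ah u i - k * u i) / u i) ` ?I)"
    have \<epsilon>: "\<epsilon> > 0" unfolding \<epsilon>_def using d strict u_pos by (subst Min_gr_iff) auto
    have \<epsilon>_le: "(k + \<epsilon>) * u i \<le> ah u i" if i: "i \<in> ?I" for i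
    proof -
      have "\<epsilon> \<le> (ah u i - k * u i) / u i" unfolding \<epsilon>_def using i by (intro Min_le) auto
      then show ?thesis using u_pos[OF i] by (simp add: field_simps)
    qed
    define G where "G = Max (u ` ?I)"
    have "G \<in> u ` ?I" unfolding G_def using d by (intro Max_in) auto
    then obtain i0 where i0: "i0 \<in> ?I" "G = u i0" by auto
    have G_ge: "u i \<le> G" if "i \<in> ?I" for i unfolding G_def using that by (intro Max_ge) auto
    have G_pos: "G > 0" using u_pos i0 by simp
    define h' where "h' i = (if i \<in> ?I then u i / G else 1)" for i
    have "\<delta> \<le> u i / G" if i: "i \<in> ?I" for i
    proof -
      have "m * (\<Sum>l\<in>?I. h l) \<le> u i"
        unfolding u_def ah_def sum_distrib_left using am i h_pos by (intro sum_mono mult_right_mono) (auto intro: less_imp_le)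
      moreover have "G \<le> M * (\<Sum>l\<in>?I. h l)"
        unfolding i0(2) u_def ah_def sum_distrib_left using am i0 h_pos by (intro sum_mono mult_right_mono) (auto intro: less_imp_le)
      ultimately have "m * G \<le> M * u i"
        using m_pos mM by (smt (verit, best) mult.left_commute mult_left_mono)
      then show ?thesis using G_pos m_pos mM by (simp add: \<delta>_def field_simps)
    qed
    then have h'K: "h' \<in> K"
      using G_ge G_pos \<delta> by (auto simp: K_def h'_def)
    have "ah h' i = ah u i / G" for i
      unfolding ah_def sum_divide_distrib by (intro sum.cong) (auto simp: h'_def)
    then have k': "\<forall>i\<in>?I. (k + \<epsilon>) * h' i \<le> ah h' i"
      using \<epsilon>_le G_pos by (auto simp: h'_def divide_right_mono)
    then have "(k + \<epsilon>, h') \<in> S" using C_bound[OF h'K k'] h'K k0 \<epsilon> by (auto simp: S_def)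
    then show False using p(2)[of "(k + \<epsilon>, h')"] \<epsilon> by (simp add: kh)
  qed
  have "k > 0"
  proof -
    have "ah h 1 > 0" using d h_pos by (intro ah_pos) auto
    then have "k * h 1 > 0" using eq[of 1] d by simp
    then show ?thesis using h_pos[of 1] by (simp add: zero_less_mult_iff)
  qed
  then show thesis using h_pos eq by (intro that[of k h]) (auto simp: ah_def)
qed

section \<open>The normalized cost\<close>

text \<open>
  The cost as a function of \<open>x\<close> and two letters.
\<close>

definition letter_cost :: "(nat \<times> (nat \<Rightarrow> nat) \<Rightarrow> real) \<Rightarrow> nat \<Rightarrow> nat \<Rightarrow> nat \<Rightarrow> real" where
  "letter_cost A x i j = A (x, scons i (\<lambda>_. j))"

text \<open>
  Costs that depend on \<open>x\<close> and the first two letters only.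
\<close>

locale two_letter_cost =
  fixes d :: nat and A :: "nat \<times> (nat \<Rightarrow> nat) \<Rightarrow> real"
  assumes d2: "d \<ge> 2"
    and A_cong: "\<And>x y w. x \<in> Xset \<Longrightarrow> y \<in> Omega d \<Longrightarrow> w \<in> Omega d \<Longrightarrow>
              y 0 = w 0 \<Longrightarrow> y 1 = w 1 \<Longrightarrow> A (x, y) = A (x, w)"
begin

lemma A_eq: "x \<in> Xset \<Longrightarrow> y \<in> Omega d \<Longrightarrow> A (x, y) = letter_cost A x (y 0) (y 1)"
  unfolding letter_cost_def
proof (rule A_cong)
  assume y: "y \<in> Omega d"
  have "(\<lambda>_. y 1) \<in> Omega d" using Omega_nth[OF y, of 1] unfolding Omega_def by auto
  then show "scons (y 0) (\<lambda>_. y 1) \<in> Omega d" using Omega_nth[OF y, of 0] by simp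
qed (simp_all add: scons_def)

lemma A_scons: "x \<in> Xset \<Longrightarrow> i \<in> {1..d} \<Longrightarrow> y \<in> Omega d \<Longrightarrow> A (x, scons i y) = letter_cost A x i (y 0)"
  using A_eq[of x "scons i y"] by simp

lemma transfer_op_eq:
  "y \<in> Omega d \<Longrightarrow> transfer_op d A v y = (\<Sum>x\<in>Xset. \<Sum>i\<in>{1..d}. exp (letter_cost A x i (y 0)) * v (scons i y))"
  unfolding transfer_op_def
  by (subst shift_vimage, assumption, subst sum.reindex[OF inj_scons]) (simp add: A_scons)

end

text \<open>
  A cost with a Perron eigenvalue and eigenvector of its transfer operator on functions of one letter.
\<close>

locale perron_cost = two_letter_cost +
  fixes lam :: real and h :: "nat \<Rightarrow> real"
  assumes lam_pos: "lam > 0" and h_pos: "\<And>i. i \<in> {1..d} \<Longrightarrow> h i > 0"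
    and eigen: "\<And>j. j \<in> {1..d} \<Longrightarrow> (\<Sum>x\<in>Xset. \<Sum>i\<in>{1..d}. exp (letter_cost A x i j) * h i) = lam * h j"
begin

text \<open>
  The kernel of the normalized cost.
\<close>

definition g :: "nat \<Rightarrow> nat \<Rightarrow> nat \<Rightarrow> real" where
  "g x i j = exp (letter_cost A x i j) * h i / (lam * h j)"

sublocale kernel d g
proof
  show "g x i j > 0" if "x \<in> Xset" "i \<in> {1..d}" "j \<in> {1..d}" for x i j
    using that h_pos lam_pos by (simp add: g_def)
  show "(\<Sum>x\<in>Xset. \<Sum>i\<in>{1..d}. g x i j) = 1" if "j \<in> {1..d}" for j
    using eigen[OF that] h_pos[OF that] lam_pos by (simp add: g_def sum_divide_distrib[symmetric])
qed (rule d2)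

lemma continuous_letter: "continuous_on S (\<lambda>y::nat \<Rightarrow> nat. (F (y k) :: real))"
  by (rule continuous_on_compose2[OF _ continuous_coord[of S k], of UNIV]) (auto simp: continuous_on_open_vimage discrete_topology_class.open_discrete)

lemma h_letter_pos: "y \<in> Omega d \<Longrightarrow> h (y 0) > 0"
  using h_pos[OF Omega_nth] .

lemma transfer_op_h: "y \<in> Omega d \<Longrightarrow> transfer_op d A (\<lambda>y. h (y 0)) y = lam * h (y 0)"
  using eigen[OF Omega_nth] by (simp add: transfer_op_eq)

lemma Omega_witness: "(\<lambda>_. 1) \<in> Omega d"
  using d2 by (simp add: Omega_def)

text \<open>
  An eigenfunction \<open>v\<close> is compared with \<open>h\<close> at a maximum of \<open>\<bar>v\<bar> / h\<close>.
\<close>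

lemma eigenvalue_le: "is_eigenvalue d A l \<Longrightarrow> l \<le> lam"
proof -
  assume "is_eigenvalue d A l"
  then obtain v y0 where v: "continuous_on (Omega d) v" "y0 \<in> Omega d" "v y0 \<noteq> 0"
    "\<And>y. y \<in> Omega d \<Longrightarrow> transfer_op d A v y = l * v y"
    unfolding is_eigenvalue_def by blast
  have cont: "continuous_on (Omega d) (\<lambda>y. \<bar>v y\<bar> / h (y 0))"
    using h_letter_pos by (intro continuous_intros v continuous_letter) force
  obtain y where y: "y \<in> Omega d" "\<And>w. w \<in> Omega d \<Longrightarrow> \<bar>v w\<bar> / h (w 0) \<le> \<bar>v y\<bar> / h (y 0)"
    using continuous_attains_sup[OF compact_Omega _ cont] v(2) by blast
  define m where "m = \<bar>v y\<bar> / h (y 0)"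
  have le: "\<bar>v w\<bar> \<le> m * h (w 0)" if "w \<in> Omega d" for w
    using y(2)[OF that] h_letter_pos[OF that] by (simp add: m_def[symmetric] pos_divide_le_eq)
  have vy: "\<bar>v y\<bar> = m * h (y 0)" using h_letter_pos[OF y(1)] by (simp add: m_def)
  have "m * h (y0 0) > 0" using le[OF v(2)] v(3) by linarith
  then have m: "m > 0" using h_letter_pos[OF v(2)] by (simp add: zero_less_mult_iff)
  have "l * \<bar>v y\<bar> \<le> \<bar>l * v y\<bar>" by (simp add: abs_mult mult_right_mono)
  also have "\<dots> = \<bar>\<Sum>x\<in>Xset. \<Sum>i\<in>{1..d}. exp (letter_cost A x i (y 0)) * v (scons i y)\<bar>"
    using v(4)[OF y(1)] by (simp add: transfer_op_eq[OF y(1)])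
  also have "\<dots> \<le> (\<Sum>x\<in>Xset. \<Sum>i\<in>{1..d}. \<bar>exp (letter_cost A x i (y 0)) * v (scons i y)\<bar>)"
    by (rule order_trans[OF sum_abs]) (intro sum_mono sum_abs)
  also have "\<dots> \<le> (\<Sum>x\<in>Xset. \<Sum>i\<in>{1..d}. exp (letter_cost A x i (y 0)) * (m * h i))"
    using le[of "scons _ y"] y(1) by (intro sum_mono) (simp add: abs_mult)
  also have "\<dots> = m * (\<Sum>x\<in>Xset. \<Sum>i\<in>{1..d}. exp (letter_cost A x i (y 0)) * h i)"
    by (simp add: sum_distrib_left mult_ac)
  also have "\<dots> = lam * \<bar>v y\<bar>" using eigen[OF Omega_nth[OF y(1), of 0]] by (simp add: vy)
  finally show "l \<le> lam" using m h_letter_pos[OF y(1)] by (simp add: vy)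
qed

lemma max_eigenvalue_eq: "max_eigenvalue d A = lam"
  unfolding max_eigenvalue_def
proof (rule Greatest_equality)
  have h1: "h 1 \<noteq> 0" using h_letter_pos[OF Omega_witness] by simp
  have "continuous_on (Omega d) (\<lambda>y. h (y 0)) \<and> (\<exists>y\<in>Omega d. h (y 0) \<noteq> 0) \<and>
    (\<forall>y\<in>Omega d. transfer_op d A (\<lambda>y. h (y 0)) y = lam * h (y 0))"
    by (intro conjI bexI[OF _ Omega_witness] ballI transfer_op_h continuous_letter h1)
  then show "is_eigenvalue d A lam" unfolding is_eigenvalue_def by (rule exI[where x = "\<lambda>y. h (y 0)"])
qed (rule eigenvalue_le)

text \<open>
  Simplicity of the eigenvalue: the quotient of two positive eigenfunctions is fixed by the transition
  operator, hence constant.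
\<close>

lemma pos_eigenfun_eq:
  obtains c where "c > 0" "\<And>y. y \<in> Omega d \<Longrightarrow> pos_eigenfun d A y = c * h (y 0)"
proof -
  let ?p = "pos_eigenfun d A"
  let ?P = "\<lambda>h. continuous_on (Omega d) h \<and> (\<forall>y\<in>Omega d. h y > 0) \<and>
    (\<forall>y\<in>Omega d. transfer_op d A h y = max_eigenvalue d A * h y)"
  have "?P (\<lambda>y. h (y 0))"
    using transfer_op_h h_letter_pos continuous_letter by (auto simp: max_eigenvalue_eq)
  then have "?P ?p" unfolding pos_eigenfun_def by (rule someI[of ?P])
  then have p: "continuous_on (Omega d) ?p" "\<And>y. y \<in> Omega d \<Longrightarrow> ?p y > 0"
    "\<And>y. y \<in> Omega d \<Longrightarrow> transfer_op d A ?p y = lam * ?p y"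
    by (auto simp: max_eigenvalue_eq)
  define r where "r z = ?p (snd z) / h (snd z 0)" for z :: "nat \<times> (nat \<Rightarrow> nat)"
  have "continuous_on (Omega d) (\<lambda>y. ?p y / h (y 0))"
    using h_letter_pos by (intro continuous_intros p continuous_letter) force
  then have "continuous_on (Xset \<times> Omega d) r"
    unfolding r_def by (rule continuous_on_compose2[OF _ continuous_on_snd[OF continuous_on_id]]) auto
  then have ur: "ucont d r" by (rule ucont_continuous)
  have "markov_op r z = r z" if z: "z \<in> State d" for z
  proof -
    have y: "snd z \<in> Omega d" using z by (auto simp: State_def)
    have "markov_op r z = (\<Sum>x\<in>Xset. \<Sum>i\<in>{1..d}. exp (letter_cost A x i (snd z 0)) * ?p (scons i (snd z)) / (lam * h (snd z 0)))"
      unfolding markov_op_def r_def g_def using h_pos by (intro sum.cong refl) (auto simp: less_imp_neq[symmetric])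
    also have "\<dots> = transfer_op d A ?p (snd z) / (lam * h (snd z 0))"
      by (simp add: transfer_op_eq[OF y] sum_divide_distrib)
    also have "\<dots> = r z" using p(3)[OF y] lam_pos by (simp add: r_def)
    finally show ?thesis .
  qed
  note fixed = this
  have "(markov_op ^^ n) r z = r z" if "z \<in> State d" for n z
    using that
  proof (induction n arbitrary: z)
    case (Suc n)
    have "markov_op ((markov_op ^^ n) r) z = markov_op r z" by (rule markov_op_cong[OF Suc.IH Suc.prems])
    then show ?case using fixed[OF Suc.prems] by simp
  qed simp
  then have r: "r z = lim_mean r" if "z \<in> State d" for z
    using markov_op_pow_tendsto_lim_mean[OF ur that] that by (simp add: LIMSEQ_const_iff)
  show thesis
  proof (rule that)
    have "r (1, \<lambda>_. 1) > 0" unfolding r_def using p(2)[OF Omega_witness] h_letter_pos[OF Omega_witness] by simp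
    then show "lim_mean r > 0" using r[OF State_witness] by simp
    show "?p y = lim_mean r * h (y 0)" if y: "y \<in> Omega d" for y
      using r[of "(1, y)"] y h_letter_pos[OF y] by (simp add: r_def State_def Xset_def field_simps)
  qed
qed

theorem exp_normalized_cost:
  assumes "x \<in> Xset" "i \<in> {1..d}" "y \<in> Omega d"
  shows "exp (normalized_cost d A (x, scons i y)) = g x i (y 0)"
proof -
  obtain c where c: "c > 0" "\<And>y. y \<in> Omega d \<Longrightarrow> pos_eigenfun d A y = c * h (y 0)"
    by (rule pos_eigenfun_eq) (rule that)
  have hy: "h (y 0) > 0" "h i > 0" using assms h_letter_pos h_pos by auto
  have "normalized_cost d A (x, scons i y) = letter_cost A x i (y 0) + ln (c * h i) - ln (c * h (y 0)) - ln lam"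
    using assms by (simp add: normalized_cost_def A_scons max_eigenvalue_eq c(2))
  also have "\<dots> = letter_cost A x i (y 0) + ln (h i) - ln (h (y 0)) - ln lam"
    using c(1) hy by (simp add: ln_mult)
  finally show ?thesis
    using hy lam_pos by (simp add: exp_add exp_diff g_def mult.commute)
qed

end

lemma (in two_letter_cost) exists_perron: "\<exists>lam h. perron_cost d A lam h"
proof -
  have pos: "(\<Sum>x\<in>Xset. exp (letter_cost A x i j)) > 0" for i j
    by (intro sum_pos) (auto simp: Xset_def)
  have d1: "d \<ge> 1" using d2 by simp
  obtain k h where kh: "k > 0" "\<And>i. i \<in> {1..d} \<Longrightarrow> h i > 0"
    "\<And>j. j \<in> {1..d} \<Longrightarrow> (\<Sum>i\<in>{1..d}. (\<Sum>x\<in>Xset. exp (letter_cost A x i j)) * h i) = k * h j"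
    using perron_frobenius[OF d1, of "\<lambda>j i. \<Sum>x\<in>Xset. exp (letter_cost A x i j)"] pos by blast
  have "perron_cost d A k h"
  proof
    show "(\<Sum>x\<in>Xset. \<Sum>i\<in>{1..d}. exp (letter_cost A x i j) * h i) = k * h j" if "j \<in> {1..d}" for j
      using kh(3)[OF that] by (subst sum.swap) (simp add: sum_distrib_right)
  qed (use kh in auto)
  then show ?thesis by blast
qed

section \<open>The ergodic theorem for the random sequence\<close>

text \<open>
  The distance from \<open>N\<close> to the largest square below it is at most \<open>2 * sqrt N\<close>.
\<close>

lemma tendsto_zero_of_squares:
  fixes S :: "nat \<Rightarrow> real"
  assumes step: "\<And>n. \<bar>S (Suc n) - S n\<bar> \<le> K"
    and sq: "\<And>e. e > 0 \<Longrightarrow> \<forall>\<^sub>F m in sequentially. \<bar>S (m\<^sup>2)\<bar> \<le> e * real (m\<^sup>2)"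
  shows "(\<lambda>N. S N / real N) \<longlonglongrightarrow> 0"
proof (rule metric_LIMSEQ_I)
  have K: "K \<ge> 0" using step[of 0] by linarith
  have lip: "\<bar>S (n + j) - S n\<bar> \<le> real j * K" for n j
  proof (induction j)
    case (Suc j)
    have "\<bar>S (n + Suc j) - S n\<bar> \<le> \<bar>S (Suc (n + j)) - S (n + j)\<bar> + \<bar>S (n + j) - S n\<bar>" by simp
    also have "\<dots> \<le> K + real j * K" using step Suc by (intro add_mono) auto
    finally show ?case by (simp add: algebra_simps)
  qed simp
  fix r :: real assume r: "r > 0"
  obtain m0 where m0: "\<And>m. m \<ge> m0 \<Longrightarrow> \<bar>S (m\<^sup>2)\<bar> \<le> r / 4 * real (m\<^sup>2)"
    using sq[of "r / 4"] r unfolding eventually_sequentially by auto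
  obtain m1 :: nat where m1: "real m1 * r > 8 * K" using reals_Archimedean3[OF r] by blast
  define m2 where "m2 = max (max m0 m1) 1"
  have "dist (S N / real N) 0 < r" if N: "N \<ge> m2\<^sup>2" for N
  proof -
    define m where "m = (GREATEST m. m\<^sup>2 \<le> N)"
    have bound: "\<forall>k. k\<^sup>2 \<le> N \<longrightarrow> k \<le> N" 
    proof (intro allI impI)
      fix k :: nat assume "k\<^sup>2 \<le> N"
      moreover have "k \<le> k\<^sup>2" by (simp add: power2_eq_square)
      ultimately show "k \<le> N" by linarith
    qed
    have m_le: "m\<^sup>2 \<le> N" unfolding m_def by (rule GreatestI_nat[where P = "\<lambda>m. m\<^sup>2 \<le> N", OF N]) (use bound in blast)
    have m_ge: "k \<le> m" if "k\<^sup>2 \<le> N" for k unfolding m_def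
      by (rule Greatest_le_nat[where P = "\<lambda>m. m\<^sup>2 \<le> N", OF that]) (use bound in blast)
    have m2m: "m2 \<le> m" using m_ge[OF N] .
    have "\<not> (Suc m)\<^sup>2 \<le> N" using m_ge[of "Suc m"] by auto
    then have up: "N \<le> m\<^sup>2 + 2 * m" by (simp add: power2_eq_square)
    have Npos: "real N > 0"
    proof -
      have "1 \<le> m2\<^sup>2" by (simp add: m2_def)
      then show ?thesis using N by simp
    qed
    have mpos: "m \<ge> 1" "m \<ge> m0" "m \<ge> m1" using m2m by (auto simp: m2_def)
    have "\<bar>S N\<bar> \<le> \<bar>S (m\<^sup>2)\<bar> + \<bar>S (m\<^sup>2 + (N - m\<^sup>2)) - S (m\<^sup>2)\<bar>" using m_le by simp
    also have "\<dots> \<le> r / 4 * real (m\<^sup>2) + real (N - m\<^sup>2) * K"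
      using m0[OF mpos(2)] lip by (intro add_mono) auto
    also have "real (N - m\<^sup>2) * K \<le> real (2 * m) * K"
    proof (rule mult_right_mono[OF _ K])
      have "N - m\<^sup>2 \<le> 2 * m" using up by simp
      then show "real (N - m\<^sup>2) \<le> real (2 * m)" by (rule of_nat_mono)
    qed
    also have "\<dots> \<le> r / 4 * real (m\<^sup>2)"
    proof -
      have "8 * K \<le> real m1 * r" using m1 by simp
      also have "\<dots> \<le> real m * r" using mpos r by (intro mult_right_mono) auto
      finally have "real m * (8 * K) \<le> real m * (real m * r)" by (intro mult_left_mono) auto
      then show ?thesis by (simp add: power2_eq_square field_simps)
    qed
    finally have "\<bar>S N\<bar> \<le> r / 2 * real (m\<^sup>2)" by simp
    also have "\<dots> \<le> r / 2 * real N" using m_le r by (intro mult_left_mono) (simp_all del: of_nat_power)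
    also have "\<dots> < r * real N" using r Npos by simp
    finally show ?thesis using Npos by (simp add: dist_real_def pos_divide_less_eq)
  qed
  then show "\<exists>N0. \<forall>N\<ge>N0. dist (S N / real N) 0 < r" by blast
qed

text \<open>
  A Markov chain with kernel \<open>g\<close>, started at \<open>z0\<close>. The transition probabilities are prescribed
  after histories of positive probability.
\<close>

locale kernel_process = kernel d g + prob_space M
  for d :: nat and g :: "nat \<Rightarrow> nat \<Rightarrow> nat \<Rightarrow> real" and M :: "'w measure" +
  fixes Z :: "nat \<Rightarrow> 'w \<Rightarrow> nat \<times> (nat \<Rightarrow> nat)" and z0 :: "nat \<times> (nat \<Rightarrow> nat)"
  assumes Z_meas: "\<And>k. Z k \<in> M \<rightarrow>\<^sub>M restrict_space borel (Xset \<times> Omega d)"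
    and Z_0: "AE \<omega> in M. Z 0 \<omega> = z0"
    and z0: "z0 \<in> State d"
    and trans: "\<And>k h \<alpha> i. measure M {\<omega> \<in> space M. \<forall>j\<le>k. Z j \<omega> = h j} > 0 \<Longrightarrow> h k \<in> State d \<Longrightarrow> \<alpha> \<in> Xset \<Longrightarrow> i \<in> {1..d} \<Longrightarrow>
      measure M {\<omega> \<in> space M. Z (Suc k) \<omega> = (\<alpha>, scons i (snd (h k))) \<and> (\<forall>j\<le>k. Z j \<omega> = h j)}
        = g \<alpha> i (snd (h k) 0) * measure M {\<omega> \<in> space M. \<forall>j\<le>k. Z j \<omega> = h j}"
begin

text \<open>
  The event that the process follows \<open>h\<close> up to time \<open>k\<close>.
\<close>

definition hist_event :: "nat \<Rightarrow> (nat \<Rightarrow> nat \<times> (nat \<Rightarrow> nat)) \<Rightarrow> 'w set" where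
  "hist_event k h = {\<omega> \<in> space M. \<forall>j\<le>k. Z j \<omega> = h j}"

text \<open>
  The history \<open>h\<close> up to time \<open>k\<close>, continued by one transition.
\<close>

definition step :: "nat \<Rightarrow> (nat \<Rightarrow> nat \<times> (nat \<Rightarrow> nat)) \<Rightarrow> nat \<times> nat \<Rightarrow> nat \<Rightarrow> nat \<times> (nat \<Rightarrow> nat)" where
  "step k h a = h(Suc k := (fst a, scons (snd a) (snd (h k))))"

text \<open>
  The possible histories up to time \<open>k\<close>. After time \<open>k\<close> they take the value \<open>z0\<close>, so that there are
  finitely many and distinct ones exclude each other.
\<close>

fun histories :: "nat \<Rightarrow> (nat \<Rightarrow> nat \<times> (nat \<Rightarrow> nat)) set" where
  "histories 0 = {\<lambda>_. z0}"
| "histories (Suc k) = (\<lambda>(h, a). step k h a) ` (histories k \<times> (Xset \<times> {1..d}))"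

lemma finite_histories [simp]: "finite (histories k)"
  by (induction k) auto

lemma histories_beyond: "h \<in> histories k \<Longrightarrow> j > k \<Longrightarrow> h j = z0"
  by (induction k arbitrary: h) (auto simp: step_def)

lemma histories_State: "h \<in> histories k \<Longrightarrow> h j \<in> State d"
proof (induction k arbitrary: h j)
  case (Suc k)
  then obtain h' x i where h: "h' \<in> histories k" "h = step k h' (x, i)" "x \<in> Xset" "i \<in> {1..d}" by auto
  then show ?case using Suc.IH[OF h(1), of j] Suc.IH[OF h(1), of k] scons_State[of "h' k" x i] by (auto simp: step_def)
qed (simp add: z0)

lemma inj_step: "inj_on (\<lambda>(h, a). step k h a) (histories k \<times> (Xset \<times> {1..d}))"
proof (rule inj_onI)
  fix p p' assume p: "p \<in> histories k \<times> (Xset \<times> {1..d})" "p' \<in> histories k \<times> (Xset \<times> {1..d})"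
    and "(\<lambda>(h, a). step k h a) p = (\<lambda>(h, a). step k h a) p'"
  moreover obtain h x i where ph: "p = (h, x, i)" by (cases p)
  moreover obtain h' x' i' where ph': "p' = (h', x', i')" by (cases p')
  ultimately have h: "h \<in> histories k" "h' \<in> histories k" and eq: "step k h (x, i) = step k h' (x', i')" by auto
  have hh: "h = h'"
  proof
    fix j
    show "h j = h' j"
      using fun_cong[OF eq, of j] histories_beyond[OF h(1), of "Suc k"] histories_beyond[OF h(2), of "Suc k"]
      by (cases "j = Suc k") (simp_all add: step_def)
  qed
  have "(x, scons i (snd (h k))) = (x', scons i' (snd (h k)))"
    using fun_cong[OF eq, of "Suc k"] hh by (simp add: step_def)
  then have "x = x'" and sc: "scons i (snd (h k)) = scons i' (snd (h k))" by auto
  moreover have "i = i'" using fun_cong[OF sc, of 0] by simp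
  ultimately show "p = p'" using hh ph ph' by simp
qed

lemma sets_Z_eq: "{\<omega> \<in> space M. Z j \<omega> = z} \<in> sets M"
proof -
  obtain x y where z: "z = (x, y)" by (cases z)
  have Zb: "Z j \<in> M \<rightarrow>\<^sub>M borel"
    using measurable_compose[OF Z_meas measurable_restrict_space1[OF measurable_ident]] by simp
  have f: "(\<lambda>\<omega>. fst (Z j \<omega>)) \<in> M \<rightarrow>\<^sub>M borel" and s: "(\<lambda>\<omega>. snd (Z j \<omega>)) \<in> M \<rightarrow>\<^sub>M borel"
    by (rule measurable_compose[OF Zb borel_measurable_continuous_onI], intro continuous_on_fst continuous_on_snd continuous_on_id)+
  have "{\<omega> \<in> space M. Z j \<omega> = z} = ((\<lambda>\<omega>. fst (Z j \<omega>)) -` {x} \<inter> space M) \<inter> (\<Inter>n. (\<lambda>\<omega>. snd (Z j \<omega>)) -` cyl (pre n y) \<inter> space M)"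
  proof -
    have "w = y \<longleftrightarrow> (\<forall>n. w \<in> cyl (pre n y))" for w
      by (auto simp: cyl_pre pre_eq_iff fun_eq_iff)
    then show ?thesis by (auto simp: z prod_eq_iff)
  qed
  moreover have "(\<lambda>\<omega>. fst (Z j \<omega>)) -` {x} \<inter> space M \<in> sets M"
    by (rule measurable_sets[OF f]) (simp add: borel_open discrete_topology_class.open_discrete)
  moreover have "(\<Inter>n. (\<lambda>\<omega>. snd (Z j \<omega>)) -` cyl (pre n y) \<inter> space M) \<in> sets M"
    by (intro sets.countable_INT) (auto intro: measurable_sets[OF s])
  ultimately show ?thesis by auto
qed

lemma sets_hist_event [simp]: "hist_event k h \<in> sets M"
proof -
  have "hist_event k h = (\<Inter>j\<in>{..k}. {\<omega> \<in> space M. Z j \<omega> = h j})" by (auto simp: hist_event_def)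
  also have "\<dots> \<in> sets M" by (intro sets.finite_INT) (auto intro: sets_Z_eq)
  finally show ?thesis .
qed

lemma hist_event_step: "hist_event (Suc k) (step k h a) = {\<omega> \<in> space M. Z (Suc k) \<omega> = (fst a, scons (snd a) (snd (h k))) \<and> (\<forall>j\<le>k. Z j \<omega> = h j)}"
  by (auto simp: hist_event_def step_def le_Suc_eq)

lemma prob_hist_event_step:
  assumes "h \<in> histories k" "x \<in> Xset" "i \<in> {1..d}"
  shows "measure M (hist_event (Suc k) (step k h (x, i))) = g x i (snd (h k) 0) * measure M (hist_event k h)"
proof (cases "measure M (hist_event k h) > 0")
  case True
  then show ?thesis using trans[of k h x i] histories_State[OF assms(1)] assms by (simp add: hist_event_step) (simp add: hist_event_def)
next
  case False
  then have 0: "measure M (hist_event k h) = 0" using measure_nonneg[of M "hist_event k h"] by linarith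
  have "measure M (hist_event (Suc k) (step k h (x, i))) \<le> measure M (hist_event k h)"
  proof (rule finite_measure_mono)
    show "hist_event (Suc k) (step k h (x, i)) \<subseteq> hist_event k h" unfolding hist_event_step unfolding hist_event_def by blast
  qed simp
  then show ?thesis using 0 measure_nonneg[of M "hist_event (Suc k) (step k h (x, i))"] by simp
qed

lemma sum_histories_Suc: "(\<Sum>h\<in>histories (Suc k). F h) = (\<Sum>h\<in>histories k. \<Sum>x\<in>Xset. \<Sum>i\<in>{1..d}. F (step k h (x, i)))"
proof -
  have "(\<Sum>h\<in>histories (Suc k). F h) = (\<Sum>(h, a)\<in>histories k \<times> (Xset \<times> {1..d}). F (step k h a))"
    unfolding histories.simps by (subst sum.reindex[OF inj_step]) (simp add: split_beta)
  also have "\<dots> = (\<Sum>h\<in>histories k. \<Sum>a\<in>Xset \<times> {1..d}. F (step k h a))"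
    by (rule sum.cartesian_product[symmetric])
  also have "\<dots> = (\<Sum>h\<in>histories k. \<Sum>x\<in>Xset. \<Sum>i\<in>{1..d}. F (step k h (x, i)))"
    by (intro sum.cong refl) (simp add: sum.cartesian_product)
  finally show ?thesis .
qed

lemma disjoint_hist_event: "disjoint_family_on (hist_event k) (histories k)"
  unfolding disjoint_family_on_def
proof (intro ballI impI)
  fix h h' assume *: "h \<in> histories k" "h' \<in> histories k" "h \<noteq> h'"
  then obtain j where j: "h j \<noteq> h' j" by auto
  have "j \<le> k"
  proof (rule ccontr)
    assume "\<not> j \<le> k"
    then show False using j histories_beyond[OF *(1), of j] histories_beyond[OF *(2), of j] by simp
  qed
  then show "hist_event k h \<inter> hist_event k h' = {}" using j by (auto simp: hist_event_def)
qed

lemma sum_prob_hist_event: "(\<Sum>h\<in>histories k. measure M (hist_event k h)) = 1"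
proof (induction k)
  case 0
  have "measure M (hist_event 0 (\<lambda>_. z0)) = measure M (space M)"
  proof (rule finite_measure_eq_AE)
    show "AE \<omega> in M. (\<omega> \<in> hist_event 0 (\<lambda>_. z0)) = (\<omega> \<in> space M)"
      using Z_0 by eventually_elim (simp add: hist_event_def)
  qed simp_all
  then show ?case by (simp add: prob_space)
next
  case (Suc k)
  have "(\<Sum>h\<in>histories (Suc k). measure M (hist_event (Suc k) h)) = (\<Sum>h\<in>histories k. \<Sum>x\<in>Xset. \<Sum>i\<in>{1..d}. g x i (snd (h k) 0) * measure M (hist_event k h))"
    unfolding sum_histories_Suc by (intro sum.cong refl prob_hist_event_step)
  also have "\<dots> = (\<Sum>h\<in>histories k. measure M (hist_event k h))"
    by (intro sum.cong refl) (simp add: sum_distrib_right[symmetric] g_sum_State[OF histories_State, simplified])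
  finally show ?case using Suc by simp
qed

lemma AE_history: "AE \<omega> in M. \<exists>h\<in>histories k. \<omega> \<in> hist_event k h"
proof -
  have "measure M (\<Union>h\<in>histories k. hist_event k h) = (\<Sum>h\<in>histories k. measure M (hist_event k h))"
    by (rule finite_measure_finite_Union) (auto simp: disjoint_hist_event)
  then have "AE \<omega> in M. \<omega> \<in> (\<Union>h\<in>histories k. hist_event k h)"
    by (intro AE_prob_1) (simp add: sum_prob_hist_event)
  then show ?thesis by eventually_elim blast
qed

text \<open>
  The martingale of a function \<open>u\<close> along a history.
\<close>

definition mart :: "(nat \<times> (nat \<Rightarrow> nat) \<Rightarrow> real) \<Rightarrow> nat \<Rightarrow> (nat \<Rightarrow> nat \<times> (nat \<Rightarrow> nat)) \<Rightarrow> real" where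
  "mart u n h = (\<Sum>k<n. u (h (Suc k)) - markov_op u (h k))"

lemma mart_step: "mart u (Suc k) (step k h (x, i)) = mart u k h + (u (x, scons i (snd (h k))) - markov_op u (h k))"
proof -
  have "mart u k (step k h (x, i)) = mart u k h"
    unfolding mart_def by (intro sum.cong) (auto simp: step_def)
  then show ?thesis by (simp add: mart_def step_def)
qed

lemma mart_hist_event: "\<omega> \<in> hist_event k h \<Longrightarrow> mart u k (\<lambda>j. Z j \<omega>) = mart u k h"
  unfolding mart_def by (intro sum.cong) (auto simp: hist_event_def)

text \<open>
  The increments of the martingale are orthogonal, so its variance grows linearly.
\<close>

lemma variance_le:
  assumes u: "\<And>z. z \<in> State d \<Longrightarrow> \<bar>u z\<bar> \<le> B"
  shows "(\<Sum>h\<in>histories k. measure M (hist_event k h) * (mart u k h)\<^sup>2) \<le> real k * (2 * B)\<^sup>2"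
proof (induction k)
  case 0
  then show ?case by (simp add: mart_def)
next
  case (Suc k)
  have QB: "\<bar>markov_op u z\<bar> \<le> B" if "z \<in> State d" for z
    using markov_op_pow_bounds[of "-B" u B z 1] u that by (auto simp: abs_le_iff minus_le_iff)
  have step: "(\<Sum>x\<in>Xset. \<Sum>i\<in>{1..d}. measure M (hist_event (Suc k) (step k h (x, i))) * (mart u (Suc k) (step k h (x, i)))\<^sup>2)
      \<le> measure M (hist_event k h) * (mart u k h)\<^sup>2 + measure M (hist_event k h) * (2 * B)\<^sup>2" if h: "h \<in> histories k" for h
  proof -
    let ?p = "measure M (hist_event k h)" and ?s = "mart u k h" and ?j = "snd (h k) 0" and ?q = "markov_op u (h k)"
    let ?u = "\<lambda>x i. u (x, scons i (snd (h k)))"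
    have hS: "h k \<in> State d" by (rule histories_State[OF h])
    have "(\<Sum>x\<in>Xset. \<Sum>i\<in>{1..d}. measure M (hist_event (Suc k) (step k h (x, i))) * (mart u (Suc k) (step k h (x, i)))\<^sup>2)
       = (\<Sum>x\<in>Xset. \<Sum>i\<in>{1..d}. g x i ?j * ?p * (?s + (?u x i - ?q))\<^sup>2)"
      using h by (intro sum.cong refl) (simp only: prob_hist_event_step mart_step)
    also have "\<dots> = (\<Sum>x\<in>Xset. \<Sum>i\<in>{1..d}. g x i ?j * (?p * ?s\<^sup>2 - 2 * ?p * ?s * ?q) + 2 * ?p * ?s * (g x i ?j * ?u x i)
          + ?p * (g x i ?j * (?u x i - ?q)\<^sup>2))"
      by (intro sum.cong refl) (simp add: power2_eq_square algebra_simps)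
    also have "\<dots> = (\<Sum>x\<in>Xset. \<Sum>i\<in>{1..d}. g x i ?j) * (?p * ?s\<^sup>2 - 2 * ?p * ?s * ?q) + 2 * ?p * ?s * ?q
          + ?p * (\<Sum>x\<in>Xset. \<Sum>i\<in>{1..d}. g x i ?j * (?u x i - ?q)\<^sup>2)"
      by (simp add: sum.distrib sum_distrib_right[symmetric] sum_distrib_left[symmetric] markov_op_def)
    also have "\<dots> = ?p * ?s\<^sup>2 + ?p * (\<Sum>x\<in>Xset. \<Sum>i\<in>{1..d}. g x i ?j * (?u x i - ?q)\<^sup>2)"
      using g_sum_State[OF hS] by simp
    also have "\<dots> \<le> ?p * ?s\<^sup>2 + ?p * (\<Sum>x\<in>Xset. \<Sum>i\<in>{1..d}. g x i ?j * (2 * B)\<^sup>2)"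
    proof (intro add_left_mono mult_left_mono sum_mono)
      fix x i assume xi: "x \<in> Xset" "i \<in> {1..d}"
      have "\<bar>?u x i - ?q\<bar> \<le> 2 * B"
        using u[OF scons_State[OF hS xi]] QB[OF hS] by linarith
      then show "(?u x i - ?q)\<^sup>2 \<le> (2 * B)\<^sup>2"
        by (metis abs_le_square_iff abs_of_nonneg abs_ge_zero order_trans)
      show "0 \<le> g x i ?j" using g_pos_State[OF hS xi] by simp
    qed simp
    also have "\<dots> = ?p * ?s\<^sup>2 + ?p * (2 * B)\<^sup>2"
      using g_sum_State[OF hS] by (simp add: sum_distrib_right[symmetric])
    finally show ?thesis .
  qed
  have "(\<Sum>h\<in>histories (Suc k). measure M (hist_event (Suc k) h) * (mart u (Suc k) h)\<^sup>2)
      \<le> (\<Sum>h\<in>histories k. measure M (hist_event k h) * (mart u k h)\<^sup>2 + measure M (hist_event k h) * (2 * B)\<^sup>2)"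
    unfolding sum_histories_Suc by (intro sum_mono step)
  also have "\<dots> = (\<Sum>h\<in>histories k. measure M (hist_event k h) * (mart u k h)\<^sup>2) + (2 * B)\<^sup>2"
    using sum_prob_hist_event[of k] by (simp add: sum.distrib sum_distrib_right[symmetric])
  finally show ?case using Suc by (simp add: algebra_simps)
qed

text \<open>
  Chebyshev's inequality and the Borel--Cantelli lemma. The exceptional events are unions of the
  finitely many history events, so measurability of \<open>u\<close> is not needed.
\<close>

lemma AE_squares:
  assumes u: "\<And>z. z \<in> State d \<Longrightarrow> \<bar>u z\<bar> \<le> B" and e: "e > 0"
  shows "AE \<omega> in M. \<forall>\<^sub>F m in sequentially. \<bar>mart u (m\<^sup>2) (\<lambda>j. Z j \<omega>)\<bar> \<le> e * real (m\<^sup>2)"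
proof -
  define Bad where "Bad n = {h \<in> histories n. e * real n < \<bar>mart u n h\<bar>}" for n
  define E where "E m = (\<Union>h\<in>Bad (m\<^sup>2). hist_event (m\<^sup>2) h)" for m
  have fin: "finite (Bad n)" for n by (simp add: Bad_def)
  have E_sets: "E m \<in> sets M" for m unfolding E_def using fin by (intro sets.finite_UN) auto
  have prob: "measure M (\<Union>h\<in>Bad n. hist_event n h) \<le> (2 * B)\<^sup>2 / (e\<^sup>2 * real n)" if n: "n \<ge> 1" for n
  proof -
    have "(e * real n)\<^sup>2 * measure M (\<Union>h\<in>Bad n. hist_event n h) \<le> (e * real n)\<^sup>2 * (\<Sum>h\<in>Bad n. measure M (hist_event n h))"
      using fin by (intro mult_left_mono finite_measure_subadditive_finite) auto
    also have "\<dots> = (\<Sum>h\<in>Bad n. measure M (hist_event n h) * (e * real n)\<^sup>2)"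
      by (subst mult.commute) (rule sum_distrib_right)
    also have "\<dots> \<le> (\<Sum>h\<in>Bad n. measure M (hist_event n h) * (mart u n h)\<^sup>2)"
    proof (intro sum_mono mult_left_mono)
      fix h assume "h \<in> Bad n"
      then have "\<bar>e * real n\<bar> \<le> \<bar>mart u n h\<bar>" using e by (simp add: Bad_def)
      then show "(e * real n)\<^sup>2 \<le> (mart u n h)\<^sup>2" by (simp only: abs_le_square_iff)
    qed simp
    also have "\<dots> \<le> (\<Sum>h\<in>histories n. measure M (hist_event n h) * (mart u n h)\<^sup>2)"
      by (intro sum_mono2) (auto simp: Bad_def)
    also have "\<dots> \<le> real n * (2 * B)\<^sup>2" by (rule variance_le[OF u])
    finally show ?thesis using e n by (simp add: power_mult_distrib field_simps power2_eq_square)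
  qed
  have "summable (\<lambda>m. measure M (E m))"
  proof (rule summable_comparison_test')
    show "summable (\<lambda>m. (2 * B)\<^sup>2 / e\<^sup>2 * inverse (real m ^ 2))"
      by (intro summable_mult inverse_power_summable) simp
    show "norm (measure M (E m)) \<le> (2 * B)\<^sup>2 / e\<^sup>2 * inverse (real m ^ 2)" if "m \<ge> 1" for m
      using prob[of "m\<^sup>2"] that by (simp add: E_def field_simps)
  qed
  then have ev: "AE \<omega> in M. \<forall>\<^sub>F m in sequentially. \<omega> \<in> space M - E m"
    using E_sets by (intro borel_cantelli_AE1) (auto simp: emeasure_eq_measure)
  have hist: "AE \<omega> in M. \<forall>k. \<exists>h\<in>histories k. \<omega> \<in> hist_event k h"
    unfolding AE_all_countable by (intro allI AE_history)
  show ?thesis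
    using ev hist
  proof eventually_elim
    case (elim \<omega>)
    from elim(1) show ?case
    proof eventually_elim
      case (elim m)
      obtain h where h: "h \<in> histories (m\<^sup>2)" "\<omega> \<in> hist_event (m\<^sup>2) h" using \<open>\<forall>k. \<exists>h\<in>histories k. \<omega> \<in> hist_event k h\<close> by blast
      then have "h \<notin> Bad (m\<^sup>2)" using elim by (auto simp: E_def)
      then have "\<bar>mart u (m\<^sup>2) h\<bar> \<le> e * real (m\<^sup>2)" using h(1) by (simp add: Bad_def not_less)
      then show ?case using mart_hist_event[OF h(2)] by simp
    qed
  qed
qed

lemma Z_State: "\<omega> \<in> space M \<Longrightarrow> Z k \<omega> \<in> State d"
  using measurable_space[OF Z_meas] by (simp add: space_restrict_space State_def)

lemma AE_martingale:
  assumes u: "\<And>z. z \<in> State d \<Longrightarrow> \<bar>u z\<bar> \<le> B"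
  shows "AE \<omega> in M. (\<lambda>N. mart u N (\<lambda>j. Z j \<omega>) / real N) \<longlonglongrightarrow> 0"
proof -
  have "AE \<omega> in M. \<forall>r. \<forall>\<^sub>F m in sequentially. \<bar>mart u (m\<^sup>2) (\<lambda>j. Z j \<omega>)\<bar> \<le> inverse (real (Suc r)) * real (m\<^sup>2)"
    unfolding AE_all_countable by (intro allI AE_squares[OF u]) simp_all
  then show ?thesis
    using AE_space
  proof eventually_elim
    case (elim \<omega>)
    have ZS: "Z k \<omega> \<in> State d" for k by (rule Z_State[OF elim(2)])
    have QB: "\<bar>markov_op u z\<bar> \<le> B" if "z \<in> State d" for z
      using markov_op_pow_bounds[of "-B" u B z 1] u that by (auto simp: abs_le_iff minus_le_iff)
    show ?case
    proof (rule tendsto_zero_of_squares[where K = "2 * B"])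
      show "\<bar>mart u (Suc n) (\<lambda>j. Z j \<omega>) - mart u n (\<lambda>j. Z j \<omega>)\<bar> \<le> 2 * B" for n
        using u[OF ZS[of "Suc n"]] QB[OF ZS[of n]] by (simp add: mart_def)
      fix e :: real assume "e > 0"
      then obtain r where r: "inverse (real (Suc r)) < e" using reals_Archimedean by blast
      have "\<forall>\<^sub>F m in sequentially. \<bar>mart u (m\<^sup>2) (\<lambda>j. Z j \<omega>)\<bar> \<le> inverse (real (Suc r)) * real (m\<^sup>2)"
        using elim(1) by blast
      then show "\<forall>\<^sub>F m in sequentially. \<bar>mart u (m\<^sup>2) (\<lambda>j. Z j \<omega>)\<bar> \<le> e * real (m\<^sup>2)"
      proof eventually_elim
        case (elim m)
        have "inverse (real (Suc r)) * real (m\<^sup>2) \<le> e * real (m\<^sup>2)" using r by (intro mult_right_mono) auto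
        then show ?case using elim by linarith
      qed
    qed
  qed
qed

theorem AE_ergodic:
  assumes f: "ucont d f"
  shows "AE \<omega> in M. (\<lambda>N. (\<Sum>k<N. f (Z k \<omega>)) / real N) \<longlonglongrightarrow> lim_mean f"
proof -
  obtain B where B: "\<And>z. z \<in> State d \<Longrightarrow> \<bar>f z\<bar> \<le> B" using ucont_bounded[OF f] d2 by auto
  \<comment> \<open>A truncated solution of the Poisson equation: \<open>u n - markov_op (u n) = f - (markov_op ^^ n) f\<close>.\<close>
  define u where "u n z = (\<Sum>j<n. (markov_op ^^ j) f z)" for n z
  have QnB: "\<bar>(markov_op ^^ j) f z\<bar> \<le> B" if "z \<in> State d" for j z
    using markov_op_pow_bounds[of "-B" f B z j] B that by (auto simp: abs_le_iff minus_le_iff)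
  have uB: "\<bar>u n z\<bar> \<le> real n * B" if z: "z \<in> State d" for n z
  proof -
    have "\<bar>u n z\<bar> \<le> (\<Sum>j<n. \<bar>(markov_op ^^ j) f z\<bar>)" unfolding u_def by (rule sum_abs)
    also have "\<dots> \<le> (\<Sum>j<n. B)" using QnB[OF z] by (intro sum_mono) auto
    finally show ?thesis by simp
  qed
  have Qu: "markov_op (u n) z = (\<Sum>j<n. (markov_op ^^ Suc j) f z)" for n z
    by (simp add: u_def markov_op_def sum_distrib_left sum.swap[of _ "{..<n}"])
  have tele: "u n z - markov_op (u n) z = f z - (markov_op ^^ n) f z" for n z
    unfolding Qu u_def using sum_lessThan_telescope'[of "\<lambda>j. (markov_op ^^ j) f z" n] by (simp add: sum_subtractf[symmetric])
  have "AE \<omega> in M. \<forall>n. (\<lambda>N. mart (u n) N (\<lambda>j. Z j \<omega>) / real N) \<longlonglongrightarrow> 0"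
    unfolding AE_all_countable by (intro allI AE_martingale[OF uB])
  then show ?thesis
    using AE_space
  proof eventually_elim
    case (elim \<omega>)
    have ZS: "Z k \<omega> \<in> State d" for k by (rule Z_State[OF elim(2)])
    show ?case
    proof (rule metric_LIMSEQ_I)
      fix r :: real assume r: "r > 0"
      obtain n where n: "\<And>z. z \<in> State d \<Longrightarrow> \<bar>(markov_op ^^ n) f z - lim_mean f\<bar> \<le> r / 4"
        using markov_op_pow_tendsto_uniform[OF f, of "r / 4"] r by auto
      let ?S = "\<lambda>N. mart (u n) N (\<lambda>j. Z j \<omega>)"
      have dec: "(\<Sum>k<N. f (Z k \<omega>)) - real N * lim_mean f = u n (Z 0 \<omega>) - u n (Z N \<omega>) + ?S N + (\<Sum>k<N. (markov_op ^^ n) f (Z k \<omega>) - lim_mean f)" for N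
      proof -
        have "(\<Sum>k<N. f (Z k \<omega>)) = (\<Sum>k<N. (u n (Z k \<omega>) - u n (Z (Suc k) \<omega>)) + (u n (Z (Suc k) \<omega>) - markov_op (u n) (Z k \<omega>)) + (markov_op ^^ n) f (Z k \<omega>))"
          using tele[of n] by (intro sum.cong) auto
        also have "\<dots> = (\<Sum>k<N. u n (Z k \<omega>) - u n (Z (Suc k) \<omega>)) + ?S N + (\<Sum>k<N. (markov_op ^^ n) f (Z k \<omega>))"
          by (simp only: sum.distrib mart_def)
        also have "(\<Sum>k<N. u n (Z k \<omega>) - u n (Z (Suc k) \<omega>)) = u n (Z 0 \<omega>) - u n (Z N \<omega>)"
          by (rule sum_lessThan_telescope')
        finally show ?thesis by (simp add: sum_subtractf)
      qed
      have "(\<lambda>N. 2 * (real n * B) * inverse (real N)) \<longlonglongrightarrow> 2 * (real n * B) * 0"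
        by (intro tendsto_intros lim_inverse_n)
      then have 1: "\<forall>\<^sub>F N in sequentially. 2 * (real n * B) * inverse (real N) < r / 4"
        using r by (intro order_tendstoD(2)) auto
      have 2: "\<forall>\<^sub>F N in sequentially. \<bar>?S N / real N\<bar> < r / 4"
        using elim(1) r by (intro order_tendstoD(2)[OF tendsto_rabs_zero]) auto
      have "\<forall>\<^sub>F N in sequentially. dist ((\<Sum>k<N. f (Z k \<omega>)) / real N) (lim_mean f) < r"
        using 1 2 eventually_gt_at_top[of 0]
      proof eventually_elim
        case (elim N)
        have N: "real N > 0" using elim(3) by simp
        have a: "\<bar>u n (Z 0 \<omega>) - u n (Z N \<omega>)\<bar> < r / 4 * real N"
        proof -
          have "\<bar>u n (Z 0 \<omega>) - u n (Z N \<omega>)\<bar> \<le> 2 * (real n * B)"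
            using uB[OF ZS[of 0], of n] uB[OF ZS[of N], of n] by linarith
          also have "\<dots> < r / 4 * real N" using elim(1) N by (simp add: field_simps)
          finally show ?thesis .
        qed
        have b: "\<bar>?S N\<bar> < r / 4 * real N" using elim(2) N by (simp add: abs_divide pos_divide_less_eq)
        have c: "\<bar>\<Sum>k<N. (markov_op ^^ n) f (Z k \<omega>) - lim_mean f\<bar> \<le> r / 4 * real N"
        proof -
          have "\<bar>\<Sum>k<N. (markov_op ^^ n) f (Z k \<omega>) - lim_mean f\<bar> \<le> (\<Sum>k<N. \<bar>(markov_op ^^ n) f (Z k \<omega>) - lim_mean f\<bar>)" by (rule sum_abs)
          also have "\<dots> \<le> (\<Sum>k<N. r / 4)" using n[OF ZS] by (intro sum_mono) auto
          finally show ?thesis by (simp add: mult.commute)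
        qed
        have "\<bar>(\<Sum>k<N. f (Z k \<omega>)) - real N * lim_mean f\<bar> < r * real N"
          unfolding dec using a b c mult_pos_pos[OF r N] by linarith
        moreover have "(\<Sum>k<N. f (Z k \<omega>)) / real N - lim_mean f = ((\<Sum>k<N. f (Z k \<omega>)) - real N * lim_mean f) / real N"
          using N by (simp add: field_simps)
        ultimately show ?case using N by (simp add: dist_real_def abs_divide pos_divide_less_eq)
      qed
      then show "\<exists>N0. \<forall>N\<ge>N0. dist ((\<Sum>k<N. f (Z k \<omega>)) / real N) (lim_mean f) < r"
        by (simp add: eventually_sequentially)
    qed
  qed
qed

end

section \<open>Pressure\<close>

lemma (in kernel) exists_kernel_plan: "\<exists>\<pi>. kernel_plan d g \<pi>"
proof -
  obtain \<pi> where \<pi>: "inv_plan d \<pi>" "\<And>x l. x \<in> Xset \<Longrightarrow> set l \<subseteq> {1..d} \<Longrightarrow> plan_space.weight d \<pi> x l = cyl_mean x l"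
    using exists_plan by blast
  interpret P: inv_plan d \<pi> by fact
  have "kernel_plan d g \<pi>"
  proof (unfold_locales)
    fix x i l n assume *: "x \<in> Xset" "i \<in> {1..d}" "l \<in> words d n" "n \<ge> (1::nat)"
    have l: "set l \<subseteq> {1..d}" "l \<noteq> []" using *(3,4) by (auto simp: words_def)
    have "P.weight x (i # l) = cyl_mean x (i # l)" using * l by (intro \<pi>(2)) auto
    also have "\<dots> = g x i (hd l) * (\<Sum>x'\<in>Xset. cyl_mean x' l)" by (rule cyl_mean_Cons[OF *(1,2) l(2)])
    also have "(\<Sum>x'\<in>Xset. cyl_mean x' l) = P.marg l"
      unfolding P.marg_sum[OF *(3)] by (intro sum.cong refl \<pi>(2)[symmetric] l)
    finally show "P.weight x (i # l) = g x i (hd l) * P.marg l" .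
  qed
  then show ?thesis by blast
qed

context two_letter_cost
begin

lemma integral_letter_cost:
  assumes "inv_plan d \<pi>"
  shows "integrable \<pi> A"
    and "(\<integral>z. A z \<partial>\<pi>) = (\<integral>z. letter_cost A (fst z) (snd z 0) (snd z 1) \<partial>\<pi>)"
proof -
  interpret P: inv_plan d \<pi> by fact
  have eq: "A z = letter_cost A (fst z) (snd z 0) (snd z 1)" if "z \<in> space \<pi>" for z
    using that A_eq[of "fst z" "snd z"] by (auto simp: P.space_plan)
  show "integrable \<pi> A"
    by (subst Bochner_Integration.integrable_cong[OF refl eq], assumption) (rule P.integrable_cost)
  show "(\<integral>z. A z \<partial>\<pi>) = (\<integral>z. letter_cost A (fst z) (snd z 0) (snd z 1) \<partial>\<pi>)"
    by (rule Bochner_Integration.integral_cong[OF refl eq])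
qed

lemma value_le:
  assumes "\<And>i. i \<in> {1..d} \<Longrightarrow> h i > 0" "k > 0"
    and "\<And>j. j \<in> {1..d} \<Longrightarrow> (\<Sum>x\<in>Xset. \<Sum>i\<in>{1..d}. exp (letter_cost A x i j) * h i) \<le> k * h j"
    and "inv_plan d \<pi>"
  shows "(\<integral>z. A z \<partial>\<pi>) + plan_entropy d \<pi> \<le> ln k"
  unfolding integral_letter_cost(2)[OF assms(4)] by (rule inv_plan.pressure_bound[OF assms(4,1-3)])

lemma pressure_le:
  assumes "\<And>i. i \<in> {1..d} \<Longrightarrow> h i > 0" "k > 0"
    and "\<And>j. j \<in> {1..d} \<Longrightarrow> (\<Sum>x\<in>Xset. \<Sum>i\<in>{1..d}. exp (letter_cost A x i j) * h i) \<le> k * h j"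
  shows "pressure d A \<le> ln k"
proof -
  obtain lam h' where "perron_cost d A lam h'" using exists_perron by blast
  then interpret perron_cost d A lam h' .
  obtain \<pi> where "kernel_plan d g \<pi>" using exists_kernel_plan by blast
  then interpret P: kernel_plan d g \<pi> .
  have "\<pi> \<in> inv_plans d" using P.inv_plan_axioms by (simp add: inv_plans_iff)
  then show ?thesis
    unfolding pressure_def
    by (intro cSUP_least) (auto intro!: value_le[OF assms] simp: inv_plans_iff)
qed

end

context perron_cost
begin

lemma integral_ln_g:
  assumes "inv_plan d \<pi>"
  shows "(\<integral>z. ln (g (fst z) (snd z 0) (snd z 1)) \<partial>\<pi>) = (\<integral>z. A z \<partial>\<pi>) - ln lam"
  unfolding g_def integral_letter_cost(2)[OF assms]
  by (rule inv_plan.integral_ln_cocycle[OF assms h_pos lam_pos])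

lemma value_kernel_plan:
  assumes "kernel_plan d g \<pi>"
  shows "(\<integral>z. A z \<partial>\<pi>) + plan_entropy d \<pi> = ln lam"
proof -
  interpret P: kernel_plan d g \<pi> by fact
  show ?thesis using integral_ln_g[OF P.inv_plan_axioms] P.plan_entropy_kernel by simp
qed

lemma value_le_ln_lam: "inv_plan d \<pi> \<Longrightarrow> (\<integral>z. A z \<partial>\<pi>) + plan_entropy d \<pi> \<le> ln lam"
  by (rule value_le[OF h_pos lam_pos eq_refl[OF eigen]])

theorem pressure_eq: "pressure d A = ln lam"
proof (rule antisym)
  show "pressure d A \<le> ln lam"
    by (rule pressure_le[OF h_pos lam_pos eq_refl[OF eigen]])
  obtain \<pi> where \<pi>: "kernel_plan d g \<pi>" using exists_kernel_plan by blast
  then interpret P: kernel_plan d g \<pi> .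
  have "\<pi> \<in> inv_plans d" using P.inv_plan_axioms by (simp add: inv_plans_iff)
  moreover have "bdd_above ((\<lambda>\<pi>. (\<integral>z. A z \<partial>\<pi>) + plan_entropy d \<pi>) ` inv_plans d)"
    by (rule bdd_aboveI2[of _ _ "ln lam"]) (simp add: inv_plans_iff value_le_ln_lam)
  ultimately have "(\<integral>z. A z \<partial>\<pi>) + plan_entropy d \<pi> \<le> pressure d A"
    unfolding pressure_def by (rule cSUP_upper)
  then show "ln lam \<le> pressure d A" using value_kernel_plan[OF \<pi>] by simp
qed

text \<open>
  A plan that attains the pressure is a plan of the kernel.
\<close>

theorem kernel_planI:
  assumes "inv_plan d \<pi>" and "(\<integral>z. A z \<partial>\<pi>) + plan_entropy d \<pi> \<ge> ln lam"
  shows "kernel_plan d g \<pi>"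
proof -
  interpret P: inv_plan d \<pi> by fact
  have eq: "(\<integral>z. ln (g (fst z) (snd z 0) (snd z 1)) \<partial>\<pi>) + plan_entropy d \<pi> = 0"
    using assms(2) value_le_ln_lam[OF assms(1)] integral_ln_g[OF assms(1)] by simp
  show ?thesis
  proof unfold_locales
    show "P.weight x (i # l) = g x i (hd l) * P.marg l" if "x \<in> Xset" "i \<in> {1..d}" "l \<in> words d n" "1 \<le> n" for x i l n
      using P.entropy_subkernel(2)[where q = g, OF g_pos _ eq that] g_sum by simp
  qed
qed

end

lemma two_letter_cost_minus: "two_letter_cost d c \<Longrightarrow> two_letter_cost d (cost_minus c \<phi>)"
proof -
  assume "two_letter_cost d c"
  then interpret two_letter_cost d c .
  show ?thesis
  proof
    fix x y w assume "x \<in> Xset" "y \<in> Omega d" "w \<in> Omega d" "y 0 = w 0" "y 1 = w 1"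
    then have "c (x, y) = c (x, w)" by (rule A_cong)
    then show "cost_minus c \<phi> (x, y) = cost_minus c \<phi> (x, w)" by (simp add: cost_minus_def)
  qed (rule d2)
qed

lemma letter_cost_minus: "letter_cost (cost_minus c \<phi>) x i j = letter_cost c x i j - \<phi> x"
  by (simp add: letter_cost_def cost_minus_def)

lemma pressure_add_const:
  assumes "two_letter_cost d c"
  shows "pressure d (cost_minus c (\<lambda>x. \<phi> x + s)) = pressure d (cost_minus c \<phi>) - s"
proof -
  interpret two_letter_cost d "cost_minus c \<phi>" using assms by (rule two_letter_cost_minus)
  interpret T: two_letter_cost d "cost_minus c (\<lambda>x. \<phi> x + s)" using assms by (rule two_letter_cost_minus)
  obtain lam h where "perron_cost d (cost_minus c \<phi>) lam h" using exists_perron by blast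
  then interpret P: perron_cost d "cost_minus c \<phi>" lam h .
  interpret Q: perron_cost d "cost_minus c (\<lambda>x. \<phi> x + s)" "lam * exp (- s)" h
  proof unfold_locales
    fix j assume j: "j \<in> {1..d}"
    have "(\<Sum>x\<in>Xset. \<Sum>i\<in>{1..d}. exp (letter_cost (cost_minus c (\<lambda>x. \<phi> x + s)) x i j) * h i)
      = exp (- s) * (\<Sum>x\<in>Xset. \<Sum>i\<in>{1..d}. exp (letter_cost (cost_minus c \<phi>) x i j) * h i)"
      by (simp add: sum_distrib_left letter_cost_minus exp_diff exp_add exp_minus field_simps)
    then show "(\<Sum>x\<in>Xset. \<Sum>i\<in>{1..d}. exp (letter_cost (cost_minus c (\<lambda>x. \<phi> x + s)) x i j) * h i)
      = lam * exp (- s) * h j" using P.eigen[OF j] by simp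
  qed (use P.lam_pos P.h_pos in auto)
  show ?thesis using Q.pressure_eq P.pressure_eq P.lam_pos by (simp add: ln_mult)
qed

section \<open>First variation of the pressure\<close>

lemma exp_le_quadratic:
  fixes w :: real assumes "\<bar>w\<bar> \<le> 1" shows "exp w \<le> 1 + w + w\<^sup>2"
proof (cases "w \<ge> 0")
  case True
  then show ?thesis using assms exp_bound[of w] by simp
next
  case False
  define v where "v = - w"
  have v: "0 < v" using False by (simp add: v_def)
  have "1 + v \<le> exp v" by (rule exp_ge_add_one_self)
  have "1 \<le> (1 + v) * (1 - v + v\<^sup>2)" using v by (simp add: algebra_simps power2_eq_square)
  also have "\<dots> \<le> exp v * (1 - v + v\<^sup>2)"
  proof (rule mult_right_mono[OF exp_ge_add_one_self])
    have "0 \<le> (1 - v)\<^sup>2 + v" using v by simp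
    then show "0 \<le> 1 - v + v\<^sup>2" by (simp add: power2_eq_square algebra_simps)
  qed
  finally have "exp w \<le> exp w * (exp v * (1 - v + v\<^sup>2))" by simp
  also have "\<dots> = 1 - v + v\<^sup>2" by (simp add: v_def mult.assoc[symmetric] exp_add[symmetric])
  finally show ?thesis by (simp add: v_def)
qed

text \<open>
  A function of \<open>x\<close> as a function on states.
\<close>

definition first_letter :: "(nat \<Rightarrow> real) \<Rightarrow> nat \<times> (nat \<Rightarrow> nat) \<Rightarrow> real" where
  "first_letter \<psi> z = \<psi> (fst z)"

lemma cylfun_first_letter: "cylfun d (first_letter \<psi>)"
  by (rule cylfunI[where F = "\<lambda>x l. \<psi> x" and n = 0]) (simp add: first_letter_def)

context perron_cost
begin

lemma markov_op_pow_first_letter: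
  assumes "x \<in> Xset" "y \<in> Omega d"
  shows "(markov_op ^^ Suc k) (first_letter \<psi>) (x, y) = (markov_op ^^ Suc k) (first_letter \<psi>) (1, \<lambda>_. y 0)"
proof -
  have "near d (Suc 0) 0 (first_letter \<psi>)" by (simp add: near_def first_letter_def)
  then have nr: "near d 1 0 ((markov_op ^^ Suc k) (first_letter \<psi>))" by (rule near_markov_op_pow) simp
  have w: "(\<lambda>_. y 0) \<in> Omega d" using Omega_nth[OF assms(2), of 0] unfolding Omega_def by auto
  have "pre 1 y = pre 1 (\<lambda>_. y 0)" by (simp add: pre_eq_iff)
  from nr[unfolded near_def, rule_format, OF assms w this]
  have "(markov_op ^^ Suc k) (first_letter \<psi>) (x, y) = (markov_op ^^ Suc k) (first_letter \<psi>) (x, \<lambda>_. y 0)"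
    by (simp del: funpow.simps)
  also have "\<dots> = (markov_op ^^ Suc k) (first_letter \<psi>) (1, \<lambda>_. y 0)"
    unfolding funpow.simps o_apply by (rule markov_op_snd)
  finally show ?thesis .
qed

text \<open>
  Approximate solutions \<open>u\<close> of the Poisson equation: up to \<open>e\<close>, subtracting the coboundary of \<open>u\<close> makes
  the conditional mean of \<open>\<psi>\<close> constant.
\<close>

lemma exists_corrector:
  assumes e: "e > 0"
  shows "\<exists>u. \<forall>j\<in>{1..d}. \<bar>(\<Sum>x\<in>Xset. \<Sum>i\<in>{1..d}. g x i j * (u i - u j - \<psi> x)) + lim_mean (first_letter \<psi>)\<bar> \<le> e"
proof -
  let ?f = "first_letter \<psi>"
  obtain N where N: "\<forall>n\<ge>N. \<forall>z\<in>State d. \<bar>(markov_op ^^ n) ?f z - lim_mean ?f\<bar> \<le> e"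
    using markov_op_pow_tendsto_uniform[OF cylfun_ucont[OF cylfun_first_letter] e] by blast
  define q where "q k j = (markov_op ^^ Suc k) ?f (1, \<lambda>_. j)" for k j
  define u where "u i = - (\<Sum>k<N. q k i)" for i
  have "\<bar>(\<Sum>x\<in>Xset. \<Sum>i\<in>{1..d}. g x i j * (u i - u j - \<psi> x)) + lim_mean ?f\<bar> \<le> e" if j: "j \<in> {1..d}" for j
  proof -
    have jO: "(\<lambda>_. j) \<in> Omega d" using j unfolding Omega_def by auto
    have z: "(1, \<lambda>_. j) \<in> State d" using jO by (simp add: State_def Xset_def)
    have q_Suc: "q (Suc k) j = (\<Sum>x\<in>Xset. \<Sum>i\<in>{1..d}. g x i j * q k i)" for k
    proof -
      have "q (Suc k) j = markov_op ((markov_op ^^ Suc k) ?f) (1, \<lambda>_. j)" by (simp add: q_def)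
      also have "\<dots> = (\<Sum>x\<in>Xset. \<Sum>i\<in>{1..d}. g x i j * (markov_op ^^ Suc k) ?f (x, scons i (\<lambda>_. j)))"
        by (simp add: markov_op_def)
      also have "\<dots> = (\<Sum>x\<in>Xset. \<Sum>i\<in>{1..d}. g x i j * q k i)"
        using jO by (intro sum.cong refl) (subst markov_op_pow_first_letter, auto simp: q_def simp del: funpow.simps)
      finally show ?thesis .
    qed
    have q_0: "q 0 j = (\<Sum>x\<in>Xset. \<Sum>i\<in>{1..d}. g x i j * \<psi> x)"
      by (simp add: q_def markov_op_def first_letter_def)
    have "(\<Sum>x\<in>Xset. \<Sum>i\<in>{1..d}. g x i j * (u i - u j - \<psi> x))
      = (\<Sum>x\<in>Xset. \<Sum>i\<in>{1..d}. g x i j * u i) - (\<Sum>x\<in>Xset. \<Sum>i\<in>{1..d}. g x i j) * u j - q 0 j"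
      by (simp add: q_0 sum_subtractf sum.distrib sum_distrib_left sum_distrib_right algebra_simps)
    also have "(\<Sum>x\<in>Xset. \<Sum>i\<in>{1..d}. g x i j * u i) = - (\<Sum>k<N. \<Sum>x\<in>Xset. \<Sum>i\<in>{1..d}. g x i j * q k i)"
      by (simp add: u_def sum_distrib_left sum_negf sum.swap[of _ "{..<N}"])
    also have "\<dots> = - (\<Sum>k<N. q (Suc k) j)" by (simp add: q_Suc)
    also have "- (\<Sum>k<N. q (Suc k) j) - (\<Sum>x\<in>Xset. \<Sum>i\<in>{1..d}. g x i j) * u j - q 0 j = - q N j"
      unfolding g_sum[OF j] u_def using sum_lessThan_telescope[of "\<lambda>k. q k j" N] by (simp add: sum_subtractf)
    finally have "(\<Sum>x\<in>Xset. \<Sum>i\<in>{1..d}. g x i j * (u i - u j - \<psi> x)) = - q N j" .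
    moreover have "\<bar>q N j - lim_mean ?f\<bar> \<le> e" unfolding q_def using N[rule_format, of "Suc N", OF _ z] by simp
    ultimately show ?thesis by (simp add: abs_minus_commute)
  qed
  then show ?thesis by blast
qed

text \<open>
  The first order bound follows from the test vector \<open>h i * exp (t * u i)\<close>, where \<open>u\<close> is a corrector of \<open>\<psi>\<close>.
\<close>

theorem pressure_first_order:
  assumes e: "e > 0"
  shows "\<exists>K\<ge>1. \<forall>t. \<bar>t\<bar> * K \<le> 1 \<longrightarrow>
    pressure d (cost_minus A (\<lambda>x. t * \<psi> x)) \<le> ln lam - t * lim_mean (first_letter \<psi>) + \<bar>t\<bar> * e + t\<^sup>2 * K\<^sup>2"
proof -
  let ?L = "lim_mean (first_letter \<psi>)"
  obtain u where u: "\<And>j. j \<in> {1..d} \<Longrightarrow> \<bar>(\<Sum>x\<in>Xset. \<Sum>i\<in>{1..d}. g x i j * (u i - u j - \<psi> x)) + ?L\<bar> \<le> e"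
    using exists_corrector[OF e] by blast
  define K where "K = 1 + (\<Sum>x\<in>Xset. \<bar>\<psi> x\<bar>) + 2 * (\<Sum>i\<in>{1..d}. \<bar>u i\<bar>)"
  have K1: "K \<ge> 1" unfolding K_def by (simp add: sum_nonneg)
  have K: "\<bar>u i - u j - \<psi> x\<bar> \<le> K" if "x \<in> Xset" "i \<in> {1..d}" "j \<in> {1..d}" for x i j
  proof -
    have "\<bar>\<psi> x\<bar> \<le> (\<Sum>x\<in>Xset. \<bar>\<psi> x\<bar>)" "\<bar>u i\<bar> \<le> (\<Sum>i\<in>{1..d}. \<bar>u i\<bar>)" "\<bar>u j\<bar> \<le> (\<Sum>i\<in>{1..d}. \<bar>u i\<bar>)"
      using that by (auto intro!: member_le_sum)
    then show ?thesis unfolding K_def by linarith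
  qed
  have "pressure d (cost_minus A (\<lambda>x. t * \<psi> x)) \<le> ln lam - t * ?L + \<bar>t\<bar> * e + t\<^sup>2 * K\<^sup>2"
    if t: "\<bar>t\<bar> * K \<le> 1" for t
  proof -
    interpret T: two_letter_cost d "cost_minus A (\<lambda>x. t * \<psi> x)"
      by (rule two_letter_cost_minus) (rule two_letter_cost_axioms)
    define r where "r = 1 - t * ?L + \<bar>t\<bar> * e + t\<^sup>2 * K\<^sup>2"
    have main: "(\<Sum>x\<in>Xset. \<Sum>i\<in>{1..d}. g x i j * exp (t * (u i - u j - \<psi> x))) \<le> r" if j: "j \<in> {1..d}" for j
    proof -
      have "(\<Sum>x\<in>Xset. \<Sum>i\<in>{1..d}. g x i j * exp (t * (u i - u j - \<psi> x)))
        \<le> (\<Sum>x\<in>Xset. \<Sum>i\<in>{1..d}. g x i j * (1 + t * (u i - u j - \<psi> x) + t\<^sup>2 * K\<^sup>2))"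
      proof (intro sum_mono mult_left_mono)
        fix x i assume xi: "x \<in> Xset" "i \<in> {1..d}"
        let ?w = "t * (u i - u j - \<psi> x)"
        have "\<bar>?w\<bar> \<le> \<bar>t\<bar> * K" using K[OF xi j] by (simp add: abs_mult mult_left_mono)
        then have "\<bar>?w\<bar> \<le> 1" using t by simp
        then have "exp ?w \<le> 1 + ?w + ?w\<^sup>2" by (rule exp_le_quadratic)
        also have "?w\<^sup>2 \<le> (\<bar>t\<bar> * K)\<^sup>2" using \<open>\<bar>?w\<bar> \<le> \<bar>t\<bar> * K\<close>
          by (metis abs_ge_zero order_trans abs_of_nonneg abs_le_square_iff)
        also have "(\<bar>t\<bar> * K)\<^sup>2 = t\<^sup>2 * K\<^sup>2" by (simp add: power_mult_distrib)
        finally show "exp ?w \<le> 1 + ?w + t\<^sup>2 * K\<^sup>2" by simp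
        show "0 \<le> g x i j" using g_pos[OF xi j] by simp
      qed
      also have "\<dots> = (\<Sum>x\<in>Xset. \<Sum>i\<in>{1..d}. g x i j) * (1 + t\<^sup>2 * K\<^sup>2) + t * (\<Sum>x\<in>Xset. \<Sum>i\<in>{1..d}. g x i j * (u i - u j - \<psi> x))"
        unfolding sum_distrib_left sum_distrib_right sum.distrib[symmetric]
        by (intro sum.cong refl) (simp add: algebra_simps)
      also have "\<dots> = 1 + t\<^sup>2 * K\<^sup>2 + t * (\<Sum>x\<in>Xset. \<Sum>i\<in>{1..d}. g x i j * (u i - u j - \<psi> x))"
        using g_sum[OF j] by simp
      also have "t * (\<Sum>x\<in>Xset. \<Sum>i\<in>{1..d}. g x i j * (u i - u j - \<psi> x)) \<le> \<bar>t\<bar> * e - t * ?L"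
      proof -
        have "\<bar>t * ((\<Sum>x\<in>Xset. \<Sum>i\<in>{1..d}. g x i j * (u i - u j - \<psi> x)) + ?L)\<bar> \<le> \<bar>t\<bar> * e"
          unfolding abs_mult using u[OF j] by (rule mult_left_mono) simp
        then show ?thesis unfolding distrib_left by linarith
      qed
      finally show ?thesis by (simp add: r_def)
    qed
    have r_pos: "r > 0"
    proof -
      have 1: "1 \<in> {1..d}" using d2 by simp
      have "0 < (\<Sum>x\<in>Xset. \<Sum>i\<in>{1..d}. g x i 1 * exp (t * (u i - u 1 - \<psi> x)))"
        using d2 g_pos[OF _ _ 1] by (intro sum_pos mult_pos_pos) (auto simp: Xset_def)
      then show ?thesis using main[OF 1] by linarith
    qed
    have "pressure d (cost_minus A (\<lambda>x. t * \<psi> x)) \<le> ln (lam * r)"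
    proof (rule T.pressure_le[where h = "\<lambda>i. h i * exp (t * u i)"])
      show "h i * exp (t * u i) > 0" if "i \<in> {1..d}" for i using h_pos[OF that] by simp
      show "lam * r > 0" using lam_pos r_pos by simp
      fix j assume j: "j \<in> {1..d}"
      have "(\<Sum>x\<in>Xset. \<Sum>i\<in>{1..d}. exp (letter_cost (cost_minus A (\<lambda>x. t * \<psi> x)) x i j) * (h i * exp (t * u i)))
        = (\<Sum>x\<in>Xset. \<Sum>i\<in>{1..d}. lam * h j * exp (t * u j) * (g x i j * exp (t * (u i - u j - \<psi> x))))"
      proof (intro sum.cong refl)
        fix x i assume "x \<in> Xset" "i \<in> {1..d}"
        let ?E = "exp (t * u j) * exp (t * (u i - u j - \<psi> x))"
        have "exp (letter_cost (cost_minus A (\<lambda>x. t * \<psi> x)) x i j) * (h i * exp (t * u i))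
          = (exp (letter_cost (cost_minus A (\<lambda>x. t * \<psi> x)) x i j) * exp (t * u i)) * h i" by simp
        also have "exp (letter_cost (cost_minus A (\<lambda>x. t * \<psi> x)) x i j) * exp (t * u i)
          = exp (letter_cost A x i j) * ?E"
          by (simp add: letter_cost_minus exp_add[symmetric] algebra_simps)
        also have "exp (letter_cost A x i j) * ?E * h i = (exp (letter_cost A x i j) * h i) * ?E" by simp
        also have "exp (letter_cost A x i j) * h i = lam * h j * g x i j"
          using h_pos[OF j] lam_pos by (simp add: g_def)
        finally show "exp (letter_cost (cost_minus A (\<lambda>x. t * \<psi> x)) x i j) * (h i * exp (t * u i))
          = lam * h j * exp (t * u j) * (g x i j * exp (t * (u i - u j - \<psi> x)))"
          by (simp only: mult_ac)
      qed
      also have "\<dots> = lam * h j * exp (t * u j) * (\<Sum>x\<in>Xset. \<Sum>i\<in>{1..d}. g x i j * exp (t * (u i - u j - \<psi> x)))"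
        by (simp add: sum_distrib_left)
      also have "\<dots> \<le> lam * h j * exp (t * u j) * r"
        using main[OF j] h_pos[OF j] lam_pos by (intro mult_left_mono) auto
      finally show "(\<Sum>x\<in>Xset. \<Sum>i\<in>{1..d}. exp (letter_cost (cost_minus A (\<lambda>x. t * \<psi> x)) x i j) * (h i * exp (t * u i)))
        \<le> lam * r * (h j * exp (t * u j))" by (simp add: mult_ac)
    qed
    also have "ln (lam * r) = ln lam + ln r" using lam_pos r_pos by (simp add: ln_mult)
    also have "\<dots> \<le> ln lam + (r - 1)" using ln_le_minus_one[OF r_pos] by simp
    finally show ?thesis by (simp add: r_def)
  qed
  then show ?thesis using K1 by blast
qed

end

section \<open>Lagrange multipliers and the limit plan\<close>

lemma integral_Xset:
  fixes \<mu> :: "nat measure" and \<phi> :: "nat \<Rightarrow> real"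
  assumes "prob_space \<mu>" "sets \<mu> = sets (count_space Xset)"
  shows "integrable \<mu> \<phi>" and "(\<integral>x. \<phi> x \<partial>\<mu>) = \<phi> 1 * measure \<mu> {1} + \<phi> 2 * measure \<mu> {2}"
proof -
  interpret prob_space \<mu> by fact
  have sp: "space \<mu> = Xset" using sets_eq_imp_space_eq[OF assms(2)] by simp
  have eq: "\<phi> x = \<phi> 1 * indicator {1} x + \<phi> 2 * indicator {2} x" if "x \<in> space \<mu>" for x
    using that by (auto simp: sp Xset_def)
  have int: "integrable \<mu> (\<lambda>x. a * indicator {b} x)" if "b \<in> Xset" for a :: real and b
    using that assms(2) by (intro integrable_mult_right integrable_real_indicator) (auto simp: less_top[symmetric])
  have 12: "1 \<in> Xset" "2 \<in> Xset" by (auto simp: Xset_def)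
  show "integrable \<mu> \<phi>"
    by (subst Bochner_Integration.integrable_cong[OF refl eq], assumption)
      (intro Bochner_Integration.integrable_add int 12)
  have "(\<integral>x. \<phi> x \<partial>\<mu>) = (\<integral>x. \<phi> 1 * indicator {1} x + \<phi> 2 * indicator {2} x \<partial>\<mu>)"
    by (rule Bochner_Integration.integral_cong[OF refl eq])
  also have "\<dots> = (\<integral>x. \<phi> 1 * indicator {1} x \<partial>\<mu>) + (\<integral>x. \<phi> 2 * indicator {2} x \<partial>\<mu>)"
    by (rule Bochner_Integration.integral_add[OF int int]) (rule 12)+
  also have "\<dots> = \<phi> 1 * measure \<mu> {1} + \<phi> 2 * measure \<mu> {2}"
    using 12 by (simp add: sp Int_absorb2 Int_absorb1)
  finally show "(\<integral>x. \<phi> x \<partial>\<mu>) = \<phi> 1 * measure \<mu> {1} + \<phi> 2 * measure \<mu> {2}" .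
qed

lemma measure_Xset_2:
  assumes "prob_space \<mu>" "sets \<mu> = sets (count_space Xset)"
  shows "measure \<mu> {2} = 1 - measure \<mu> {1}"
  using integral_Xset(2)[OF assms, of "\<lambda>_. 1"] prob_space.prob_space[OF assms(1)] by simp

text \<open>
  The competitor \<open>\<phi>m + t * \<psi> + s\<close>, with \<open>s\<close> the pressure of \<open>c - \<phi>m - t * \<psi>\<close>, satisfies the constraint. So
  the pressure lies above the line \<open>- t * \<integral> \<psi> d\<mu>\<close>, and the first order upper bound, used for both signs of \<open>t\<close>, identifies the slope.
\<close>

lemma minimizer_first_variation:
  assumes mu: "prob_space \<mu>" "sets \<mu> = sets (count_space Xset)"
    and c: "two_letter_cost d c"
    and minimizer: "is_arg_min (\<lambda>\<phi>. \<integral>x. \<phi> x \<partial>\<mu>) (\<lambda>\<phi>. pressure d (cost_minus c \<phi>) = 0) \<phi>m"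
    and P: "perron_cost d (cost_minus c \<phi>m) lam h"
  shows "kernel.lim_mean d (perron_cost.g (cost_minus c \<phi>m) lam h) (first_letter \<psi>) = (\<integral>x. \<psi> x \<partial>\<mu>)"
proof -
  let ?A = "cost_minus c \<phi>m"
  interpret P: perron_cost d ?A lam h by fact
  let ?L = "P.lim_mean (first_letter \<psi>)" and ?m = "\<integral>x. \<psi> x \<partial>\<mu>"
  have p0: "pressure d ?A = 0" using minimizer by (simp add: is_arg_min_def)
  then have ln0: "ln lam = 0" using P.pressure_eq by simp
  have lower: "- t * ?m \<le> pressure d (cost_minus ?A (\<lambda>x. t * \<psi> x))" for t
  proof -
    define s where "s = pressure d (cost_minus ?A (\<lambda>x. t * \<psi> x))"
    have eq: "cost_minus ?A (\<lambda>x. t * \<psi> x) = cost_minus c (\<lambda>x. \<phi>m x + t * \<psi> x)"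
      by (auto simp: cost_minus_def)
    have "pressure d (cost_minus c (\<lambda>x. (\<phi>m x + t * \<psi> x) + s)) = 0"
      unfolding pressure_add_const[OF c] s_def eq by simp
    then have "(\<integral>x. \<phi>m x \<partial>\<mu>) \<le> (\<integral>x. (\<phi>m x + t * \<psi> x) + s \<partial>\<mu>)"
      using minimizer by (auto simp: is_arg_min_def not_less)
    also have "\<dots> = (\<integral>x. \<phi>m x \<partial>\<mu>) + t * ?m + s"
      unfolding integral_Xset(2)[OF mu] measure_Xset_2[OF mu] by (simp add: algebra_simps)
    finally show ?thesis by (simp add: s_def)
  qed
  have "\<bar>?L - ?m\<bar> \<le> 0 + e" if e: "e > 0" for e
  proof -
    obtain K where K: "K \<ge> 1" "\<And>t. \<bar>t\<bar> * K \<le> 1 \<Longrightarrow>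
      pressure d (cost_minus ?A (\<lambda>x. t * \<psi> x)) \<le> ln lam - t * ?L + \<bar>t\<bar> * (e / 2) + t\<^sup>2 * K\<^sup>2"
      using P.pressure_first_order[of "e / 2" \<psi>] e by auto
    \<comment> \<open>Small enough for the first order bound, and to make the quadratic term at most \<open>t * e / 2\<close>.\<close>
    define t where "t = min (1 / K) (e / (2 * K\<^sup>2))"
    have t: "t > 0" "t * K \<le> 1" "t * K\<^sup>2 \<le> e / 2"
    proof -
      have "t \<le> 1 / K" "t \<le> e / (2 * K\<^sup>2)" by (simp_all add: t_def)
      then show "t * K \<le> 1" "t * K\<^sup>2 \<le> e / 2" using K(1) by (simp_all add: field_simps)
      show "t > 0" using K(1) e by (simp add: t_def)
    qed
    have "- t * ?m \<le> - t * ?L + t * (e / 2) + t * (t * K\<^sup>2)"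
      using lower[of t] K(2)[of t] t ln0 by (simp add: power2_eq_square mult.assoc)
    moreover have "t * ?m \<le> t * ?L + t * (e / 2) + t * (t * K\<^sup>2)"
      using lower[of "- t"] K(2)[of "- t"] t ln0 by (simp add: power2_eq_square mult.assoc)
    moreover have "t * (t * K\<^sup>2) \<le> t * (e / 2)" using t by (intro mult_left_mono) auto
    ultimately have "t * (?L - ?m) \<le> t * e" "t * (?m - ?L) \<le> t * e"
      by (simp_all add: algebra_simps)
    then show ?thesis using t(1) by (simp add: abs_le_iff)
  qed
  then have "\<bar>?L - ?m\<bar> \<le> 0" by (rule field_le_epsilon)
  then show ?thesis by simp
qed

lemma (in plan_space) integral_X_marginal:
  assumes "X_marginal \<pi> = \<mu>"
  shows "(\<integral>z. \<phi> (fst z) \<partial>\<pi>) = (\<integral>x. \<phi> x \<partial>\<mu> :: real)"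
proof -
  have m: "fst \<in> \<pi> \<rightarrow>\<^sub>M count_space Xset"
    by (rule measurable_count_space_extend[of Xset UNIV]) (auto simp: space_plan)
  show ?thesis
    unfolding assms[symmetric] X_marginal_def by (subst integral_distr[OF m]) auto
qed

theorem theorem5:
  fixes d :: nat
    and \<mu> :: "nat measure"
    and c :: "nat \<times> (nat \<Rightarrow> nat) \<Rightarrow> real"
    and \<phi>m :: "nat \<Rightarrow> real"
    and \<pi> :: "(nat \<times> (nat \<Rightarrow> nat)) measure"
    and x0 :: nat and y0 :: "nat \<Rightarrow> nat"
    and M :: "'w measure"
    and Z :: "nat \<Rightarrow> 'w \<Rightarrow> nat \<times> (nat \<Rightarrow> nat)"
    and f :: "nat \<times> (nat \<Rightarrow> nat) \<Rightarrow> real"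
  assumes d: "d \<ge> 2"
    and mu: "prob_space \<mu>" "sets \<mu> = sets (count_space Xset)"
    and c: "\<And>x y w. x \<in> Xset \<Longrightarrow> y \<in> Omega d \<Longrightarrow> w \<in> Omega d \<Longrightarrow>
              y 0 = w 0 \<Longrightarrow> y 1 = w 1 \<Longrightarrow> c (x, y) = c (x, w)"
    and minimizer: "is_arg_min (\<lambda>\<phi>. \<integral>x. \<phi> x \<partial>\<mu>) (\<lambda>\<phi>. pressure d (cost_minus c \<phi>) = 0) \<phi>m"
    and maximizer: "is_arg_max (\<lambda>\<pi>. (\<integral>z. c z \<partial>\<pi>) + plan_entropy d \<pi>)
                      (\<lambda>\<pi>. \<pi> \<in> inv_plans_with d \<mu>) \<pi>"
    and start: "x0 \<in> Xset" "y0 \<in> Omega d"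
    and Z: "random_sequence d (normalized_cost d (cost_minus c \<phi>m)) (x0, y0) M Z"
    and f: "continuous_on (Xset \<times> Omega d) f"
  shows "AE \<omega> in M. (\<lambda>N. (\<Sum>k<N. f (Z k \<omega>)) / real N) \<longlonglongrightarrow> (\<integral>z. f z \<partial>\<pi>)"
proof -
  let ?A = "cost_minus c \<phi>m"
  have tc: "two_letter_cost d c" by (rule two_letter_cost.intro[where A = c, OF d c])
  interpret C: two_letter_cost d c by fact
  interpret A: two_letter_cost d ?A by (rule two_letter_cost_minus[OF tc])
  obtain lam h where P: "perron_cost d ?A lam h" using A.exists_perron by blast
  interpret P: perron_cost d ?A lam h by fact
  have value_split: "(\<integral>z. c z \<partial>\<rho>) = (\<integral>z. ?A z \<partial>\<rho>) + (\<integral>x. \<phi>m x \<partial>\<mu>)" if \<rho>: "\<rho> \<in> inv_plans_with d \<mu>" for \<rho>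
  proof -
    have inv: "inv_plan d \<rho>" using \<rho> by (simp add: inv_plans_with_def inv_plans_iff)
    interpret R: inv_plan d \<rho> by fact
    have "integrable \<rho> (\<lambda>z. \<phi>m (fst z))"
      using R.integral_pre(1)[of "\<lambda>x l. \<phi>m x" 0] .
    moreover have "c z = ?A z + \<phi>m (fst z)" for z by (cases z) (simp add: cost_minus_def)
    moreover have "X_marginal \<rho> = \<mu>" using \<rho> by (simp add: inv_plans_with_def)
    ultimately show ?thesis
      using A.integral_letter_cost(1)[OF inv] R.integral_X_marginal[of \<mu> \<phi>m] by simp
  qed
  obtain \<rho> where \<rho>: "kernel_plan d P.g \<rho>" using P.exists_kernel_plan by blast
  interpret R: kernel_plan d P.g \<rho> by fact
  have \<rho>_X: "X_marginal \<rho> = \<mu>"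
  proof -
    have m: "fst \<in> \<rho> \<rightarrow>\<^sub>M count_space Xset"
      by (rule measurable_count_space_extend[of Xset UNIV]) (auto simp: R.space_plan)
    have ps: "prob_space (X_marginal \<rho>)" "sets (X_marginal \<rho>) = sets (count_space Xset)"
      unfolding X_marginal_def using R.prob_space_distr[OF m] by simp_all
    have "measure (X_marginal \<rho>) {1} = (\<integral>x. indicator {1} x \<partial>X_marginal \<rho>)"
      unfolding integral_Xset(2)[OF ps] by simp
    also have "\<dots> = (\<integral>z. first_letter (indicator {1}) z \<partial>\<rho>)"
      unfolding first_letter_def by (rule R.integral_X_marginal[OF refl, symmetric])
    also have "\<dots> = P.lim_mean (first_letter (indicator {1}))"
      by (rule R.integral_cylfun[OF cylfun_first_letter])
    also have "\<dots> = (\<integral>x. indicator {1} x \<partial>\<mu>)"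
      by (rule minimizer_first_variation[OF mu tc minimizer P])
    also have "\<dots> = measure \<mu> {1}" unfolding integral_Xset(2)[OF mu] by simp
    finally have 1: "measure (X_marginal \<rho>) {1} = measure \<mu> {1}" .
    interpret XM: prob_space "X_marginal \<rho>" by fact
    interpret MU: prob_space \<mu> by fact
    show ?thesis
    proof (rule measure_eqI_finite[of _ Xset])
      fix a assume "a \<in> Xset"
      then have "a = 1 \<or> a = 2" by (auto simp: Xset_def)
      then show "emeasure (X_marginal \<rho>) {a} = emeasure \<mu> {a}"
        using 1 measure_Xset_2[OF ps] measure_Xset_2[OF mu]
        by (auto simp: XM.emeasure_eq_measure MU.emeasure_eq_measure)
    qed (use ps mu in auto)
  qed
  have \<rho>_with: "\<rho> \<in> inv_plans_with d \<mu>"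
    using \<rho>_X R.inv_plan_axioms by (simp add: inv_plans_with_def inv_plans_iff)
  have \<pi>_with: "\<pi> \<in> inv_plans_with d \<mu>" using maximizer by (simp add: is_arg_max_def)
  then have \<pi>_inv: "inv_plan d \<pi>" by (simp add: inv_plans_with_def inv_plans_iff)
  have "(\<integral>z. c z \<partial>\<rho>) + plan_entropy d \<rho> \<le> (\<integral>z. c z \<partial>\<pi>) + plan_entropy d \<pi>"
    using maximizer \<rho>_with by (auto simp: is_arg_max_def not_less)
  then have "ln lam \<le> (\<integral>z. ?A z \<partial>\<pi>) + plan_entropy d \<pi>"
    using P.value_kernel_plan[OF \<rho>] value_split[OF \<rho>_with] value_split[OF \<pi>_with] by simp
  then have "kernel_plan d P.g \<pi>" by (rule P.kernel_planI[OF \<pi>_inv])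
  then interpret K: kernel_plan d P.g \<pi> .
  have uf: "ucont d f" using f by (rule ucont_continuous)
  have "f \<in> borel_measurable \<pi>"
    using borel_measurable_continuous_on_restrict[OF f] by (rule K.measurable_planI)
  then have int: "(\<integral>z. f z \<partial>\<pi>) = P.lim_mean f" by (rule K.integral_eq_lim_mean[OF uf])
  have "prob_space M" using Z by (simp add: random_sequence_def)
  then interpret M: prob_space M .
  interpret KP: kernel_process d P.g M Z "(x0, y0)"
  proof unfold_locales
    show "Z k \<in> M \<rightarrow>\<^sub>M restrict_space borel (Xset \<times> Omega d)" for k
      using Z by (simp add: random_sequence_def)
    show "AE \<omega> in M. Z 0 \<omega> = (x0, y0)" using Z by (simp add: random_sequence_def)
    show "(x0, y0) \<in> State d" using start by (simp add: State_def)
    fix k h \<alpha> i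
    assume pos: "measure M {\<omega> \<in> space M. \<forall>j\<le>k. Z j \<omega> = h j} > 0" and hk: "h k \<in> State d"
      and \<alpha>: "\<alpha> \<in> Xset" and i: "i \<in> {1..d}"
    have "snd (h k) \<in> Omega d" using hk by (auto simp: State_def)
    note g_eq = P.exp_normalized_cost[OF \<alpha> i this]
    have "cond_prob M (\<lambda>\<omega>. Z (Suc k) \<omega> = (\<alpha>, scons i (snd (h k)))) (\<lambda>\<omega>. \<forall>j\<le>k. Z j \<omega> = h j)
      = exp (normalized_cost d ?A (\<alpha>, scons i (snd (h k))))"
      using Z[unfolded random_sequence_def, THEN conjunct2, THEN conjunct2, THEN conjunct2,
        rule_format, OF pos \<alpha> i] .
    then show "measure M {\<omega> \<in> space M. Z (Suc k) \<omega> = (\<alpha>, scons i (snd (h k))) \<and> (\<forall>j\<le>k. Z j \<omega> = h j)}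
        = P.g \<alpha> i (snd (h k) 0) * measure M {\<omega> \<in> space M. \<forall>j\<le>k. Z j \<omega> = h j}"
      unfolding g_eq using pos by (simp add: cond_prob_def field_simps)
  qed
  show ?thesis unfolding int by (rule KP.AE_ergodic[OF uf])
qed

end
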